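(* Let $H$ be a finitely generated subgroup of $PL_o(I)$ which has towers of arbitrarily large finite height. Then $H$ contains a subgroup isomorphic to $(\mathbf{Z}\wr)^{\infty}$ or a subgroup isomorphic to $(\wr\mathbf{Z})^{\infty}$.
   Context: $PL_o(I)$ is the group of orientation-preserving piecewise-linear homeomorphisms of $I=[0,1]$ with finitely many breaks in slope, acting on the right. An orbital of $g$ is a connected component of the set of points moved by $g$. A signed orbital of $H$ is a pair $(A,g)$, $g\in H$, $A$ an orbital of $g$. A tower of $H$ is a set of signed orbitals of $H$ with pairwise distinct orbitals which are pairwise comparable under inclusion; its height is its cardinality. Restricted wreath product: $A\wr\mathbf{Z}=(\bigoplus_{i\in\mathbf{Z}}A)\rtimes\mathbf{Z}$. Let $W_1=\mathbf{Z}$, $W_{k+1}=W_k\wr\mathbf{Z}$, with $W_k$ embedded in $W_{k+1}$ as the index-$0$ summand of the base group; $(\mathbf{Z}\wr)^{\infty}=\ldots(((\mathbf{Z}\wr\mathbf{Z})\wr\mathbf{Z})\wr\mathbf{Z})\ldots$ is the ascending union of the $W_k$. For permutation groups $(K,X)$, $(L,Y)$, the permutation wreath product $K\wr L$ is the subgroup of $\mathrm{Sym}(X\times Y)$ generated by the maps $(x,y)\mapsto(x\kappa,y)$, $(x,y')\mapsto(x,y')$ for $y'\neq y$ (for $\kappa\in K$, $y\in Y$) and $(x,y)\mapsto(x,y\lambda)$ (for $\lambda\in L$). Let $P_1=\mathbf{Z}$ acting on $X_1=\mathbf{Z}$ by translation, and $P_{k+1}=\mathbf{Z}\wr P_k$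 (permutation wreath product, $\mathbf{Z}$ acting on itself by translation) acting on $X_{k+1}=\mathbf{Z}\times X_k$, with $P_k$ embedded as the top group; $(\wr\mathbf{Z})^{\infty}=\ldots\wr(\mathbf{Z}\wr(\mathbf{Z}\wr(\mathbf{Z}\wr\mathbf{Z})))\ldots$ is the ascending union of the $P_k$. *)

theory Defs
  imports "HOL-Analysis.Analysis" "HOL-Algebra.Algebra"
begin

text \<open>Elements of PL_o(I) are represented as functions real => real that are
  orientation-preserving homeomorphisms of [0,1] with finitely many breaks in slope
  (affine on the pieces of a finite subdivision of [0,1]), extended by the identity
  outside [0,1] so that equality of functions is equality of homeomorphisms.\<close>

definition PLo :: "(real \<Rightarrow> real) set" where
  "PLo = {f. (\<forall>x. x \<notin> {0..1} \<longrightarrow> f x = x)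
           \<and> (\<exists>g. homeomorphism {0..1} {0..1} f g)
           \<and> mono_on {0..1} f
           \<and> (\<exists>xs :: real list. sorted_wrt (<) xs \<and> length xs \<ge> 2
                \<and> hd xs = 0 \<and> last xs = 1
                \<and> (\<forall>i. Suc i < length xs \<longrightarrow>
                      (\<exists>m c. \<forall>x\<in>{xs ! i .. xs ! Suc i}. f x = m * x + c)))}"

text \<open>Right action: x (g h) = (x g) h, so the product g h is "first g, then h".\<close>
definition PLgrp :: "(real \<Rightarrow> real) monoid" where
  "PLgrp = \<lparr>carrier = PLo, mult = (\<lambda>g h. h \<circ> g), one = id\<rparr>"

definition moved :: "(real \<Rightarrow> real) \<Rightarrow> real set" where
  "moved g = {x \<in> {0..1}. g x \<noteq> x}"

definition orbital :: "real set \<Rightarrow> (real \<Rightarrow> real) \<Rightarrow> bool" where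
  "orbital A g \<longleftrightarrow> (\<exists>x\<in>moved g. A = connected_component_set (moved g) x)"

definition signed_orbitals :: "(real \<Rightarrow> real) set \<Rightarrow> (real set \<times> (real \<Rightarrow> real)) set" where
  "signed_orbitals H = {(A, g). g \<in> H \<and> orbital A g}"

definition tower :: "(real \<Rightarrow> real) set \<Rightarrow> (real set \<times> (real \<Rightarrow> real)) set \<Rightarrow> bool" where
  "tower H T \<longleftrightarrow> T \<subseteq> signed_orbitals H \<and> inj_on fst T
      \<and> (\<forall>p\<in>T. \<forall>q\<in>T. fst p \<subseteq> fst q \<or> fst q \<subseteq> fst p)"

text \<open>Universal carrier type. WN l f n (tag l = level) represents the element (f, n)
  of the restricted wreath product W \<wr> Z, f finitely supported.  Elements of the form
  (delta_0 x, 0) (x in the index-0 summand) are represented by x itself, so that the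
  embedding of W_k into W_(k+1) as the index-0 summand of the base group is literally
  an inclusion of carriers.\<close>
datatype wt = WB int | WN nat "int \<Rightarrow> wt" int

fun wint :: "wt \<Rightarrow> int" where
  "wint (WB a) = a"
| "wint (WN _ _ _) = 0"

definition wdn :: "wt monoid \<Rightarrow> wt \<Rightarrow> (int \<Rightarrow> wt) \<times> int" where
  "wdn G x = (if x \<in> carrier G then ((\<lambda>i. if i = 0 then x else \<one>\<^bsub>G\<^esub>), 0)
              else (case x of WN _ f n \<Rightarrow> (f, n) | WB _ \<Rightarrow> ((\<lambda>i. \<one>\<^bsub>G\<^esub>), 0)))"

definition wup :: "nat \<Rightarrow> wt monoid \<Rightarrow> (int \<Rightarrow> wt) \<times> int \<Rightarrow> wt" where
  "wup l G p = (case p of (f, n) \<Rightarrow>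
      if n = 0 \<and> (\<forall>i. i \<noteq> 0 \<longrightarrow> f i = \<one>\<^bsub>G\<^esub>) then f 0 else WN l f n)"

text \<open>Restricted wreath product G \<wr> Z = (\<oplus>_{i\<in>Z} G) \<rtimes> Z with
  (f,m)(g,n) = (i \<mapsto> f i \<cdot> g (i - m), m + n).\<close>
definition wr_step :: "nat \<Rightarrow> wt monoid \<Rightarrow> wt monoid" where
  "wr_step l G = \<lparr>carrier = {wup l G (f, n) | f n. (\<forall>i. f i \<in> carrier G)
                                \<and> finite {i. f i \<noteq> \<one>\<^bsub>G\<^esub>}},
     mult = (\<lambda>x y. case wdn G x of (f, m) \<Rightarrow> (case wdn G y of (g, n) \<Rightarrow>
               wup l G ((\<lambda>i. f i \<otimes>\<^bsub>G\<^esub> g (i - m)), m + n))),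
     one = \<one>\<^bsub>G\<^esub>\<rparr>"

text \<open>Wg k is W_(k+1): Wg 0 = Z, Wg (Suc k) = Wg k \<wr> Z.\<close>
primrec Wg :: "nat \<Rightarrow> wt monoid" where
  "Wg 0 = \<lparr>carrier = range WB, mult = (\<lambda>x y. WB (wint x + wint y)), one = WB 0\<rparr>"
| "Wg (Suc k) = wr_step (Suc k) (Wg k)"

definition Winf :: "wt monoid" where
  "Winf = \<lparr>carrier = (\<Union>k. carrier (Wg k)),
     mult = (\<lambda>x y. x \<otimes>\<^bsub>Wg (LEAST k. x \<in> carrier (Wg k) \<and> y \<in> carrier (Wg k))\<^esub> y),
     one = WB 0\<rparr>"

text \<open>X_k = Z \<times> X_(k-1) (X_0 a point) is realised as the coordinates 0..k-1 of a
  sequence s :: nat => int (coordinate k-1 being the new Z factor); P_k acts on those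
  coordinates and fixes the others, so that the embedding of P_k into P_(k+1) as the
  top group is literally an inclusion.  Permutations act on the right.\<close>
definition SymR :: "((nat \<Rightarrow> int) \<Rightarrow> (nat \<Rightarrow> int)) monoid" where
  "SymR = \<lparr>carrier = {p. bij p}, mult = (\<lambda>g h. h \<circ> g), one = id\<rparr>"

text \<open>Base-group generator of Z \<wr> P_k: translate the Z factor by c in the copy indexed
  by the point y of X_k (y given by its coordinates 0..k-1), fix all other points.\<close>
definition pbase :: "nat \<Rightarrow> int \<Rightarrow> (nat \<Rightarrow> int) \<Rightarrow> (nat \<Rightarrow> int) \<Rightarrow> (nat \<Rightarrow> int)" where
  "pbase k c y = (\<lambda>s. if (\<forall>j<k. s j = y j) then s(k := s k + c) else s)"

primrec Pset :: "nat \<Rightarrow> ((nat \<Rightarrow> int) \<Rightarrow> (nat \<Rightarrow> int)) set" where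
  "Pset 0 = {id}"
| "Pset (Suc k) = generate SymR (Pset k \<union> {pbase k c y | c y. True})"

definition Pinf :: "((nat \<Rightarrow> int) \<Rightarrow> (nat \<Rightarrow> int)) monoid" where
  "Pinf = SymR\<lparr>carrier := (\<Union>k. Pset k)\<rparr>"

end

theory Submission
  imports Defs
begin

text \<open>A group \<open>H\<close> containing towers of every height is not solvable. An interval \<open>O\<close> complementary to the fixed set of
  a finitely generated \<open>H\<close> is either good (the derived group \<open>H'\<close> has no fixed point in \<open>O\<close>; then no term
  of the derived series has one) or bad. On a bad interval the action is controlled: some \<open>c \<in> H\<close> moves all of
  \<open>O\<close>, and the elements of \<open>H\<close> with a fixed point in \<open>O\<close> act on a fundamental domain of \<open>c\<close> through a finitely
  generated subgroup of \<open>H'\<close>. Hence if all finitely generated subgroups of \<open>H'\<close> are solvable, some term \<open>L\<close> of the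
  derived series of \<open>H\<close> is non-trivial and supported on the good intervals, where each of its elements has compact support.
  Elements of \<open>L\<close> can then move any compact part of the support of \<open>L\<close> off itself, and climbing up yields
  \<open>(\<int>\<wr>)\<^sup>\<infinity>\<close>. Otherwise there is a finitely generated non-solvable subgroup of \<open>H'\<close>; its
  support is relatively compact in that of \<open>H\<close>, so some element of \<open>H\<close> moves it off itself,
  and iterating downwards yields \<open>(\<wr>\<int>)\<^sup>\<infinity>\<close>.\<close>

subsection \<open>Groups of bijections\<close>

text \<open>Everything rests on germs: at a common fixed point the one-sided slopes are
  homomorphisms into the positive reals, so a commutator has slope 1 on both sides and is the
  identity nearby. Supports of elements of \<open>der H\<close> are therefore relatively compact in
  the complement of \<open>fixpts H\<close>. The obstacle is that the upward construction inside a
  term \<open>L\<close> of the derived series needs compactness relative to the possibly larger set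
  \<open>fixpts L\<close>; the good intervals are those where \<open>L\<close> acquires no new fixed
  points. On a bad interval the slopes at the left end decide. If they accumulate at 1, the derived
  group acts trivially there. Otherwise they form a cyclic group generated by the slope of
  \<open>c\<close>, and after correcting the generators of \<open>H\<close> by powers of
  \<open>c\<close> only finitely many of their conjugates are visible on a fundamental domain. The
  same description bounds the height of a tower by the derived length: passing to the finitely
  generated subgroup of \<open>der H\<close> costs at most one orbital, namely the whole bad
  interval.\<close>

abbreviation iv :: "('a \<Rightarrow> 'a) \<Rightarrow> 'a \<Rightarrow> 'a" where
  "iv f \<equiv> inv_into UNIV f"

text \<open>The closure conditions do not depend on the order in which products are read, so
  subgroups of \<open>PLgrp\<close> and of \<open>SymR\<close>, whose products are reversed
  compositions, are both covered.\<close>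

definition fgroup :: "('a \<Rightarrow> 'a) set \<Rightarrow> bool" where
  "fgroup H \<longleftrightarrow> id \<in> H \<and> (\<forall>f\<in>H. bij f \<and> iv f \<in> H) \<and> (\<forall>f\<in>H. \<forall>g\<in>H. f \<circ> g \<in> H)"

lemma fgroupD:
  assumes "fgroup H"
  shows "id \<in> H" "\<And>f. f \<in> H \<Longrightarrow> bij f" "\<And>f. f \<in> H \<Longrightarrow> iv f \<in> H"
    "\<And>f g. f \<in> H \<Longrightarrow> g \<in> H \<Longrightarrow> f \<circ> g \<in> H"
  using assms unfolding fgroup_def by auto

lemma bij_iv_simps:
  assumes "bij f"
  shows "f (iv f x) = x" "iv f (f x) = x"
  using assms by (simp_all add: bij_is_inj bij_is_surj surj_f_inv_f)

lemma iv_eq_iff: "bij f \<Longrightarrow> iv f x = y \<longleftrightarrow> x = f y"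
  by (metis bij_iv_simps)

inductive_set gen :: "('a \<Rightarrow> 'a) set \<Rightarrow> ('a \<Rightarrow> 'a) set" for S where
  one: "id \<in> gen S"
| incl: "s \<in> S \<Longrightarrow> s \<in> gen S"
| inverse: "f \<in> gen S \<Longrightarrow> iv f \<in> gen S"
| comp: "f \<in> gen S \<Longrightarrow> g \<in> gen S \<Longrightarrow> f \<circ> g \<in> gen S"

lemma gen_subsetI:
  assumes "id \<in> P" "S \<subseteq> P" "\<And>f. f \<in> gen S \<Longrightarrow> f \<in> P \<Longrightarrow> iv f \<in> P"
    "\<And>f g. f \<in> gen S \<Longrightarrow> f \<in> P \<Longrightarrow> g \<in> gen S \<Longrightarrow> g \<in> P \<Longrightarrow> f \<circ> g \<in> P"
  shows "gen S \<subseteq> P"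
proof
  fix f assume "f \<in> gen S"
  then show "f \<in> P" by (rule gen.induct) (use assms in blast)+
qed

lemma gen_bij: assumes "\<And>f. f \<in> S \<Longrightarrow> bij f" "f \<in> gen S" shows "bij f"
proof -
  have "gen S \<subseteq> {f. bij f}"
    by (rule gen_subsetI) (auto simp: assms bij_imp_bij_inv bij_comp)
  then show ?thesis using assms by blast
qed

lemma fgroup_gen: assumes "\<And>f. f \<in> S \<Longrightarrow> bij f" shows "fgroup (gen S)"
  unfolding fgroup_def using gen_bij[OF assms] by (blast intro: gen.intros)

lemma gen_least: assumes "fgroup H" "S \<subseteq> H" shows "gen S \<subseteq> H"
  by (rule gen_subsetI) (use assms in \<open>auto simp: fgroup_def\<close>)

lemma gen_mono: "S \<subseteq> T \<Longrightarrow> gen S \<subseteq> gen T"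
  by (rule gen_subsetI) (auto intro: gen.intros)

lemma gen_fix:
  assumes "\<And>f. f \<in> S \<Longrightarrow> bij f" "\<And>f. f \<in> S \<Longrightarrow> f x = x" "g \<in> gen S"
  shows "g x = x"
proof -
  have "gen S \<subseteq> {g. g x = x}"
    by (rule gen_subsetI) (auto simp: assms iv_eq_iff gen_bij[OF assms(1)])
  then show ?thesis using assms by blast
qed

section \<open>Commutators and the derived series\<close>

definition comm :: "('a \<Rightarrow> 'a) \<Rightarrow> ('a \<Rightarrow> 'a) \<Rightarrow> 'a \<Rightarrow> 'a" where
  "comm f g = iv f \<circ> iv g \<circ> f \<circ> g"

definition der :: "('a \<Rightarrow> 'a) set \<Rightarrow> ('a \<Rightarrow> 'a) set" where
  "der H = gen {comm f g | f g. f \<in> H \<and> g \<in> H}"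

abbreviation dseries :: "('a \<Rightarrow> 'a) set \<Rightarrow> nat \<Rightarrow> ('a \<Rightarrow> 'a) set" where
  "dseries H n \<equiv> (der ^^ n) H"

lemma comm_in: "fgroup H \<Longrightarrow> f \<in> H \<Longrightarrow> g \<in> H \<Longrightarrow> comm f g \<in> H"
  by (simp add: comm_def fgroupD)

lemma comm_in_der: "f \<in> H \<Longrightarrow> g \<in> H \<Longrightarrow> comm f g \<in> der H"
  unfolding der_def by (rule gen.incl) auto

lemma fgroup_der: "fgroup H \<Longrightarrow> fgroup (der H)"
  unfolding der_def by (rule fgroup_gen) (auto dest: comm_in fgroupD)

lemma der_subset: "fgroup H \<Longrightarrow> der H \<subseteq> H"
  unfolding der_def by (rule gen_least) (auto dest: comm_in)

lemma der_mono: "H \<subseteq> K \<Longrightarrow> der H \<subseteq> der K"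
  unfolding der_def by (rule gen_mono) auto

lemma dseries_mono: "H \<subseteq> K \<Longrightarrow> dseries H n \<subseteq> dseries K n"
  by (induction n) (auto dest: der_mono)

lemma fgroup_dseries: "fgroup H \<Longrightarrow> fgroup (dseries H n)"
  by (induction n) (auto intro: fgroup_der)

lemma dseries_Suc_right: "dseries H (Suc n) = dseries (der H) n"
  by (simp add: funpow_swap1)

lemma dseries_antimono: assumes "fgroup H" "m \<le> n" shows "dseries H n \<subseteq> dseries H m"
  using assms(2)
proof (induction n rule: dec_induct)
  case (step n)
  then show ?case using der_subset[OF fgroup_dseries[OF assms(1)], of n] by auto
qed simp

lemma dseries_subset: "fgroup H \<Longrightarrow> dseries H n \<subseteq> H"
  using dseries_antimono[of H 0 n] by simp

lemma conj_comp: "bij y \<Longrightarrow> iv y \<circ> (f \<circ> g) \<circ> y = (iv y \<circ> f \<circ> y) \<circ> (iv y \<circ> g \<circ> y)"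
  by (simp add: fun_eq_iff bij_iv_simps[of y])

lemma conj_iv: "bij y \<Longrightarrow> bij f \<Longrightarrow> iv (iv y \<circ> f \<circ> y) = iv y \<circ> iv f \<circ> y"
  by (rule ext) (simp add: iv_eq_iff bij_comp bij_imp_bij_inv bij_iv_simps[of y] bij_iv_simps[of f])

lemma conj_comm:
  assumes "bij y" "bij f" "bij g"
  shows "iv y \<circ> comm f g \<circ> y = comm (iv y \<circ> f \<circ> y) (iv y \<circ> g \<circ> y)"
  unfolding comm_def conj_comp[OF assms(1)] conj_iv[OF assms(1,2)] conj_iv[OF assms(1,3)] ..

text \<open>Conjugation by \<open>y\<close> respects composition and inverses and sends commutators
  of \<open>K\<close> to commutators of \<open>K\<close>, so it preserves the group that they
  generate.\<close>

lemma der_normal: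
  assumes "bij y" "\<And>f. f \<in> K \<Longrightarrow> iv y \<circ> f \<circ> y \<in> K" "fgroup K" "d \<in> der K"
  shows "iv y \<circ> d \<circ> y \<in> der K"
proof -
  have "der K \<subseteq> {d. iv y \<circ> d \<circ> y \<in> der K}"
    unfolding der_def
  proof (rule gen_subsetI)
    have "iv y \<circ> id \<circ> y = id" using assms(1) by (simp add: fun_eq_iff bij_iv_simps(2))
    then show "id \<in> {d. iv y \<circ> d \<circ> y \<in> gen {comm f g |f g. f \<in> K \<and> g \<in> K}}"
      unfolding mem_Collect_eq by (simp only: gen.one)
  next
    have "iv y \<circ> comm f g \<circ> y \<in> gen {comm f g |f g. f \<in> K \<and> g \<in> K}" if "f \<in> K" "g \<in> K" for f g
      unfolding conj_comm[OF assms(1) fgroupD(2)[OF assms(3) that(1)] fgroupD(2)[OF assms(3) that(2)]]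
      using assms(2) that by (intro gen.incl) blast
    then show "{comm f g |f g. f \<in> K \<and> g \<in> K} \<subseteq> {d. iv y \<circ> d \<circ> y \<in> gen {comm f g |f g. f \<in> K \<and> g \<in> K}}"
      by blast
  next
    fix f assume f: "f \<in> gen {comm f g |f g. f \<in> K \<and> g \<in> K}"
      and *: "f \<in> {d. iv y \<circ> d \<circ> y \<in> gen {comm f g |f g. f \<in> K \<and> g \<in> K}}"
    have "bij f" using f fgroup_der[OF assms(3)] fgroupD(2) unfolding der_def by blast
    from gen.inverse[OF *[unfolded mem_Collect_eq]]
    show "iv f \<in> {d. iv y \<circ> d \<circ> y \<in> gen {comm f g |f g. f \<in> K \<and> g \<in> K}}"
      unfolding mem_Collect_eq conj_iv[OF assms(1) \<open>bij f\<close>] .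
  next
    fix f g
    assume f: "f \<in> {d. iv y \<circ> d \<circ> y \<in> gen {comm f g |f g. f \<in> K \<and> g \<in> K}}"
      and g: "g \<in> {d. iv y \<circ> d \<circ> y \<in> gen {comm f g |f g. f \<in> K \<and> g \<in> K}}"
    from gen.comp[OF f[unfolded mem_Collect_eq] g[unfolded mem_Collect_eq]]
    show "f \<circ> g \<in> {d. iv y \<circ> d \<circ> y \<in> gen {comm f g |f g. f \<in> K \<and> g \<in> K}}"
      unfolding mem_Collect_eq conj_comp[OF assms(1)] .
  qed
  with assms(4) show ?thesis by blast
qed

lemma dseries_normal:
  assumes "fgroup H" "y \<in> H"
  shows "d \<in> dseries H n \<Longrightarrow> iv y \<circ> d \<circ> y \<in> dseries H n"
proof (induct n arbitrary: d)
  case 0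
  then show ?case using assms unfolding funpow_0 by (intro fgroupD(4) fgroupD(3))
next
  case (Suc n)
  from der_normal[OF fgroupD(2)[OF assms] Suc.hyps fgroup_dseries[OF assms(1)]] Suc.prems
  show ?case by (metis funpow.simps(2) comp_apply)
qed

section \<open>Integer powers of a bijection\<close>

definition ipow :: "('a \<Rightarrow> 'a) \<Rightarrow> int \<Rightarrow> 'a \<Rightarrow> 'a" where
  "ipow f n = (if n \<ge> 0 then f ^^ nat n else iv f ^^ nat (- n))"

lemma ipow_0 [simp]: "ipow f 0 = id"
  by (simp add: ipow_def)

lemma ipow_1 [simp]: "ipow f 1 = f"
  by (simp add: ipow_def)

lemma ipow_of_nat [simp]: "ipow f (int n) = f ^^ n"
  by (simp add: ipow_def)

lemma ipow_Suc: assumes "bij f" shows "ipow f (n + 1) x = f (ipow f n x)"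
proof (cases "n \<ge> 0")
  case True
  then show ?thesis by (simp add: ipow_def nat_add_distrib)
next
  case False
  then have "nat (- n) = Suc (nat (- (n + 1)))" by simp
  then have "ipow f n x = iv f (ipow f (n + 1) x)"
    using False by (cases "n + 1 = 0") (auto simp: ipow_def)
  then show ?thesis using assms by (simp add: bij_iv_simps[of f])
qed

lemma ipow_add: assumes "bij f" shows "ipow f (m + n) x = ipow f m (ipow f n x)"
proof (induction m rule: int_induct[where k = 0])
  case base
  then show ?case by simp
next
  case (step1 i)
  have "ipow f (i + 1 + n) x = ipow f ((i + n) + 1) x" by (simp add: ac_simps)
  then show ?case using step1 by (simp add: ipow_Suc[OF assms])
next
  case (step2 i)
  have "f (ipow f (i - 1 + n) x) = ipow f (i + n) x"
    using ipow_Suc[OF assms, of "i - 1 + n" x] by (simp add: algebra_simps)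
  moreover have "f (ipow f (i - 1) (ipow f n x)) = ipow f i (ipow f n x)"
    using ipow_Suc[OF assms, of "i - 1"] by simp
  ultimately show ?case using step2 assms by (metis bij_iv_simps(2))
qed

lemma ipow_in: assumes "fgroup H" "f \<in> H" shows "ipow f n \<in> H"
proof -
  have "g ^^ m \<in> H" if "g \<in> H" for g and m :: nat
    using that assms by (induction m) (auto dest: fgroupD)
  then show ?thesis using assms by (simp add: ipow_def fgroupD)
qed

lemma ipow_inverse [simp]: assumes "bij f"
  shows "ipow f (- n) (ipow f n x) = x" "ipow f n (ipow f (- n) x) = x"
  unfolding ipow_add[OF assms, symmetric] by simp_all

lemma bij_ipow: assumes "bij f" shows "bij (ipow f n)"
  by (rule bij_betw_byWitness[where f' = "ipow f (- n)"]) (use assms in auto)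

lemma iv_ipow: assumes "bij f" shows "iv (ipow f n) = ipow f (- n)"
  using assms by (simp add: fun_eq_iff iv_eq_iff bij_ipow)

lemma ipow_fix: assumes "bij f" "f x = x" shows "ipow f n x = x"
proof (induction n rule: int_induct[where k = 0])
  case (step1 i)
  then show ?case using assms ipow_Suc by metis
next
  case (step2 i)
  have "f (ipow f (i - 1) x) = x" using ipow_Suc[OF assms(1), of "i - 1" x] step2 by simp
  then show ?case using assms by (metis bij_iv_simps(2))
qed simp

subsection \<open>Piecewise linear groups and their fixed points\<close>

text \<open>Of the piecewise linearity only the existence of affine one-sided germs is used.\<close>

definition PLa :: "(real \<Rightarrow> real) set" where
  "PLa = {f. strict_mono f \<and> bij f \<and> continuous_on UNIV f \<and> (\<forall>x. x \<notin> {0..1} \<longrightarrow> f x = x)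
    \<and> (\<forall>p. \<forall>\<sigma>\<in>{1,-1}. \<exists>m>0. \<exists>e>0. \<forall>t\<in>{0..e}. f (p + \<sigma> * t) = f p + \<sigma> * (m * t))}"

definition plgroup :: "(real \<Rightarrow> real) set \<Rightarrow> bool" where
  "plgroup H \<longleftrightarrow> fgroup H \<and> H \<subseteq> PLa"

definition fixpts :: "('a \<Rightarrow> 'a) set \<Rightarrow> 'a set" where
  "fixpts H = {x. \<forall>g\<in>H. g x = x}"

definition mv :: "('a \<Rightarrow> 'a) \<Rightarrow> 'a set" where
  "mv g = {x. g x \<noteq> x}"

lemma PLaD:
  assumes "f \<in> PLa"
  shows "strict_mono f" "bij f" "continuous_on A f" "x \<notin> {0..1} \<Longrightarrow> f x = x"
    "\<sigma> \<in> {1,-1} \<Longrightarrow> \<exists>m>0. \<exists>e>0. \<forall>t\<in>{0..e}. f (p + \<sigma> * t) = f p + \<sigma> * (m * t)"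
  using assms continuous_on_subset[of UNIV f A] unfolding PLa_def by auto

lemma PLa_less [simp]: "f \<in> PLa \<Longrightarrow> f x < f y \<longleftrightarrow> x < y"
  by (rule strict_mono_less[OF PLaD(1)])

lemma PLa_le [simp]: "f \<in> PLa \<Longrightarrow> f x \<le> f y \<longleftrightarrow> x \<le> y"
  by (rule strict_mono_less_eq[OF PLaD(1)])

lemma PLa_eq [simp]: "f \<in> PLa \<Longrightarrow> f x = f y \<longleftrightarrow> x = y"
  by (rule strict_mono_eq[OF PLaD(1)])

text \<open>Points outside the unit interval are fixed. Injectivity therefore keeps the image of 0
  from being negative, and a preimage of 0 cannot be negative either; the end 1 is
  symmetric.\<close>

lemma PLa_01: assumes "f \<in> PLa" shows "f 0 = 0" "f 1 = 1"
proof -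
  have o: "f x = x" if "x < 0 \<or> 1 < x" for x using PLaD(4)[OF assms] that by auto
  have "\<not> f 0 < 0"
  proof
    assume h: "f 0 < 0"
    then have "f (f 0) = f 0" by (intro o) auto
    then show False using assms h by simp
  qed
  moreover obtain z where z: "f z = 0" using PLaD(2)[OF assms] by (metis bij_pointE)
  moreover have "\<not> z < 0" using o[of z] z by auto
  ultimately show "f 0 = 0" using PLa_le[OF assms, of 0 z] by auto
  have "\<not> f 1 > 1"
  proof
    assume h: "f 1 > 1"
    then have "f (f 1) = f 1" by (intro o) auto
    then show False using assms h by simp
  qed
  moreover obtain w where w: "f w = 1" using PLaD(2)[OF assms] by (metis bij_pointE)
  moreover have "\<not> w > 1" using o[of w] w by auto
  ultimately show "f 1 = 1" using PLa_le[OF assms, of w 1] by auto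
qed

lemma PLa_range: "f \<in> PLa \<Longrightarrow> x \<in> {0..1} \<Longrightarrow> f x \<in> {0..1}"
  using PLa_le[of f 0 x] PLa_le[of f x 1] by (simp add: PLa_01)

lemma PLa_mv: "f \<in> PLa \<Longrightarrow> mv f \<subseteq> {0<..<1}"
  unfolding mv_def using PLaD(4)[of f] PLa_01[of f] by force

lemma plgroupD:
  assumes "plgroup H"
  shows "fgroup H" "H \<subseteq> PLa" "f \<in> H \<Longrightarrow> f \<in> PLa" "id \<in> H" "f \<in> H \<Longrightarrow> bij f"
    "f \<in> H \<Longrightarrow> iv f \<in> H" "f \<in> H \<Longrightarrow> g \<in> H \<Longrightarrow> f \<circ> g \<in> H" "f \<in> H \<Longrightarrow> ipow f n \<in> H"
  using assms fgroupD[of H] ipow_in[of H f n] unfolding plgroup_def by auto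

lemma plgroup_sub: "plgroup H \<Longrightarrow> fgroup K \<Longrightarrow> K \<subseteq> H \<Longrightarrow> plgroup K"
  unfolding plgroup_def by auto

lemma plgroup_gen: assumes "plgroup H" "S \<subseteq> H" shows "plgroup (gen S)" "gen S \<subseteq> H"
proof -
  have "fgroup (gen S)" by (rule fgroup_gen) (use assms plgroupD(5) in blast)
  moreover show "gen S \<subseteq> H" by (rule gen_least) (use assms plgroupD in blast)+
  ultimately show "plgroup (gen S)" using assms plgroup_sub by blast
qed

lemma plgroup_dseries: "plgroup H \<Longrightarrow> plgroup (dseries H n)"
  using plgroup_sub fgroup_dseries dseries_subset plgroupD(1) by metis

lemma plgroup_der: "plgroup H \<Longrightarrow> plgroup (der H)"
  using plgroup_dseries[of H 1] by simp

lemma fixpts_gen: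
  assumes "\<And>f. f \<in> S \<Longrightarrow> bij f"
  shows "fixpts (gen S) = {x. \<forall>s\<in>S. s x = x}"
  unfolding fixpts_def using gen_fix[OF assms] gen.incl[of _ S] by blast

lemma fixpts_closed: assumes "plgroup H" shows "closed (fixpts H)"
proof -
  have "closed {x. g x = x}" if "g \<in> H" for g
    using PLaD(3)[OF plgroupD(3)[OF assms that]] by (intro closed_Collect_eq) (auto intro: continuous_on_id)
  moreover have "fixpts H = (\<Inter>g\<in>H. {x. g x = x})" unfolding fixpts_def by auto
  ultimately show ?thesis by auto
qed

lemma fixpts_outside: "plgroup H \<Longrightarrow> x \<le> 0 \<or> 1 \<le> x \<Longrightarrow> x \<in> fixpts H"
  unfolding fixpts_def using PLaD(4)[of _ x] PLa_01 plgroupD(3)[of H] by force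

lemma fixpts_less:
  assumes "plgroup H" "p \<in> fixpts H" "g \<in> H"
  shows "g x < p \<longleftrightarrow> x < p" "p < g x \<longleftrightarrow> p < x" "g x = p \<longleftrightarrow> x = p"
proof -
  have "g p = p" "g \<in> PLa" using assms plgroupD by (auto simp: fixpts_def)
  then show "g x < p \<longleftrightarrow> x < p" "p < g x \<longleftrightarrow> p < x" "g x = p \<longleftrightarrow> x = p"
    using PLa_less[of g x p] PLa_less[of g p x] PLa_eq[of g x p] by auto
qed

lemma fixpts_mono: "K \<subseteq> H \<Longrightarrow> fixpts H \<subseteq> fixpts K"
  unfolding fixpts_def by auto

lemma cont_mono_Inf:
  assumes "f \<in> PLa" "A \<noteq> {}" "bdd_below A" "f ` A = A"
  shows "f (Inf A) = Inf A"
proof -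
  have "f (Inf A) = Inf (f ` A)"
    by (rule continuous_at_Inf_mono)
       (use assms PLaD(1)[of f] PLaD(3)[of f UNIV] in \<open>auto simp: strict_mono_mono continuous_on_eq_continuous_within intro: continuous_at_imp_continuous_at_within\<close>)
  then show ?thesis using assms by simp
qed

lemma cont_mono_Sup:
  assumes "f \<in> PLa" "A \<noteq> {}" "bdd_above A" "f ` A = A"
  shows "f (Sup A) = Sup A"
proof -
  have "f (Sup A) = Sup (f ` A)"
    by (rule continuous_at_Sup_mono)
       (use assms PLaD(1)[of f] PLaD(3)[of f UNIV] in \<open>auto simp: strict_mono_mono continuous_on_eq_continuous_within intro: continuous_at_imp_continuous_at_within\<close>)
  then show ?thesis using assms by simp
qed

lemma orbit_image:
  assumes "fgroup H" "g \<in> H"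
  shows "g ` {h x | h. h \<in> H} = {h x | h. h \<in> H}"
proof (intro equalityI subsetI)
  fix y assume "y \<in> g ` {h x | h. h \<in> H}"
  then obtain h where "h \<in> H" "y = (g \<circ> h) x" by auto
  then show "y \<in> {h x | h. h \<in> H}" using fgroupD(4)[OF assms \<open>h \<in> H\<close>] by blast
next
  fix y assume "y \<in> {h x | h. h \<in> H}"
  then obtain h where h: "h \<in> H" "y = h x" by auto
  have "iv g \<circ> h \<in> H" using assms h by (simp add: fgroupD)
  moreover have "y = g ((iv g \<circ> h) x)" using h fgroupD(2)[OF assms] by (simp add: bij_iv_simps(1)[of g "h x"])
  ultimately show "y \<in> g ` {h x | h. h \<in> H}" by blast
qed

text \<open>Each element permutes the orbit, is increasing and continuous, and so fixes the infimum
  and the supremum of the orbit. This is the main source of common fixed points.\<close>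

lemma orbit_ends:
  assumes "plgroup H" "x \<in> {0..1}"
  defines "A \<equiv> {h x | h. h \<in> H}"
  shows "Inf A \<in> fixpts H" "Sup A \<in> fixpts H" "Inf A \<le> x" "x \<le> Sup A"
    "\<And>u. Inf A < u \<Longrightarrow> \<exists>h\<in>H. h x < u" "\<And>u. u < Sup A \<Longrightarrow> \<exists>h\<in>H. u < h x"
    "Inf A \<in> closure A" "Sup A \<in> closure A"
proof -
  have x: "x \<in> A" unfolding A_def mem_Collect_eq
    by (rule exI[of _ id]) (simp add: plgroupD(4)[OF assms(1)])
  have "A \<subseteq> {0..1}" unfolding A_def using PLa_range plgroupD(3)[OF assms(1)] assms(2) by auto
  then have b: "bdd_below A" "bdd_above A" by (auto intro: bdd_below_mono bdd_above_mono)
  have im: "g ` A = A" if "g \<in> H" for g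
    unfolding A_def by (rule orbit_image[OF plgroupD(1)[OF assms(1)] that])
  show "Inf A \<in> fixpts H" "Sup A \<in> fixpts H"
    unfolding fixpts_def mem_Collect_eq
    by (intro ballI cont_mono_Inf cont_mono_Sup b im plgroupD(3)[OF assms(1)]; use x in blast)+
  show "Inf A \<le> x" "x \<le> Sup A" using x b cInf_lower cSup_upper by auto
  show "\<exists>h\<in>H. h x < u" if "Inf A < u" for u using cInf_lessD[OF _ that] x unfolding A_def by blast
  show "\<exists>h\<in>H. u < h x" if "u < Sup A" for u using less_cSupD[OF _ that] x unfolding A_def by blast
  show "Inf A \<in> closure A" "Sup A \<in> closure A"
    using closure_contains_Inf[OF _ b(1)] closure_contains_Sup[OF _ b(2)] x by blast+
qed

text \<open>The slope at the fixed point \<open>p\<close> on the right (\<open>\<sigma> = 1\<close>) or on the left (\<open>\<sigma> = -1\<close>).\<close>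

definition slope :: "real \<Rightarrow> real \<Rightarrow> (real \<Rightarrow> real) \<Rightarrow> real \<Rightarrow> bool" where
  "slope \<sigma> p f m \<longleftrightarrow> (\<exists>e>0. \<forall>t\<in>{0..e}. f (p + \<sigma> * t) = p + \<sigma> * (m * t))"

lemma slope_ex: assumes "f \<in> PLa" "f p = p" "\<sigma> \<in> {1,-1}" obtains m where "m > 0" "slope \<sigma> p f m"
  using PLaD(5)[OF assms(1,3), of p] assms(2) unfolding slope_def by metis

lemma slope_unique: assumes "slope \<sigma> p f m" "slope \<sigma> p f n" "\<sigma> \<noteq> 0" shows "m = n"
proof -
  obtain e e' where e: "e > 0" "\<forall>t\<in>{0..e}. f (p + \<sigma> * t) = p + \<sigma> * (m * t)"
    "e' > 0" "\<forall>t\<in>{0..e'}. f (p + \<sigma> * t) = p + \<sigma> * (n * t)"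
    using assms unfolding slope_def by auto
  define t where "t = min e e'"
  have "f (p + \<sigma> * t) = p + \<sigma> * (m * t)" "f (p + \<sigma> * t) = p + \<sigma> * (n * t)" "t > 0"
    using e(2)[rule_format, of t] e(4)[rule_format, of t] e(1,3) by (auto simp: t_def)
  then have "\<sigma> * (m * t) = \<sigma> * (n * t)" by linarith
  with \<open>t > 0\<close> show ?thesis using assms(3) by simp
qed

lemma slope_comp: assumes "slope \<sigma> p f m" "slope \<sigma> p g n" "n > 0" shows "slope \<sigma> p (f \<circ> g) (m * n)"
proof -
  obtain e e' where e: "e > 0" "\<forall>t\<in>{0..e}. f (p + \<sigma> * t) = p + \<sigma> * (m * t)"
    "e' > 0" "\<forall>t\<in>{0..e'}. g (p + \<sigma> * t) = p + \<sigma> * (n * t)"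
    using assms unfolding slope_def by auto
  define d where "d = min e' (e / n)"
  have "d > 0" using e assms by (simp add: d_def)
  moreover have "(f \<circ> g) (p + \<sigma> * t) = p + \<sigma> * (m * n * t)" if "t \<in> {0..d}" for t
  proof -
    have "g (p + \<sigma> * t) = p + \<sigma> * (n * t)" using that e(4) by (simp add: d_def)
    moreover have "n * t \<in> {0..e}" using that assms(3) unfolding d_def by (auto simp: field_simps)
    ultimately show ?thesis using e(2) by (simp add: mult.assoc)
  qed
  ultimately show ?thesis unfolding slope_def by blast
qed

lemma slope_iv: assumes "bij f" "slope \<sigma> p f m" "m > 0" shows "slope \<sigma> p (iv f) (1 / m)"
proof -
  obtain e where e: "e > 0" "\<forall>t\<in>{0..e}. f (p + \<sigma> * t) = p + \<sigma> * (m * t)"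
    using assms unfolding slope_def by auto
  have "iv f (p + \<sigma> * t) = p + \<sigma> * (1 / m * t)" if "t \<in> {0..e * m}" for t
  proof -
    have "t / m \<in> {0..e}" using that assms(3) by (auto simp: field_simps)
    then have "f (p + \<sigma> * (t / m)) = p + \<sigma> * (m * (t / m))" using e(2) by blast
    then have "f (p + \<sigma> * (t / m)) = p + \<sigma> * t" using assms(3) by simp
    then show ?thesis using assms(1) by (simp add: iv_eq_iff)
  qed
  then show ?thesis unfolding slope_def using e(1) assms(3) by (intro exI[of _ "e * m"]) auto
qed

lemma slope_id: "slope \<sigma> p id 1"
  unfolding slope_def by (auto intro: exI[of _ 1])

lemma slope_ipow:
  assumes "bij f" "slope \<sigma> p f m" "m > 0"
  shows "slope \<sigma> p (ipow f n) (m powi n)"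
proof -
  have *: "slope \<sigma> p (g ^^ k) (l ^ k)" if "slope \<sigma> p g l" "l > 0" for g l and k :: nat
  proof (induct k)
    case 0
    show ?case using slope_id by (simp add: id_def)
  next
    case (Suc k)
    from slope_comp[OF that(1) Suc zero_less_power[OF that(2)]] show ?case unfolding funpow.simps power_Suc .
  qed
  show ?thesis
  proof (cases "n \<ge> 0")
    case True
    then show ?thesis using *[OF assms(2,3)] by (simp add: ipow_def power_int_def)
  next
    case False
    then show ?thesis using *[OF slope_iv[OF assms]] assms(3)
      by (simp add: ipow_def power_int_def inverse_eq_divide)
  qed
qed

text \<open>The slope on one side of a common fixed point is multiplicative with values in an
  abelian group, hence equal to 1 on every commutator.\<close>

lemma der_slope:
  assumes "plgroup H" "p \<in> fixpts H" "d \<in> der H" "\<sigma> \<in> {1,-1}"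
  shows "slope \<sigma> p d 1"
proof -
  have "der H \<subseteq> {d. slope \<sigma> p d 1}"
    unfolding der_def
  proof (rule gen_subsetI)
    show "id \<in> {d. slope \<sigma> p d 1}" using slope_id by blast
  next
    have "slope \<sigma> p (comm f g) 1" if fg: "f \<in> H" "g \<in> H" for f g
    proof -
      obtain m where m: "m > 0" "slope \<sigma> p f m"
        using slope_ex[of f p \<sigma>] assms fg plgroupD(3) unfolding fixpts_def by auto
      obtain n where n: "n > 0" "slope \<sigma> p g n"
        using slope_ex[of g p \<sigma>] assms fg plgroupD(3) unfolding fixpts_def by auto
      have b: "bij f" "bij g" using fg assms plgroupD by auto
      have "slope \<sigma> p (iv f \<circ> iv g \<circ> f \<circ> g) (1 / m * (1 / n) * m * n)"
        by (intro slope_comp slope_iv b m n) (use m n in auto)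
      then show ?thesis unfolding comm_def using m n by simp
    qed
    then show "{comm f g |f g. f \<in> H \<and> g \<in> H} \<subseteq> {d. slope \<sigma> p d 1}" by blast
  next
    fix f assume "f \<in> gen {comm f g |f g. f \<in> H \<and> g \<in> H}" "f \<in> {d. slope \<sigma> p d 1}"
    then show "iv f \<in> {d. slope \<sigma> p d 1}"
      using slope_iv[of f \<sigma> p 1] plgroupD(5)[OF plgroup_der[OF assms(1)], of f] unfolding der_def by auto
  next
    fix f g assume "f \<in> {d. slope \<sigma> p d 1}" "g \<in> {d. slope \<sigma> p d 1}"
    then show "f \<circ> g \<in> {d. slope \<sigma> p d 1}"
      using slope_comp[of \<sigma> p f 1 g 1] by auto
  qed
  then show ?thesis using assms(3) by auto
qed

text \<open>Near \<open>p\<close> on this side \<open>f x - x = (m - 1) * (x - p)\<close>, so an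
  affine germ is either the identity or has no fixed point besides \<open>p\<close>.\<close>

lemma slope_side:
  assumes "slope \<sigma> p f m" "\<sigma> \<in> {1,-1}"
  obtains e where "e > 0" "m = 1 \<longrightarrow> (\<forall>x. 0 \<le> \<sigma> * (x - p) \<longrightarrow> \<sigma> * (x - p) \<le> e \<longrightarrow> f x = x)"
    "m \<noteq> 1 \<longrightarrow> (\<forall>x. 0 < \<sigma> * (x - p) \<longrightarrow> \<sigma> * (x - p) \<le> e \<longrightarrow> f x \<noteq> x)"
proof -
  obtain e where e: "e > 0" "\<forall>t\<in>{0..e}. f (p + \<sigma> * t) = p + \<sigma> * (m * t)"
    using assms unfolding slope_def by auto
  have ss: "\<sigma> * (\<sigma> * z) = z" for z using assms(2) by auto
  have *: "f x = p + m * (x - p)" if "0 \<le> \<sigma> * (x - p)" "\<sigma> * (x - p) \<le> e" for x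
  proof -
    have "f (p + \<sigma> * (\<sigma> * (x - p))) = p + \<sigma> * (m * (\<sigma> * (x - p)))" using e that by auto
    then show ?thesis using ss[of "x - p"] ss[of "m * (x - p)"] by (simp add: algebra_simps)
  qed
  show thesis
  proof (rule that[OF e(1)]; intro impI allI)
    show "f x = x" if "m = 1" "0 \<le> \<sigma> * (x - p)" "\<sigma> * (x - p) \<le> e" for x using * that by simp
    show "f x \<noteq> x" if "m \<noteq> 1" "0 < \<sigma> * (x - p)" "\<sigma> * (x - p) \<le> e" for x
    proof
      assume "f x = x"
      then have "(m - 1) * (x - p) = 0" using *[of x] that by (simp add: algebra_simps)
      then show False using that by auto
    qed
  qed
qed

lemma slope_one_near:
  assumes "slope 1 p f 1" "slope (-1) p f 1"
  obtains e where "e > 0" "\<And>x. \<bar>x - p\<bar> \<le> e \<Longrightarrow> f x = x"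
proof -
  obtain e where e: "e > 0" "\<And>x. 0 \<le> x - p \<Longrightarrow> x - p \<le> e \<Longrightarrow> f x = x"
    using slope_side[OF assms(1)] by auto
  obtain e' where e': "e' > 0" "\<And>x. 0 \<le> p - x \<Longrightarrow> p - x \<le> e' \<Longrightarrow> f x = x"
    using slope_side[OF assms(2)] by auto
  show thesis
    by (rule that[of "min e e'"]) (use e e' in \<open>auto simp: abs_if split: if_splits\<close>)
qed

lemma not_in_closure_mv:
  fixes f :: "real \<Rightarrow> real"
  assumes "e > 0" "\<And>x. \<bar>x - p\<bar> \<le> e \<Longrightarrow> f x = x"
  shows "p \<notin> closure (mv f)"
proof
  assume "p \<in> closure (mv f)"
  then obtain y where "y \<in> mv f" "dist y p < e" using assms(1) by (meson closure_approachable)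
  then show False using assms(2)[of y] by (auto simp: mv_def dist_real_def)
qed

text \<open>Slope 1 on both sides makes \<open>d\<close> the identity near each common fixed point
  of \<open>H\<close>. This turns the support of \<open>d\<close> into a set to which
  \<open>clear_compact\<close> applies.\<close>

lemma der_closure_mv:
  assumes "plgroup H" "d \<in> der H"
  shows "closure (mv d) \<inter> fixpts H = {}"
proof -
  have "p \<notin> closure (mv d)" if "p \<in> fixpts H" for p
  proof -
    have "slope 1 p d 1" "slope (-1) p d 1" using der_slope[OF assms(1) that assms(2)] by auto
    then obtain e where "e > 0" "\<And>x. \<bar>x - p\<bar> \<le> e \<Longrightarrow> d x = x" by (rule slope_one_near) blast
    then show ?thesis by (rule not_in_closure_mv)
  qed
  then show ?thesis by auto
qed

text \<open>Infinitely many such points would accumulate at a fixed point \<open>l\<close>. On each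
  side of \<open>l\<close> the germ is the identity, which leaves no moved points nearby, or moves
  every point, which leaves no fixed ones.\<close>

lemma finite_frontier_fix:
  assumes "f \<in> PLa"
  shows "finite {e. f e = e \<and> e \<in> closure (mv f)}"
proof (rule ccontr)
  define Z where "Z = {e. f e = e \<and> e \<in> closure (mv f)}"
  assume "infinite {e. f e = e \<and> e \<in> closure (mv f)}"
  then have inf: "infinite Z" by (simp add: Z_def)
  have "closure (mv f) \<subseteq> {0..1}"
    using PLa_mv[OF assms] by (intro closure_minimal) auto
  then have "Z \<subseteq> {0..1}" by (auto simp: Z_def)
  then have "bounded Z" by (rule bounded_subset[OF bounded_closed_interval])
  with inf obtain l where l: "l islimpt Z" using bounded_infinite_imp_islimpt[of Z Z] by blast
  have "closed {e. f e = e}"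
    using PLaD(3)[OF assms] by (intro closed_Collect_eq) (auto intro: continuous_on_id)
  moreover have "l islimpt {e. f e = e}" using l by (rule islimpt_subset) (auto simp: Z_def)
  ultimately have "f l = l" unfolding closed_limpt by blast
  have *: "\<exists>e>0. \<forall>x. 0 < \<sigma> * (x - l) \<longrightarrow> \<sigma> * (x - l) < e \<longrightarrow> x \<notin> Z" if s: "\<sigma> \<in> {1,-1}" for \<sigma>
  proof -
    obtain m where m: "slope \<sigma> l f m" using slope_ex[OF assms \<open>f l = l\<close> s] by blast
    obtain e where e: "e > 0" "m = 1 \<longrightarrow> (\<forall>x. 0 \<le> \<sigma> * (x - l) \<longrightarrow> \<sigma> * (x - l) \<le> e \<longrightarrow> f x = x)"
      "m \<noteq> 1 \<longrightarrow> (\<forall>x. 0 < \<sigma> * (x - l) \<longrightarrow> \<sigma> * (x - l) \<le> e \<longrightarrow> f x \<noteq> x)"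
      by (rule slope_side[OF m s])
    have "x \<notin> Z" if x: "0 < \<sigma> * (x - l)" "\<sigma> * (x - l) < e" for x
    proof (cases "m = 1")
      case True
      \<comment> \<open>The largest radius for which the neighbourhood of \<open>x\<close> stays in
        the affine piece next to \<open>l\<close>.\<close>
      define d where "d = min (\<sigma> * (x - l)) (e - \<sigma> * (x - l))"
      have "f y = y" if "\<bar>y - x\<bar> \<le> d" for y
      proof (rule e(2)[rule_format, OF True])
        have "\<bar>\<sigma> * (y - l) - \<sigma> * (x - l)\<bar> \<le> d" using that s by (auto simp: abs_if split: if_splits)
        then show "0 \<le> \<sigma> * (y - l)" "\<sigma> * (y - l) \<le> e" unfolding d_def by linarith+
      qed
      moreover have "d > 0" using x by (simp add: d_def)
      ultimately have "x \<notin> closure (mv f)" using not_in_closure_mv[of d x f] by blast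
      then show ?thesis by (simp add: Z_def)
    next
      case False
      then have "f x \<noteq> x" using e(3) x by fastforce
      then show ?thesis by (simp add: Z_def)
    qed
    then show ?thesis by (intro exI[of _ e] conjI allI impI e(1))
  qed
  obtain e where e: "e > 0" "\<forall>x. 0 < 1 * (x - l) \<longrightarrow> 1 * (x - l) < e \<longrightarrow> x \<notin> Z"
    using *[of 1] by blast
  obtain e' where e': "e' > 0" "\<forall>x. 0 < (-1) * (x - l) \<longrightarrow> (-1) * (x - l) < e' \<longrightarrow> x \<notin> Z"
    using *[of "-1"] by blast
  have "min e e' > 0" using e e' by simp
  then obtain y where y: "y \<in> Z" "y \<noteq> l" "dist y l < min e e'"
    using l unfolding islimpt_approachable by blast
  show False
  proof (cases "y < l")
    case True
    then show ?thesis using e'(2)[rule_format, of y] y by (auto simp: dist_real_def)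
  next
    case False
    then show ?thesis using e(2)[rule_format, of y] y by (auto simp: dist_real_def)
  qed
qed

subsection \<open>Clearing compact sets\<close>

text \<open>The infimum of the orbit of \<open>t\<close> is a fixed point not above
  \<open>t\<close>, so it lies below the whole interval, and the orbit comes arbitrarily close to
  it.\<close>

lemma clear_one:
  assumes "plgroup H" "{s..t} \<inter> fixpts H = {}" "s \<le> t"
  obtains g where "g \<in> H" "g t < s"
proof -
  have "t \<notin> fixpts H" using assms by auto
  then have t: "t \<in> {0..1}" using fixpts_outside[OF assms(1), of t] by force
  let ?i = "Inf {h t | h. h \<in> H}"
  have "?i \<in> fixpts H" "?i \<le> t" using orbit_ends[OF assms(1) t] by auto
  then have "?i < s" using assms(2) by (meson atLeastAtMost_iff disjoint_iff not_le)
  then show thesis using orbit_ends(5)[OF assms(1) t] that by blast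
qed

text \<open>If \<open>f\<close> clears the hulls of \<open>g x\<close> and \<open>x\<close> on the other intervals, then both \<open>f \<circ> g\<close> and
  \<open>iv f \<circ> g\<close> clear them, and one of the two does not undo the effect of \<open>g\<close> on the last interval.\<close>

lemma clear_list:
  assumes "plgroup H"
  shows "(\<forall>(s, t)\<in>set ps. s \<le> t \<and> {s..t} \<inter> fixpts H = {}) \<Longrightarrow>
    \<exists>g\<in>H. \<forall>(s, t)\<in>set ps. g t < s \<or> t < g s"
proof (induct "length ps" arbitrary: ps)
  case 0
  then show ?case using plgroupD(4)[OF assms] by auto
next
  case (Suc n)
  then obtain s t qs where p: "ps = (s, t) # qs" "n = length qs"
    by (cases ps) auto
  have st: "s \<le> t" "{s..t} \<inter> fixpts H = {}" using Suc.prems p by auto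
  obtain g where g: "g \<in> H" "g t < s" using clear_one[OF assms st(2,1)] .
  define rs where "rs = map (\<lambda>(u, v). (min u (g u), max v (g v))) qs"
  have "\<exists>f\<in>H. \<forall>(s, t)\<in>set rs. f t < s \<or> t < f s"
  proof (rule Suc.hyps)
    show "n = length rs" using p by (simp add: rs_def)
    have "min u (g u) \<le> max v (g v) \<and> {min u (g u)..max v (g v)} \<inter> fixpts H = {}"
      if uv: "(u, v) \<in> set qs" for u v
    proof -
      have h: "u \<le> v" "{u..v} \<inter> fixpts H = {}" using Suc.prems p uv by auto
      \<comment> \<open>A fixed point lies on the same side of a point and of its image, so the
        interval and its image lie on the same side of \<open>q\<close> and their hull avoids
        it.\<close>
      have False if q: "q \<in> fixpts H" "min u (g u) \<le> q" "q \<le> max v (g v)" for q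
      proof -
        have "\<not> (u \<le> q \<and> q \<le> v)" using h(2) q(1) by auto
        then have "q < u \<or> v < q" by linarith
        then show False
          using q fixpts_less[OF assms q(1) g(1), of u] fixpts_less[OF assms q(1) g(1), of v] h(1)
          by (auto simp: min_def max_def split: if_splits)
      qed
      then show ?thesis using h(1) by auto
    qed
    then show "\<forall>(s, t)\<in>set rs. s \<le> t \<and> {s..t} \<inter> fixpts H = {}" unfolding rs_def by auto
  qed
  then obtain f where f: "f \<in> H" "\<And>u v. (u, v) \<in> set qs \<Longrightarrow> f (max v (g v)) < min u (g u) \<or> max v (g v) < f (min u (g u))"
    unfolding rs_def by fastforce
  have H: "f \<in> PLa" "g \<in> PLa" "iv f \<in> PLa" "iv f \<in> H" "bij f"
    using f g plgroupD[OF assms] by auto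
  \<comment> \<open>The inverse of \<open>f\<close> satisfies the same alternative with its two
    cases exchanged.\<close>
  have iv: "iv f x < y \<longleftrightarrow> x < f y" "y < iv f x \<longleftrightarrow> f y < x" for x y
    using PLa_less[OF H(1), of "iv f x" y] PLa_less[OF H(1), of y "iv f x"] by (simp_all add: bij_iv_simps(1)[OF H(5)])
  have *: "k (g v) < u \<or> v < k (g u)" if "(u, v) \<in> set qs" "k = f \<or> k = iv f" for u v k
  proof -
    have "k \<in> PLa" using that H by auto
    have k: "k (max v (g v)) < min u (g u) \<or> max v (g v) < k (min u (g u))"
      using f(2)[OF that(1)] that(2) iv by blast
    have "k (g v) \<le> k (max v (g v))" "k (min u (g u)) \<le> k (g u)"
      using \<open>k \<in> PLa\<close> by simp_all
    with k show ?thesis by linarith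
  qed
  have "f (g t) \<le> g t \<or> iv f (g t) \<le> g t" using iv(2)[of "g t" "g t"] by linarith
  then obtain k where k: "k = f \<or> k = iv f" "k (g t) \<le> g t" by blast
  show ?case
  proof (rule bexI)
    show "k \<circ> g \<in> H" using k H f g plgroupD(7)[OF assms] by blast
    show "\<forall>(s, t)\<in>set ps. (k \<circ> g) t < s \<or> t < (k \<circ> g) s"
      using * k g(2) unfolding p by fastforce
  qed
qed

lemma ipow_less:
  assumes "g \<in> PLa" "g t < s" "s \<le> t" "n > 0" shows "ipow g n t < s"
proof -
  have "(g ^^ Suc k) t < s" for k
  proof (induct k)
    case (Suc k)
    have "(g ^^ Suc k) t < t" using Suc assms(3) by linarith
    then have "g ((g ^^ Suc k) t) < g t" unfolding PLa_less[OF assms(1)] .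
    then show ?case using assms(2) unfolding funpow.simps comp_apply by linarith
  qed (use assms in simp)
  from this[of "nat n - 1"] assms show ?thesis by (simp add: ipow_def)
qed

lemma ipow_greater:
  assumes "g \<in> PLa" "t < g s" "s \<le> t" "n > 0" shows "t < ipow g n s"
proof -
  have "t < (g ^^ Suc k) s" for k
  proof (induct k)
    case (Suc k)
    have "s < (g ^^ Suc k) s" using Suc assms(3) by linarith
    then have "g s < g ((g ^^ Suc k) s)" unfolding PLa_less[OF assms(1)] .
    then show ?case using assms(2) unfolding funpow.simps comp_apply by linarith
  qed (use assms in simp)
  from this[of "nat n - 1"] assms show ?thesis by (simp add: ipow_def)
qed

text \<open>Hulls of pairs of covering intervals are cleared, not only the intervals themselves, so
  that no power carries a point of one interval into another. A hull that contains a fixed point can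
  be left out: that point separates the two intervals, and no element moves a point across
  it.\<close>

lemma clear_compact:
  assumes "plgroup H" "compact K" "K \<inter> fixpts H = {}"
  obtains g where "g \<in> H" "\<And>n x. n \<noteq> 0 \<Longrightarrow> x \<in> K \<Longrightarrow> ipow g n x \<notin> K"
proof -
  have "\<exists>e>0. cball x e \<inter> fixpts H = {}" if "x \<in> K" for x
  proof -
    have "open (- fixpts H)" "x \<in> - fixpts H" using fixpts_closed[OF assms(1)] that assms(3) by auto
    then obtain e where "e > 0" "cball x e \<subseteq> - fixpts H" using open_contains_cball by blast
    then show ?thesis by blast
  qed
  then obtain e where e: "\<And>x. x \<in> K \<Longrightarrow> e x > 0 \<and> cball x (e x) \<inter> fixpts H = {}" by metis
  have "K \<subseteq> (\<Union>x\<in>K. ball x (e x))" using e by force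
  from compactE_image[OF assms(2) _ this] obtain D where D: "D \<subseteq> K" "finite D" "K \<subseteq> (\<Union>x\<in>D. ball x (e x))"
    by auto
  obtain ds where ds: "set ds = D" using D(2) finite_list by blast
  define s where "s x = x - e x" for x
  define t where "t x = x + e x" for x
  have cb: "cball x (e x) = {s x..t x}" for x by (simp add: cball_eq_atLeastAtMost s_def t_def)
  have seg: "s x \<le> t x" "{s x..t x} \<inter> fixpts H = {}" if "x \<in> D" for x
    using e[of x] that D(1) unfolding cb[symmetric] by (auto simp: s_def t_def)
  have in_seg: "\<exists>y\<in>D. s y \<le> x \<and> x \<le> t y" if "x \<in> K" for x
  proof -
    obtain y where "y \<in> D" "x \<in> ball y (e y)" using subsetD[OF D(3) \<open>x \<in> K\<close>] by blast
    then show ?thesis by (intro bexI[of _ y]) (auto simp: s_def t_def dist_real_def)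
  qed
  define ps where "ps = filter (\<lambda>(a, b). {a..b} \<inter> fixpts H = {})
    (map (\<lambda>(x, y). (min (s x) (s y), max (t x) (t y))) (List.product ds ds))"
  have "\<forall>(a, b)\<in>set ps. a \<le> b \<and> {a..b} \<inter> fixpts H = {}"
    unfolding ps_def using seg(1) ds by (fastforce simp: min_def max_def)
  then obtain g where g: "g \<in> H" "\<And>a b. (a, b) \<in> set ps \<Longrightarrow> g b < a \<or> b < g a"
    using clear_list[OF assms(1)] by blast
  have gP: "g \<in> PLa" "bij g" using g plgroupD[OF assms(1)] by auto
  have pos: "ipow g n x \<notin> K" if n: "n > 0" and x: "x \<in> K" for n x
  proof
    assume gx: "ipow g n x \<in> K"
    obtain y where y: "y \<in> D" "s y \<le> x" "x \<le> t y" using in_seg[OF x] by blast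
    obtain z where z: "z \<in> D" "s z \<le> ipow g n x" "ipow g n x \<le> t z" using in_seg[OF gx] by blast
    define a b where "a = min (s y) (s z)" and "b = max (t y) (t z)"
    have gn: "ipow g n \<in> H" "ipow g n \<in> PLa" using g(1) plgroupD[OF assms(1)] by auto
    have ab: "a \<le> x" "x \<le> b" "a \<le> ipow g n x" "ipow g n x \<le> b" "a \<le> b"
      using y z by (auto simp: a_def b_def)
    show False
    proof (cases "{a..b} \<inter> fixpts H = {}")
      case True
      then have "(a, b) \<in> set ps" unfolding ps_def using y z ds by (auto simp: a_def b_def)
      then have "ipow g n b < a \<or> b < ipow g n a"
        using g(2) ipow_less[OF gP(1) _ ab(5) n] ipow_greater[OF gP(1) _ ab(5) n] by blast
      moreover have "ipow g n x \<le> ipow g n b" "ipow g n a \<le> ipow g n x" using gn ab by simp_all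
      ultimately show False using ab by linarith
    next
      case False
      then obtain q where q: "q \<in> fixpts H" "a \<le> q" "q \<le> b" by auto
      have out: "q < s w \<or> t w < q" if "w \<in> D" for w
      proof -
        have "\<not> (s w \<le> q \<and> q \<le> t w)" using seg(2)[OF that] q(1) by auto
        then show ?thesis by linarith
      qed
      show False
        using out[OF y(1)] out[OF z(1)] fixpts_less[OF assms(1) q(1) gn(1), of x] y z q(2,3)
        by (auto simp: a_def b_def min_def max_def split: if_splits)
    qed
  qed
  show thesis
  proof (rule that[OF g(1)])
    fix n :: int and x assume n: "n \<noteq> 0" and x: "x \<in> K"
    show "ipow g n x \<notin> K"
    proof (cases "n > 0")
      case True
      then show ?thesis using pos x by blast
    next
      case False
      then have "ipow g (- n) (ipow g n x) = x" using gP by simp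
      then show ?thesis using pos[of "- n" "ipow g n x"] n False x by auto
    qed
  qed
qed

subsection \<open>Orbitals of a group\<close>

definition orb :: "(real \<Rightarrow> real) set \<Rightarrow> real \<Rightarrow> real \<Rightarrow> bool" where
  "orb H a b \<longleftrightarrow> a < b \<and> a \<in> fixpts H \<and> b \<in> fixpts H \<and> {a<..<b} \<inter> fixpts H = {}"

lemma orb_01: assumes "plgroup H" "orb H a b" "a < x" "x < b" shows "x \<in> {0..1}"
proof -
  have "x \<notin> fixpts H" using assms by (auto simp: orb_def)
  then show ?thesis using fixpts_outside[OF assms(1), of x] by force
qed

lemma orb_inv:
  assumes "plgroup H" "orb H a b" "h \<in> H"
  shows "a < h x \<longleftrightarrow> a < x" "h x < b \<longleftrightarrow> x < b"
  using fixpts_less[OF assms(1) _ assms(3)] assms(2) by (auto simp: orb_def)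

text \<open>The infimum of the orbit of \<open>x\<close> is fixed by \<open>H\<close> and the
  orbital contains no such point, so the infimum is not above \<open>a\<close>.\<close>

lemma orb_low:
  assumes "plgroup H" "orb H a b" "a < x" "x < b" "a < u"
  obtains h where "h \<in> H" "h x < u" "a < h x"
proof -
  note x = orb_01[OF assms(1-4)]
  let ?i = "Inf {h x | h. h \<in> H}"
  have i: "?i \<in> fixpts H" "?i \<le> x" using orbit_ends[OF assms(1) x] by auto
  then have "a < ?i \<Longrightarrow> ?i \<in> {a<..<b}" using assms(4) by simp
  then have "\<not> a < ?i" using assms(2) i(1) unfolding orb_def by blast
  then obtain h where "h \<in> H" "h x < u" using orbit_ends(5)[OF assms(1) x, of u] assms by force
  then show thesis using that orb_inv[OF assms(1,2)] assms by blast
qed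

lemma orb_high:
  assumes "plgroup H" "orb H a b" "a < x" "x < b" "u < b"
  obtains h where "h \<in> H" "u < h x" "h x < b"
proof -
  note x = orb_01[OF assms(1-4)]
  let ?i = "Sup {h x | h. h \<in> H}"
  have i: "?i \<in> fixpts H" "x \<le> ?i" using orbit_ends[OF assms(1) x] by auto
  then have "?i < b \<Longrightarrow> ?i \<in> {a<..<b}" using assms(3) by simp
  then have "\<not> ?i < b" using assms(2) i(1) unfolding orb_def by blast
  then obtain h where "h \<in> H" "u < h x" using orbit_ends(6)[OF assms(1) x, of u] assms by force
  then show thesis using that orb_inv[OF assms(1,2)] assms by blast
qed

text \<open>On the fixed set of its derived group, \<open>H\<close> acts through its
  abelianization.\<close>

lemma comm_fix:
  assumes "fgroup H" "c \<in> fixpts (der H)" "x \<in> H" "y \<in> H"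
  shows "x (y c) = y (x c)"
proof -
  have "comm x y c = c" using assms comm_in_der[of x H y] by (auto simp: fixpts_def)
  then have "iv x (iv y (x (y c))) = c" by (simp add: comm_def)
  then show ?thesis using assms fgroupD(2) by (metis iv_eq_iff)
qed

lemma fix_der_inv:
  assumes "fgroup H" "c \<in> fixpts (der H)" "y \<in> H"
  shows "y c \<in> fixpts (der H)"
proof -
  have "d (y c) = y c" if "d \<in> der H" for d
  proof -
    have "iv y \<circ> d \<circ> y \<in> der H" using dseries_normal[OF assms(1,3), of d 1] that by simp
    then have "(iv y \<circ> d \<circ> y) c = c" using assms(2) unfolding fixpts_def by blast
    then have "iv y (d (y c)) = c" by simp
    then show ?thesis using fgroupD(2)[OF assms(1,3)] by (simp add: iv_eq_iff)
  qed
  then show ?thesis by (auto simp: fixpts_def)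
qed

lemma der_fix_near:
  assumes "plgroup H" "a \<in> fixpts H" "d \<in> der H"
  obtains e where "e > 0" "\<And>x. \<bar>x - a\<bar> \<le> e \<Longrightarrow> d x = x"
proof -
  have "slope 1 a d 1" "slope (-1) a d 1" using der_slope[OF assms] by auto
  then show thesis by (rule slope_one_near) (rule that)
qed

text \<open>The frontier points of the fixed set of \<open>x\<close> that are limits of moved points of
  \<open>fixpts (der H)\<close> form a finite set, on which \<open>H\<close> acts because it commutes with \<open>x\<close> there.
  If it met the orbital, its least element would be fixed by \<open>H\<close>.\<close>

lemma no_fix_in_orbital:
  assumes "plgroup H" "orb H a b" "c \<in> fixpts (der H)" "a < c" "c < b" "x \<in> H" "x c \<noteq> c" "a < p" "p < b"
  shows "x p \<noteq> p"
proof
  assume xp: "x p = p"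
  have fg: "fgroup H" using assms plgroupD by blast
  define M where "M = {q \<in> fixpts (der H). x q \<noteq> q}"
  define B where "B = {e. a < e \<and> e < b \<and> x e = e \<and> e \<in> closure M}"
  have xP: "x \<in> PLa" using assms plgroupD by blast
  have "closure M \<subseteq> closure (mv x)" by (rule closure_mono) (auto simp: M_def mv_def)
  then have fin: "finite B"
    by (intro finite_subset[OF _ finite_frontier_fix[OF xP]]) (auto simp: B_def)
  have cM: "closure M \<subseteq> fixpts (der H)"
    by (rule closure_minimal) (auto simp: M_def fixpts_closed plgroup_der assms)
  have yM: "y q \<in> M" if "y \<in> H" "q \<in> M" for y q
  proof -
    have "x (y q) = y (x q)" using comm_fix[OF fg _ assms(6) that(1)] that(2) by (auto simp: M_def)
    moreover have "y (x q) \<noteq> y q"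
      using that(2) PLa_eq[OF plgroupD(3)[OF assms(1) that(1)], of "x q" q] by (auto simp: M_def)
    ultimately show ?thesis using fix_der_inv[OF fg _ that(1)] that(2) by (auto simp: M_def)
  qed
  have yB: "y e \<in> B" if "y \<in> H" "e \<in> B" for y e
  proof -
    have "y ` closure M \<subseteq> closure M"
      by (rule image_closure_subset)
        (use PLaD(3)[OF plgroupD(3)[OF assms(1) that(1)]] yM[OF that(1)] closure_subset in auto)
    then have "y e \<in> closure M" using that(2) by (auto simp: B_def)
    moreover have "x (y e) = y e"
      using comm_fix[OF fg _ assms(6) that(1), of e] cM that(2) by (auto simp: B_def)
    ultimately show ?thesis using orb_inv[OF assms(1,2) that(1)] that(2) by (auto simp: B_def)
  qed
  \<comment> \<open>The orbit of \<open>c\<close> under the group generated by \<open>x\<close>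
    stays in \<open>M\<close> and cannot cross the fixed point \<open>p\<close>. Its end on the side
    of \<open>p\<close> is fixed by \<open>x\<close> and a limit of \<open>M\<close>.\<close>
  have "B \<noteq> {}"
  proof -
    define K where "K = gen {x}"
    have K: "plgroup K" "K \<subseteq> H" using plgroup_gen[OF assms(1), of "{x}"] assms by (auto simp: K_def)
    have xK: "x \<in> K" by (auto simp: K_def gen.incl)
    have pK: "p \<in> fixpts K"
      unfolding K_def by (subst fixpts_gen) (use xp xP PLaD in auto)
    have c01: "c \<in> {0..1}" using orb_01[OF assms(1,2,4,5)] .
    let ?A = "{h c | h. h \<in> K}"
    have AM: "?A \<subseteq> M" using yM assms(3,7) K(2) by (auto simp: M_def)
    note oe = orbit_ends[OF K(1) c01]
    have "p \<noteq> c" using xp assms(7) by auto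
    then have "p < c \<or> c < p" by linarith
    then show ?thesis
    proof
      assume pc: "p < c"
      have "\<not> Inf ?A < p" using oe(5)[of p] fixpts_less(1)[OF K(1) pK] pc by force
      moreover have "Inf ?A \<le> c" by (rule oe)
      moreover have "x (Inf ?A) = Inf ?A" using oe(1) xK unfolding fixpts_def by blast
      moreover have "Inf ?A \<in> closure M" using oe(7) closure_mono[OF AM] by blast
      ultimately have "Inf ?A \<in> B" unfolding B_def using assms by auto
      then show ?thesis by blast
    next
      assume pc: "c < p"
      have "\<not> p < Sup ?A" using oe(6)[of p] fixpts_less(2)[OF K(1) pK] pc by force
      moreover have "c \<le> Sup ?A" by (rule oe)
      moreover have "x (Sup ?A) = Sup ?A" using oe(2) xK unfolding fixpts_def by blast
      moreover have "Sup ?A \<in> closure M" using oe(8) closure_mono[OF AM] by blast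
      ultimately have "Sup ?A \<in> B" unfolding B_def using assms by auto
      then show ?thesis by blast
    qed
  qed
  then have m: "Min B \<in> B" using fin by simp
  have "Min B \<in> fixpts H"
    unfolding fixpts_def
  proof (intro CollectI ballI)
    fix y assume y: "y \<in> H"
    have "iv y \<in> H" "bij y" "y \<in> PLa" using y assms plgroupD by auto
    have "Min B \<le> y (Min B)" "Min B \<le> iv y (Min B)"
      using yB[OF y m] yB[OF \<open>iv y \<in> H\<close> m] fin by simp_all
    moreover have "y (Min B) \<le> y (iv y (Min B))" using calculation(2) \<open>y \<in> PLa\<close> by simp
    ultimately show "y (Min B) = Min B" using \<open>bij y\<close> by (simp add: bij_iv_simps(1)[of y])
  qed
  then show False using m assms(2) by (auto simp: B_def orb_def)
qed

text \<open>Suppose a term without fixed points in the orbital were followed by a term fixing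
  \<open>c\<close>. An element of the former that moves \<open>c\<close> would have no fixed point
  in the orbital by \<open>no_fix_in_orbital\<close>; but it lies in \<open>der H\<close> and is the
  identity near \<open>a\<close>.\<close>

lemma good_orbital:
  assumes "plgroup H" "orb H a b" "{a<..<b} \<inter> fixpts (der H) = {}"
  shows "{a<..<b} \<inter> fixpts (dseries H n) = {}"
proof -
  \<comment> \<open>The induction starts at the first derived group because its step uses elements
    of \<open>der H\<close>. The term with index \<open>n\<close> contains the next one and so has
    no more fixed points.\<close>
  have "{a<..<b} \<inter> fixpts (dseries H (Suc n)) = {}"
  proof (induct n)
    case 0
    then show ?case using assms by simp
  next
    case (Suc n)
    let ?M = "dseries H (Suc n)"
    have pl: "plgroup ?M" by (rule plgroup_dseries[OF assms(1)])
    have sub: "?M \<subseteq> H" using dseries_subset plgroupD(1)[OF assms(1)] by blast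
    have o: "orb ?M a b" using assms(2) Suc fixpts_mono[OF sub] unfolding orb_def by blast
    have False if c: "c \<in> fixpts (der ?M)" "a < c" "c < b" for c
    proof -
      have "c \<notin> fixpts ?M" using Suc c by auto
      then obtain x where x: "x \<in> ?M" "x c \<noteq> c" by (auto simp: fixpts_def)
      have "x \<in> der H" using x(1) dseries_antimono[OF plgroupD(1)[OF assms(1)], of 1 "Suc n"] by auto
      then obtain e where e: "e > 0" "\<And>y. \<bar>y - a\<bar> \<le> e \<Longrightarrow> x y = y"
        using der_fix_near[OF assms(1)] assms(2) unfolding orb_def by metis
      define p where "p = a + min e ((b - a) / 2)"
      have "a < b" using assms(2) by (simp add: orb_def)
      then have "a < p" "p < b" "\<bar>p - a\<bar> \<le> e" using e(1) by (auto simp: p_def min_def field_simps)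
      with e(2) have "a < p" "p < b" "x p = p" by blast+
      then show False using no_fix_in_orbital[OF pl o c x] by blast
    qed
    then show ?case by auto
  qed
  then show ?thesis using fixpts_mono[OF der_subset[OF fgroup_dseries[OF plgroupD(1)[OF assms(1)], of n]]]
    by auto
qed

section \<open>Elements without fixed points on an orbital\<close>

lemma gen_single: assumes "bij c" shows "gen {c} \<subseteq> range (ipow c)"
proof (rule gen_subsetI)
  show "id \<in> range (ipow c)" by (rule range_eqI[of _ _ 0]) simp
  show "{c} \<subseteq> range (ipow c)" using ipow_1[of c] by (metis empty_subsetI insert_subset rangeI)
  show "iv f \<in> range (ipow c)" if "f \<in> range (ipow c)" for f
    using that iv_ipow[OF assms] by auto
  show "f \<circ> g \<in> range (ipow c)" if fg: "f \<in> range (ipow c)" "g \<in> range (ipow c)" for f g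
  proof -
    obtain m n where "f = ipow c m" "g = ipow c n" using fg by auto
    then have "f \<circ> g = ipow c (m + n)" using ipow_add[OF assms] by (auto simp: fun_eq_iff)
    then show ?thesis by blast
  qed
qed

text \<open>This turns facts about orbits of a group into facts about powers of one element, as in
  \<open>ipow_low\<close> and \<open>ipow_high\<close>.\<close>

lemma full_orb:
  assumes "c \<in> H" "plgroup H" "orb H a b" "\<And>x. a < x \<Longrightarrow> x < b \<Longrightarrow> c x \<noteq> x"
  shows "plgroup (gen {c})" "orb (gen {c}) a b"
proof -
  show "plgroup (gen {c})" using plgroup_gen[OF assms(2)] assms(1) by blast
  have "fixpts (gen {c}) = {x. c x = x}"
    by (subst fixpts_gen) (use assms plgroupD in auto)
  then show "orb (gen {c}) a b" using assms by (auto simp: orb_def fixpts_def)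
qed

lemma ipow_low:
  assumes "c \<in> H" "plgroup H" "orb H a b" "\<And>x. a < x \<Longrightarrow> x < b \<Longrightarrow> c x \<noteq> x" "a < x" "x < b" "a < u"
  obtains n where "ipow c n x < u"
proof -
  obtain h where "h \<in> gen {c}" "h x < u" using orb_low[OF full_orb[OF assms(1-4)] assms(5-7)] .
  then show thesis using gen_single plgroupD(5)[OF assms(2,1)] that by blast
qed

lemma ipow_high:
  assumes "c \<in> H" "plgroup H" "orb H a b" "\<And>x. a < x \<Longrightarrow> x < b \<Longrightarrow> c x \<noteq> x" "a < x" "x < b" "u < b"
  obtains n where "u < ipow c n x"
proof -
  obtain h where "h \<in> gen {c}" "u < h x" using orb_high[OF full_orb[OF assms(1-4)] assms(5-7)] .
  then show thesis using gen_single plgroupD(5)[OF assms(2,1)] that by blast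
qed

text \<open>By the intermediate value theorem a change of direction would force a fixed point in
  between.\<close>

lemma full_up:
  assumes "c \<in> PLa" "\<And>x. a < x \<Longrightarrow> x < b \<Longrightarrow> c x \<noteq> x" "a < z" "z < b" "z < c z" "a < x" "x < b"
  shows "x < c x"
proof (rule ccontr)
  assume "\<not> x < c x"
  then have cx: "c x < x" using assms(2)[OF assms(6,7)] by linarith
  have cont: "continuous_on S (\<lambda>y. c y - y)" for S
    using PLaD(3)[OF assms(1)] by (intro continuous_intros)
  have "x \<noteq> z" using cx assms by auto
  then have "\<exists>y. min x z \<le> y \<and> y \<le> max x z \<and> c y - y = 0"
  proof (cases "x < z")
    case True
    then show ?thesis using IVT'[of "\<lambda>y. c y - y" x 0 z] cont cx assms by auto
  next
    case False
    then show ?thesis using IVT2'[of "\<lambda>y. c y - y" x 0 z] cont cx assms by auto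
  qed
  then show False using assms by (auto simp: min_def max_def split: if_splits)
qed

lemma ipow_mono_exp:
  assumes "c \<in> H" "plgroup H" "orb H a b" "\<And>x. a < x \<Longrightarrow> x < b \<Longrightarrow> x < c x" "a < x" "x < b" "m \<le> n"
  shows "ipow c m x \<le> ipow c n x"
proof -
  have "ipow c m x \<le> ipow c (m + int k) x" for k
  proof (induct k)
    case (Suc k)
    let ?y = "ipow c (m + int k) x"
    have "a < ?y" "?y < b"
      using orb_inv[OF assms(2,3) plgroupD(8)[OF assms(2,1)], of "m + int k" x] assms(5,6) by auto
    then have "?y < c ?y" by (rule assms(4))
    also have "c ?y = ipow c (m + int (Suc k)) x"
      using ipow_Suc[OF plgroupD(5)[OF assms(2,1)], of "m + int k" x] by (simp add: ac_simps)
    finally show ?case using Suc by linarith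
  qed simp
  from this[of "nat (n - m)"] show ?thesis using assms(7) by simp
qed

text \<open>Take the least exponent whose power brings \<open>x\<close> to \<open>z\<close> or
  beyond. The preceding power is still below \<open>z\<close>, so this one does not exceed
  \<open>c z\<close>.\<close>

lemma fundamental_domain:
  assumes "c \<in> H" "plgroup H" "orb H a b" "\<And>x. a < x \<Longrightarrow> x < b \<Longrightarrow> x < c x" "a < x" "x < b" "a < z" "z < b"
  obtains n where "z \<le> ipow c n x" "ipow c n x \<le> c z"
proof -
  have ne: "c y \<noteq> y" if "a < y" "y < b" for y using assms(4)[OF that] by simp
  obtain l where l: "ipow c l x < z" using ipow_low[OF assms(1-3) ne assms(5-7)] by blast
  obtain r where r: "z < ipow c r x" using ipow_high[OF assms(1-3) ne assms(5,6,8)] by blast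
  note mono = ipow_mono_exp[OF assms(1-6)]
  have "\<not> r \<le> l" using mono[of r l] l r by linarith
  then have "r = l + int (nat (r - l))" by simp
  then have ex: "z \<le> ipow c (l + int (nat (r - l))) x" using r by simp
  \<comment> \<open>Counting from \<open>l\<close>, where the power is below \<open>z\<close>,
    reduces the search over the integers to a \<open>LEAST\<close> over the naturals and makes
    \<open>k\<close> positive.\<close>
  define k where "k = (LEAST k. z \<le> ipow c (l + int k) x)"
  have k: "z \<le> ipow c (l + int k) x" unfolding k_def by (rule LeastI[of _ "nat (r - l)"]) (rule ex)
  then have "k \<noteq> 0" using l by (metis add.right_neutral not_le of_nat_0)
  then obtain j where j: "k = Suc j" by (cases k) auto
  then have "\<not> z \<le> ipow c (l + int j) x" unfolding k_def by (metis lessI not_less_Least)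
  then have "c (ipow c (l + int j) x) \<le> c z"
    using PLa_le[OF plgroupD(3)[OF assms(2,1)]] by simp
  moreover have "c (ipow c (l + int j) x) = ipow c (l + int k) x"
    using ipow_Suc[OF plgroupD(5)[OF assms(2,1)], of "l + int j" x] j by (simp add: ac_simps)
  ultimately show thesis using that k by simp
qed

subsection \<open>Orbitals on which the derived group has fixed points\<close>

locale bad_orbital =
  fixes H S :: "(real \<Rightarrow> real) set" and a b z :: real
  assumes pl: "plgroup H" and S: "H = gen S" "finite S" and o: "orb H a b"
    and z: "z \<in> fixpts (der H)" "a < z" "z < b"
begin

text \<open>The elliptic elements; they turn out to be the kernel of the slope at \<open>a\<close>
  (see \<open>el_iff\<close>).\<close>

definition el :: "(real \<Rightarrow> real) \<Rightarrow> bool" where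
  "el h \<longleftrightarrow> (\<exists>p. a < p \<and> p < b \<and> h p = p)"

lemma ab: "a < b" "a \<in> fixpts H" "b \<in> fixpts H"
  using o by (auto simp: orb_def)

lemma fgH: "fgroup H"
  using pl plgroupD by blast

lemma el_fix: "h \<in> H \<Longrightarrow> el h \<Longrightarrow> c \<in> fixpts (der H) \<Longrightarrow> a < c \<Longrightarrow> c < b \<Longrightarrow> h c = c"
  using no_fix_in_orbital[OF pl o] unfolding el_def by blast

text \<open>\<open>der H\<close> is normal, so the orbit of \<open>z\<close> under \<open>H\<close>
  consists of fixed points of \<open>der H\<close>; it accumulates at both ends of the
  orbital.\<close>

lemma ends: "\<sigma> \<in> {1,-1} \<Longrightarrow> p = (if \<sigma> = 1 then a else b) \<Longrightarrow> e > 0 \<Longrightarrow>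
    \<exists>c\<in>fixpts (der H). a < c \<and> c < b \<and> 0 < \<sigma> * (c - p) \<and> \<sigma> * (c - p) < e"
proof -
  assume s: "\<sigma> \<in> {1,-1}" "p = (if \<sigma> = 1 then a else b)" "e > 0"
  show ?thesis
  proof (cases "\<sigma> = 1")
    case True
    obtain h where h: "h \<in> H" "h z < a + e" "a < h z"
      using orb_low[OF pl o z(2,3), of "a + e"] s(3) by auto
    show ?thesis
      by (rule bexI[of _ "h z"]) (use h s True fix_der_inv[OF fgH z(1) h(1)] orb_inv(2)[OF pl o h(1)] z in auto)
  next
    case False
    obtain h where h: "h \<in> H" "b - e < h z" "h z < b"
      using orb_high[OF pl o z(2,3), of "b - e"] s(3) by auto
    show ?thesis
      by (rule bexI[of _ "h z"]) (use h s False fix_der_inv[OF fgH z(1) h(1)] orb_inv(1)[OF pl o h(1)] z in auto)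
  qed
qed

text \<open>An elliptic element fixes all fixed points of \<open>der H\<close> in the orbital, and
  these accumulate at \<open>p\<close>, where a germ of slope other than 1 has no further fixed
  points.\<close>

lemma el_slope:
  assumes "h \<in> H" "el h" "\<sigma> \<in> {1,-1}" "p = (if \<sigma> = 1 then a else b)" "slope \<sigma> p h m"
  shows "m = 1"
proof (rule ccontr)
  assume m: "m \<noteq> 1"
  obtain e where e: "e > 0" "m \<noteq> 1 \<longrightarrow> (\<forall>x. 0 < \<sigma> * (x - p) \<longrightarrow> \<sigma> * (x - p) \<le> e \<longrightarrow> h x \<noteq> x)"
    by (rule slope_side[OF assms(5,3)])
  obtain c where "c \<in> fixpts (der H)" "a < c" "c < b" "0 < \<sigma> * (c - p)" "\<sigma> * (c - p) < e"
    using ends[OF assms(3,4) e(1)] by blast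
  then show False using e(2) m el_fix[OF assms(1,2)] by fastforce
qed

lemma slope_el: assumes "slope 1 a h 1" shows "el h"
proof -
  obtain e where e: "e > 0" "(1::real) = 1 \<longrightarrow> (\<forall>x. 0 \<le> 1 * (x - a) \<longrightarrow> 1 * (x - a) \<le> e \<longrightarrow> h x = x)"
    by (rule slope_side[OF assms]) auto
  define p where "p = a + min e ((b - a) / 2)"
  have "a < p" "p < b" "p - a \<le> e" using e(1) ab(1) by (auto simp: p_def min_def field_simps)
  then show ?thesis using e(2) unfolding el_def by (intro exI[of _ p]) auto
qed

lemma el_bounds:
  assumes "h \<in> H" "el h"
  obtains s t where "a < s" "t < b" "\<And>x. a \<le> x \<Longrightarrow> x \<le> s \<Longrightarrow> h x = x" "\<And>x. t \<le> x \<Longrightarrow> x \<le> b \<Longrightarrow> h x = x"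
proof -
  have h: "h \<in> PLa" "h a = a" "h b = b" using assms pl plgroupD ab by (auto simp: fixpts_def)
  obtain m where "slope 1 a h m" using slope_ex[OF h(1,2), of 1] by auto
  then have 1: "slope 1 a h 1" using el_slope[OF assms, of 1 a m] by auto
  obtain m where "slope (-1) b h m" using slope_ex[OF h(1,3), of "-1"] by auto
  then have 2: "slope (-1) b h 1" using el_slope[OF assms, of "-1" b m] by auto
  obtain e where e: "e > 0" "(1::real) = 1 \<longrightarrow> (\<forall>x. 0 \<le> 1 * (x - a) \<longrightarrow> 1 * (x - a) \<le> e \<longrightarrow> h x = x)"
    by (rule slope_side[OF 1]) auto
  obtain e' where e': "e' > 0" "(1::real) = 1 \<longrightarrow> (\<forall>x. 0 \<le> (-1) * (x - b) \<longrightarrow> (-1) * (x - b) \<le> e' \<longrightarrow> h x = x)"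
    by (rule slope_side[OF 2]) auto
  show thesis
    by (rule that[of "a + e" "b - e'"]) (use e e' in auto)
qed

text \<open>The slope homomorphism at the left end \<open>a\<close>, chosen as a function so that it
  can be multiplied and compared.\<close>

definition lam :: "(real \<Rightarrow> real) \<Rightarrow> real" where
  "lam h = (SOME m. m > 0 \<and> slope 1 a h m)"

lemma lam: assumes "h \<in> H" shows "lam h > 0" "slope 1 a h (lam h)"
proof -
  obtain m where "m > 0 \<and> slope 1 a h m"
    using slope_ex[of h a 1] plgroupD(3)[OF pl assms] ab(2) assms by (auto simp: fixpts_def)
  then have "lam h > 0 \<and> slope 1 a h (lam h)" unfolding lam_def by (rule someI)
  then show "lam h > 0" "slope 1 a h (lam h)" by auto
qed

lemma lam_eq: "h \<in> H \<Longrightarrow> slope 1 a h m \<Longrightarrow> lam h = m"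
  using slope_unique[OF lam(2)] by auto

lemma lam_comp: "h \<in> H \<Longrightarrow> k \<in> H \<Longrightarrow> lam (h \<circ> k) = lam h * lam k"
  using lam_eq[OF plgroupD(7)[OF pl]] slope_comp[OF lam(2) lam(2) lam(1)] by blast

lemma lam_iv: "h \<in> H \<Longrightarrow> lam (iv h) = 1 / lam h"
  using lam_eq[OF plgroupD(6)[OF pl]] slope_iv[OF plgroupD(5)[OF pl] lam(2) lam(1)] by blast

lemma lam_ipow: "h \<in> H \<Longrightarrow> lam (ipow h n) = lam h powi n"
  using lam_eq[OF plgroupD(8)[OF pl]] slope_ipow[OF plgroupD(5)[OF pl] lam(2) lam(1)] by blast

lemma el_iff: "h \<in> H \<Longrightarrow> el h \<longleftrightarrow> lam h = 1"
  using el_slope[of h 1 a "lam h"] slope_el[of h] lam[of h] by auto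

text \<open>An element that moves \<open>z\<close> is not elliptic, so its slope differs from 1 and
  it or its inverse expands.\<close>

lemma expanding: obtains x where "x \<in> H" "lam x > 1"
proof -
  have "z \<notin> fixpts H" using o z by (auto simp: orb_def)
  then obtain x where x: "x \<in> H" "x z \<noteq> z" by (auto simp: fixpts_def)
  then have "lam x \<noteq> 1" using el_iff el_fix[OF _ _ z] by blast
  then have "lam x > 1 \<or> 1 / lam x > 1" using lam(1)[OF x(1)] by (cases "lam x < 1") auto
  then have "lam x > 1 \<or> lam (iv x) > 1" using lam_iv[OF x(1)] by simp
  then show thesis using that x(1) plgroupD(6)[OF pl] by blast
qed

text \<open>Near \<open>a\<close> the slope moves points upwards, and the direction cannot change
  because \<open>c\<close> has no fixed point in the orbital.\<close>

lemma expanding_up: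
  assumes "c \<in> H" "lam c > 1" "a < x" "x < b"
  shows "x < c x"
proof -
  have ne: "c y \<noteq> y" if "a < y" "y < b" for y
    using assms(1,2) el_iff[OF assms(1)] that unfolding el_def by auto
  obtain e where e: "e > 0" "\<forall>t\<in>{0..e}. c (a + 1 * t) = a + 1 * (lam c * t)"
    using lam(2)[OF assms(1)] unfolding slope_def by auto
  define t where "t = min e ((b - a) / 2)"
  have t: "t \<in> {0..e}" "0 < t" "a + t < b" using e(1) ab(1) by (auto simp: t_def min_def field_simps)
  have "c (a + t) = a + lam c * t" using e(2) t(1) by auto
  then have "a + t < c (a + t)" using assms(2) t(2) by simp
  then show ?thesis using full_up[OF plgroupD(3)[OF pl assms(1)] ne, of a b "a + t" x] t assms by auto
qed

lemma linear_power:
  assumes "\<forall>t\<in>{0..e}. c (a + t) = a + m * t" "m > 1" "0 \<le> t" "m ^ n * t \<le> e"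
  shows "(c ^^ n) (a + t) = a + m ^ n * t"
  using assms(4)
proof (induct n)
  case (Suc n)
  have "0 \<le> m ^ n * t" using assms(2,3) by simp
  then have "m ^ n * t \<le> m * (m ^ n * t)" using assms(2) mult_right_mono[of 1 m "m ^ n * t"] by simp
  then have le: "m ^ n * t \<le> e" using Suc.prems by (simp add: mult.assoc)
  then have "(c ^^ Suc n) (a + t) = c (a + m ^ n * t)" using Suc.hyps by simp
  also have "\<dots> = a + m * (m ^ n * t)" using assms(1,2,3) le by auto
  finally show ?case by (simp add: mult.assoc)
qed simp

text \<open>If the slopes at \<open>a\<close> accumulate at 1, the closed invariant set \<open>fixpts (der H)\<close> is dense near
  \<open>a\<close>: conjugating by powers of one linear germ, every element acts linearly on it there.\<close>

lemma dense_case: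
  assumes "\<And>\<epsilon>. \<epsilon> > 0 \<Longrightarrow> \<exists>h\<in>H. 1 < lam h \<and> lam h < 1 + \<epsilon>" "a < y" "y < b"
  shows "y \<in> fixpts (der H)"
proof -
  obtain c where c: "c \<in> H" "lam c > 1" using expanding .
  obtain e where e: "e > 0" "\<forall>t\<in>{0..e}. c (a + 1 * t) = a + 1 * (lam c * t)"
    using lam(2)[OF c(1)] unfolding slope_def by auto
  have ce: "\<forall>t\<in>{0..e}. c (a + t) = a + lam c * t" using e(2) by simp
  \<comment> \<open>A power of \<open>c\<close> pulls \<open>w\<close> back to where the germ of
    \<open>h\<close> is affine. That power commutes with \<open>h\<close> on
    \<open>fixpts (der H)\<close>, so \<open>h\<close> is linear at \<open>w\<close> itself, on a
    range determined by \<open>c\<close> alone.\<close>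
  have lin: "h w = a + lam h * (w - a)"
    if h: "h \<in> H" "lam h > 1" and w: "w \<in> fixpts (der H)" "a < w" "lam h * (w - a) \<le> e" for h w
  proof -
    obtain d where d: "d > 0" "\<forall>t\<in>{0..d}. h (a + 1 * t) = a + 1 * (lam h * t)"
      using lam(2)[OF h(1)] unfolding slope_def by auto
    obtain n where n: "(w - a) / d < lam c ^ n" using real_arch_pow[OF c(2)] by blast
    define t where "t = (w - a) / lam c ^ n"
    have cn: "lam c ^ n > 0" using c(2) by simp
    have t: "0 \<le> t" "t \<le> d" "lam c ^ n * t = w - a"
      using n d(1) w(2) cn c(2) by (auto simp: t_def field_simps)
    have "w - a \<le> lam h * (w - a)" using h(2) w(2) by (simp add: mult_le_cancel_right1)
    then have cw: "(c ^^ n) (a + t) = w"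
      using linear_power[OF ce c(2) t(1), of n] t(3) w(3) by simp
    have cH: "c ^^ n \<in> H" using plgroupD(8)[OF pl c(1), of "int n"] by simp
    have "a + t = iv (c ^^ n) w" using cw plgroupD(5)[OF pl cH] by (metis iv_eq_iff)
    then have atF: "a + t \<in> fixpts (der H)" using fix_der_inv[OF fgH w(1) plgroupD(6)[OF pl cH]] by simp
    have ht: "h (a + t) = a + lam h * t" using d(2) t by auto
    have s: "lam c ^ n * (lam h * t) = lam h * (w - a)" using t(3) by (metis mult.left_commute)
    have "h w = (c ^^ n) (h (a + t))"
      using comm_fix[OF fgH atF h(1) cH] cw by simp
    also have "\<dots> = a + lam h * (w - a)"
      unfolding ht using linear_power[OF ce c(2), of "lam h * t" n] s w(3) t(1) h(2) by simp
    finally show ?thesis .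
  qed
  have dense: "\<exists>w\<in>fixpts (der H). u < w \<and> w < v" if uv: "a < u" "u < v" "v \<le> a + e" for u v
  proof -
    obtain k where k: "k \<in> H" "k z < u" "a < k z" using orb_low[OF pl o z(2,3) uv(1)] .
    define w where "w = k z"
    have w: "w \<in> fixpts (der H)" "a < w" "w < u" using k fix_der_inv[OF fgH z(1) k(1)] by (auto simp: w_def)
    \<comment> \<open>Multiplication by a slope below this ratio cannot jump across the interval
      from \<open>u\<close> to \<open>v\<close>, so the first power of \<open>h\<close> taking
      \<open>w\<close> beyond \<open>u\<close> lands inside it.\<close>
    have "(v - a) / (u - a) - 1 > 0" using uv by (simp add: field_simps)
    then obtain h where h: "h \<in> H" "1 < lam h" "lam h < (v - a) / (u - a)"
      using assms(1)[of "(v - a) / (u - a) - 1"] by auto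
    obtain n where n: "(u - a) / (w - a) < lam h ^ n" using real_arch_pow[OF h(2)] by blast
    define j where "j = (LEAST j. u - a < lam h ^ j * (w - a))"
    have j: "u - a < lam h ^ j * (w - a)"
      unfolding j_def by (rule LeastI[of _ n]) (use n w in \<open>simp add: field_simps\<close>)
    then have "j \<noteq> 0" using w by (metis diff_right_mono less_le_not_le mult_1 order_less_imp_le power_0)
    then obtain i where i: "j = Suc i" by (cases j) auto
    then have "\<not> u - a < lam h ^ i * (w - a)" unfolding j_def by (metis lessI not_less_Least)
    then have "lam h * (lam h ^ i * (w - a)) \<le> lam h * (u - a)" using h(2) by simp
    also have "\<dots> < v - a" using h(3) uv by (simp add: field_simps)
    finally have jv: "lam h ^ j * (w - a) < v - a" by (simp add: i mult.assoc)
    have hj: "h ^^ j \<in> H" using plgroupD(8)[OF pl h(1), of "int j"] by simp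
    have lj: "lam (h ^^ j) = lam h ^ j" using lam_ipow[OF h(1), of "int j"] by (simp add: power_int_def)
    have "lam h ^ j > 1" using h(2) \<open>j \<noteq> 0\<close> by (simp add: one_less_power)
    then have "(h ^^ j) w = a + lam h ^ j * (w - a)"
      using lin[OF hj _ w(1,2)] jv uv(3) unfolding lj by simp
    moreover have "(h ^^ j) w \<in> fixpts (der H)" using fix_der_inv[OF fgH w(1) hj] .
    ultimately show ?thesis using j jv by (intro bexI[of _ "(h ^^ j) w"]) auto
  qed
  have cl: "closed (fixpts (der H))" using fixpts_closed plgroup_der pl by blast
  have near: "u \<in> fixpts (der H)" if u: "a < u" "u < a + e" for u
  proof -
    have "\<exists>w\<in>fixpts (der H). dist w u < \<epsilon>" if eps: "\<epsilon> > 0" for \<epsilon>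
    proof -
      obtain w where "w \<in> fixpts (der H)" "u < w" "w < min (u + \<epsilon>) (a + e)"
        using dense[of u "min (u + \<epsilon>) (a + e)"] u eps by auto
      then show ?thesis by (intro bexI[of _ w]) (auto simp: dist_real_def)
    qed
    then have "u \<in> closure (fixpts (der H))" by (simp add: closure_approachable)
    then show ?thesis using cl by simp
  qed
  \<comment> \<open>Any point of the orbital is carried near \<open>a\<close> by \<open>H\<close>,
    which preserves \<open>fixpts (der H)\<close>.\<close>
  obtain h where h: "h \<in> H" "h y < a + e" "a < h y" using orb_low[OF pl o assms(2,3), of "a + e"] e(1) by auto
  then have "h y \<in> fixpts (der H)" using near by blast
  then have "iv h (h y) \<in> fixpts (der H)" using fix_der_inv[OF fgH _ plgroupD(6)[OF pl h(1)]] by blast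
  then show ?thesis using plgroupD(5)[OF pl h(1)] by (simp add: bij_iv_simps(2))
qed

text \<open>The slopes form a discrete subgroup of the positive reals. Let \<open>c\<close> have the
  least slope above 1; dividing by a suitable power leaves a slope between 1 and
  \<open>lam c\<close>, smaller than \<open>lam c\<close>, hence equal to 1.\<close>

lemma cyclic_case:
  assumes "\<epsilon> > 0" "\<And>h. h \<in> H \<Longrightarrow> 1 < lam h \<Longrightarrow> 1 + \<epsilon> \<le> lam h"
  obtains c where "c \<in> H" "lam c > 1" "\<And>h. h \<in> H \<Longrightarrow> \<exists>n. lam (ipow c n \<circ> h) = 1"
proof -
  define L where "L = {lam h | h. h \<in> H \<and> 1 < lam h}"
  have ne: "L \<noteq> {}" using expanding unfolding L_def by blast
  have bd: "bdd_below L" unfolding L_def by (intro bdd_belowI[of _ 1]) auto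
  have "1 + \<epsilon> \<le> Inf L" by (rule cInf_greatest[OF ne]) (auto simp: L_def assms)
  then have pos: "Inf L > 0" using assms(1) by linarith
  then have "Inf L < Inf L * (1 + \<epsilon>)" using assms(1) by simp
  \<comment> \<open>A slope this close to the infimum is already minimal: its quotient by a smaller
    slope above 1 would lie strictly between 1 and \<open>1 + \<epsilon>\<close>.\<close>
  from cInf_lessD[OF ne this] obtain c where c: "c \<in> H" "1 < lam c" "lam c < Inf L * (1 + \<epsilon>)"
    unfolding L_def by blast
  have min: "lam c \<le> lam h" if h: "h \<in> H" "1 < lam h" for h
  proof (rule ccontr)
    assume "\<not> lam c \<le> lam h"
    have l: "Inf L \<le> lam h" by (rule cInf_lower[OF _ bd]) (use h in \<open>auto simp: L_def\<close>)
    have ih: "iv h \<in> H" using plgroupD(6)[OF pl h(1)] .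
    have lc: "lam (c \<circ> iv h) = lam c / lam h" using lam_comp[OF c(1) ih] lam_iv[OF h(1)] by simp
    have "1 < lam c / lam h" using \<open>\<not> lam c \<le> lam h\<close> h(2) by simp
    then have "1 + \<epsilon> \<le> lam c / lam h" using assms(2)[OF plgroupD(7)[OF pl c(1) ih]] lc by simp
    then have "lam h * (1 + \<epsilon>) \<le> lam c" using h(2) by (simp add: field_simps)
    moreover have "Inf L * (1 + \<epsilon>) \<le> lam h * (1 + \<epsilon>)" using l assms(1) by simp
    ultimately show False using c(3) by linarith
  qed
  have "\<exists>n. lam (ipow c n \<circ> h) = 1" if h: "h \<in> H" for h
  proof -
    define n where "n = \<lfloor>log (lam c) (lam h)\<rfloor>"
    have "real_of_int n \<le> log (lam c) (lam h)" "log (lam c) (lam h) < real_of_int (n + 1)"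
      unfolding n_def by linarith+
    then have "lam c powr real_of_int n \<le> lam h" "lam h < lam c powr real_of_int (n + 1)"
      using c(2) lam(1)[OF h] by (simp_all only: le_log_iff log_less_iff)
    then have b: "lam c powi n \<le> lam h" "lam h < lam c powi n * lam c"
      using c(2) powr_real_of_int'[of "lam c" n] powr_real_of_int'[of "lam c" "n + 1"]
      by (simp_all add: power_int_add)
    have lp: "lam c powi n > 0" using c(2) by simp
    have ci: "ipow c (- n) \<in> H" using plgroupD(8)[OF pl c(1)] .
    have "lam (ipow c (- n) \<circ> h) = lam h / lam c powi n"
      using lam_comp[OF ci h] lam_ipow[OF c(1)] by (simp add: power_int_minus field_simps)
    moreover have "1 \<le> lam h / lam c powi n" "lam h / lam c powi n < lam c" using b lp by (simp_all add: field_simps)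
    ultimately have "lam (ipow c (- n) \<circ> h) = 1"
      using min[OF plgroupD(7)[OF pl ci h]] by linarith
    then show ?thesis by blast
  qed
  then show thesis using that c by blast
qed

text \<open>Restricted to the fundamental domain from \<open>z\<close> to \<open>c z\<close>, this
  is the action of \<open>g\<close> on the translate of that domain by the power \<open>m\<close> of
  \<open>c\<close>.\<close>

definition cj :: "(real \<Rightarrow> real) \<Rightarrow> int \<Rightarrow> (real \<Rightarrow> real) \<Rightarrow> real \<Rightarrow> real" where
  "cj c m g = iv (ipow c m) \<circ> g \<circ> ipow c m"

lemma cj_in: "c \<in> H \<Longrightarrow> g \<in> H \<Longrightarrow> cj c m g \<in> H"
  unfolding cj_def by (intro plgroupD(7)[OF pl] plgroupD(6)[OF pl] plgroupD(8)[OF pl])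

lemma cj_lam:
  assumes "c \<in> H" "g \<in> H" "lam g = 1" shows "lam (cj c m g) = 1"
proof -
  have c: "ipow c m \<in> H" "iv (ipow c m) \<in> H"
    using plgroupD(8)[OF pl assms(1)] plgroupD(6)[OF pl] by auto
  have "lam (cj c m g) = 1 / lam (ipow c m) * lam g * lam (ipow c m)"
    unfolding cj_def lam_comp[OF plgroupD(7)[OF pl c(2) assms(2)] c(1)] lam_comp[OF c(2) assms(2)] lam_iv[OF c(1)] ..
  then show ?thesis using assms lam(1)[OF c(1)] by simp
qed

lemma cj_apply: "bij c \<Longrightarrow> cj c m g x = ipow c (- m) (g (ipow c m x))"
  by (simp add: cj_def iv_ipow)

lemma cj_cj: assumes "bij c" shows "cj c m (cj c k g) = cj c (k + m) g"
proof
  fix x show "cj c m (cj c k g) x = cj c (k + m) g x"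
    using ipow_add[OF assms, of "- m" "- k"] ipow_add[OF assms, of k m]
    by (simp add: cj_apply[OF assms] ac_simps)
qed

context
  fixes c assumes c: "c \<in> H" "lam c > 1"
begin

lemma c_up: "a < x \<Longrightarrow> x < b \<Longrightarrow> x < c x"
  using expanding_up[OF c] .

lemma c_ne: "a < x \<Longrightarrow> x < b \<Longrightarrow> c x \<noteq> x"
  using c_up by force

lemma cz: "c z \<in> fixpts (der H)" "z < c z" "c z < b" "a < c z"
  using fix_der_inv[OF fgH z(1) c(1)] c_up[OF z(2,3)] orb_inv[OF pl o c(1)] z by auto

lemma preserves_domain:
  assumes "h \<in> H" "lam h = 1" "x \<in> {z..c z}" shows "h x \<in> {z..c z}"
proof -
  have "el h" using assms el_iff by blast
  then have "h z = z" "h (c z) = c z" using el_fix[OF assms(1)] z cz by auto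
  then show ?thesis
    using assms(3) PLa_le[OF plgroupD(3)[OF pl assms(1)], of z x] PLa_le[OF plgroupD(3)[OF pl assms(1)], of x "c z"]
    by auto
qed

text \<open>An elliptic element is the identity near both ends, so it is visible on only finitely
  many translates of the fundamental domain.\<close>

lemma far_trivial:
  assumes "d \<in> H" "el d"
  obtains N :: nat where "\<And>m x. \<bar>m\<bar> > int N \<Longrightarrow> x \<in> {z..c z} \<Longrightarrow> cj c m d x = x"
proof -
  obtain s t where st: "a < s" "t < b" "\<And>x. a \<le> x \<Longrightarrow> x \<le> s \<Longrightarrow> d x = x" "\<And>x. t \<le> x \<Longrightarrow> x \<le> b \<Longrightarrow> d x = x"
    using el_bounds[OF assms] by metis
  obtain k where k: "t < ipow c k z" using ipow_high[OF c(1) pl o c_ne z(2,3) st(2)] by blast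
  obtain l where l: "ipow c l (c z) < s" using ipow_low[OF c(1) pl o c_ne cz(4,3) st(1)] by blast
  define N where "N = nat \<bar>k\<bar> + nat \<bar>l\<bar>"
  have "cj c m d x = x" if m: "\<bar>m\<bar> > int N" and x: "x \<in> {z..c z}" for m x
  proof -
    let ?y = "ipow c m x"
    have cm: "ipow c m \<in> H" "ipow c m \<in> PLa" using plgroupD[OF pl] c(1) by auto
    have y: "ipow c m z \<le> ?y" "?y \<le> ipow c m (c z)" using x cm(2) by auto
    have ab: "a < ?y" "?y < b" using orb_inv[OF pl o cm(1), of x] x z cz by auto
    have "d ?y = ?y"
    proof (cases "m > 0")
      case True
      then have "ipow c k z \<le> ipow c m z"
        using m by (intro ipow_mono_exp[OF c(1) pl o c_up z(2,3)]) (auto simp: N_def)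
      then show ?thesis using st(4)[of ?y] y k ab by linarith
    next
      case False
      then have "ipow c m (c z) \<le> ipow c l (c z)"
        using m by (intro ipow_mono_exp[OF c(1) pl o c_up cz(4,3)]) (auto simp: N_def)
      then show ?thesis using st(3)[of ?y] y l ab by linarith
    qed
    then show ?thesis using plgroupD(5)[OF pl c(1)] by (simp add: cj_apply)
  qed
  then show thesis by (rule that)
qed

text \<open>On the fundamental domain, \<open>e\<close> agrees with its commutator with a large power of \<open>c\<close>.\<close>

lemma commutator_on_domain:
  assumes "e \<in> H" "el e"
  obtains \<delta> where "\<delta> \<in> der H" "\<And>x. x \<in> {z..c z} \<Longrightarrow> \<delta> x = e x"
proof -
  obtain N :: nat where N: "\<And>m x. \<bar>m\<bar> > int N \<Longrightarrow> x \<in> {z..c z} \<Longrightarrow> cj c m e x = x"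
    using far_trivial[OF assms] by metis
  define k where "k = ipow c (int N + 1)"
  have k: "k \<in> H" "bij k" "iv e \<in> H" "bij e" "bij (iv e)"
    using plgroupD[OF pl] c(1) assms(1) unfolding k_def by (auto simp: bij_imp_bij_inv)
  show thesis
  proof (rule that)
    show "comm (iv e) k \<in> der H" using comm_in_der k by blast
    fix x assume x: "x \<in> {z..c z}"
    have "iv k (e (k x)) = x" using N[OF _ x, of "int N + 1"] by (simp add: cj_def k_def)
    then have "e (k x) = k x" using k(2) by (simp add: iv_eq_iff)
    then have "iv e (k x) = k x" using k(4) by (simp add: iv_eq_iff)
    then have "iv k (iv e (k x)) = x" using k(2) by (simp add: bij_iv_simps(2))
    moreover have "iv (iv e) x = e x" using k by (simp add: iv_eq_iff bij_iv_simps(2))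
    ultimately show "comm (iv e) k x = e x" by (simp add: comm_def)
  qed
qed

text \<open>Each generator is a power of \<open>c\<close> times an element \<open>d s\<close> of
  slope 1. Every element of \<open>H\<close> is then a power of \<open>c\<close> times a product of
  conjugates of the \<open>d s\<close> and their inverses, and an elliptic element involves the
  trivial power only. Of these conjugates just finitely many act nontrivially on the domain.\<close>

lemma domain_structure_cyclic:
  assumes cyc: "\<And>h. h \<in> H \<Longrightarrow> \<exists>n. lam (ipow c n \<circ> h) = 1"
  obtains T where "finite T" "T \<subseteq> der H"
    "\<And>h. h \<in> H \<Longrightarrow> el h \<Longrightarrow> \<exists>\<delta>\<in>gen T. \<forall>x\<in>{z..c z}. \<delta> x = h x"
proof -
  have bc: "bij c" using plgroupD(5)[OF pl c(1)] .
  have SH: "S \<subseteq> H" using S(1) gen.incl by blast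
  obtain \<nu> where nu: "\<And>h. h \<in> H \<Longrightarrow> lam (ipow c (\<nu> h) \<circ> h) = 1" using cyc by metis
  define d where "d s = ipow c (\<nu> s) \<circ> s" for s
  have d: "d s \<in> H" "lam (d s) = 1" "el (d s)" if "s \<in> S" for s
  proof -
    have "s \<in> H" using that SH by blast
    then show "d s \<in> H" "lam (d s) = 1" unfolding d_def
      using plgroupD(7)[OF pl plgroupD(8)[OF pl c(1)]] nu by blast+
    then show "el (d s)" using el_iff by blast
  qed
  have "\<exists>N::nat. \<forall>m x. \<bar>m\<bar> > int N \<longrightarrow> x \<in> {z..c z} \<longrightarrow> cj c m (d s) x = x" if "s \<in> S" for s
    using far_trivial[OF d(1,3)[OF that]] by metis
  then obtain N :: "(real \<Rightarrow> real) \<Rightarrow> nat"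
    where N: "\<And>s m x. s \<in> S \<Longrightarrow> \<bar>m\<bar> > int (N s) \<Longrightarrow> x \<in> {z..c z} \<Longrightarrow> cj c m (d s) x = x"
    by metis
  have "\<exists>\<delta>\<in>der H. \<forall>x\<in>{z..c z}. \<delta> x = e x" if "e \<in> H" "lam e = 1" for e
    using commutator_on_domain[OF that(1)] el_iff[OF that(1)] that(2) by metis
  then obtain \<Delta> where \<Delta>: "\<And>e. e \<in> H \<Longrightarrow> lam e = 1 \<Longrightarrow> \<Delta> e \<in> der H \<and> (\<forall>x\<in>{z..c z}. \<Delta> e x = e x)"
    by metis
  \<comment> \<open>\<open>\<Delta>\<close> replaces a conjugate by an element of
    \<open>der H\<close> with the same restriction to the domain; the exponents beyond
    \<open>N s\<close> contribute only the identity.\<close>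
  define T where "T = (\<lambda>(s, m). \<Delta> (cj c m (d s))) ` (SIGMA s:S. {- int (N s)..int (N s)})"
  have finT: "finite T" unfolding T_def using S(2) by auto
  have TH: "T \<subseteq> der H" unfolding T_def using \<Delta> cj_in cj_lam c(1) d by auto
  have bT: "bij \<delta>" if "\<delta> \<in> gen T" for \<delta>
    using that gen_bij[of T] TH plgroupD(5)[OF plgroup_der[OF pl]] by blast
  define agree where "agree e \<longleftrightarrow> (\<exists>\<delta>\<in>gen T. \<forall>x\<in>{z..c z}. \<delta> x = e x)" for e
  \<comment> \<open>Demanding agreement for all conjugates, and not for \<open>g\<close> alone,
    makes \<open>G\<close> invariant under conjugation by powers of \<open>c\<close>.\<close>
  define G where "G = {g. g \<in> H \<and> lam g = 1 \<and> (\<forall>m. agree (cj c m g))}"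
  have GH: "g \<in> H" "lam g = 1" "bij g" if "g \<in> G" for g
    using that plgroupD(5)[OF pl] by (auto simp: G_def)
  have G_d: "d s \<in> G" if s: "s \<in> S" for s
  proof -
    have "agree (cj c m (d s))" for m
    proof (cases "\<bar>m\<bar> > int (N s)")
      case True
      then show ?thesis unfolding agree_def using N[OF s] by (intro bexI[of _ id] gen.one) auto
    next
      case False
      then have "\<Delta> (cj c m (d s)) \<in> T" unfolding T_def using s by (auto intro!: image_eqI[of _ _ "(s, m)"])
      moreover have "\<forall>x\<in>{z..c z}. \<Delta> (cj c m (d s)) x = cj c m (d s) x"
        using \<Delta> cj_in cj_lam c(1) d[OF s] by blast
      ultimately show ?thesis unfolding agree_def using gen.incl by blast
    qed
    then show ?thesis using d[OF s] by (simp add: G_def)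
  qed
  have G_id: "id \<in> G"
  proof -
    have "cj c m id x = x" for m x using bc by (simp add: cj_apply)
    then have "agree (cj c m id)" for m unfolding agree_def by (intro bexI[of _ id] gen.one) simp
    moreover have "lam id = 1" using lam_eq[OF plgroupD(4)[OF pl] slope_id] .
    ultimately show ?thesis using plgroupD(4)[OF pl] by (simp add: G_def)
  qed
  have G_comp: "f \<circ> g \<in> G" if fg: "f \<in> G" "g \<in> G" for f g
  proof -
    have "agree (cj c m (f \<circ> g))" for m
    proof -
      obtain \<delta> \<epsilon> where *: "\<delta> \<in> gen T" "\<forall>x\<in>{z..c z}. \<delta> x = cj c m f x" "\<epsilon> \<in> gen T" "\<forall>x\<in>{z..c z}. \<epsilon> x = cj c m g x"
        using fg unfolding G_def agree_def by blast
      have "(\<delta> \<circ> \<epsilon>) x = cj c m (f \<circ> g) x" if "x \<in> {z..c z}" for x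
      proof -
        have "cj c m g x \<in> {z..c z}"
          using preserves_domain[OF cj_in[OF c(1)] cj_lam[OF c(1)] that] GH[OF fg(2)] by blast
        then have "(\<delta> \<circ> \<epsilon>) x = cj c m f (cj c m g x)" using * that by simp
        then show ?thesis using bc by (simp add: cj_apply)
      qed
      then show ?thesis unfolding agree_def using gen.comp[OF *(1,3)] by blast
    qed
    moreover have "f \<circ> g \<in> H" "lam (f \<circ> g) = 1"
      using plgroupD(7)[OF pl] lam_comp GH[OF fg(1)] GH[OF fg(2)] by auto
    ultimately show ?thesis by (simp add: G_def)
  qed
  have G_iv: "iv g \<in> G" if g: "g \<in> G" for g
  proof -
    have "agree (cj c m (iv g))" for m
    proof -
      obtain \<delta> where *: "\<delta> \<in> gen T" "\<forall>x\<in>{z..c z}. \<delta> x = cj c m g x"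
        using g unfolding G_def agree_def by blast
      have e: "cj c m g \<in> H" "lam (cj c m g) = 1" "bij (cj c m g)"
        using cj_in[OF c(1)] cj_lam[OF c(1)] GH[OF g] plgroupD(5)[OF pl] by auto
      have "iv \<delta> x = cj c m (iv g) x" if "x \<in> {z..c z}" for x
      proof -
        have "iv (cj c m g) x \<in> {z..c z}"
          using preserves_domain[OF plgroupD(6)[OF pl e(1)] _ that] lam_iv[OF e(1)] e(2) by simp
        then have "\<delta> (iv (cj c m g) x) = x" using *(2) e(3) by (simp add: bij_iv_simps(1)[of "cj c m g"])
        then have "iv \<delta> x = iv (cj c m g) x" using bT[OF *(1)] by (simp add: iv_eq_iff)
        then show ?thesis unfolding cj_def conj_iv[OF bij_ipow[OF bc] GH(3)[OF g]] .
      qed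
      then show ?thesis unfolding agree_def using gen.inverse[OF *(1)] by blast
    qed
    moreover have "iv g \<in> H" "lam (iv g) = 1"
      using plgroupD(6)[OF pl] lam_iv GH[OF g] by auto
    ultimately show ?thesis by (simp add: G_def)
  qed
  have G_cj: "cj c k g \<in> G" if g: "g \<in> G" for g k
    using g cj_in[OF c(1) GH(1)[OF g]] cj_lam[OF c(1) GH(1,2)[OF g]]
    by (simp add: G_def cj_cj[OF bc])
  \<comment> \<open>The powers of \<open>c\<close> normalize \<open>G\<close>, so their products
    with elements of \<open>G\<close> form a group; it contains all generators.\<close>
  have "gen S \<subseteq> {h. \<exists>n. ipow c n \<circ> h \<in> G}"
  proof (rule gen_subsetI)
    show "id \<in> {h. \<exists>n. ipow c n \<circ> h \<in> G}" using G_id by (auto intro!: exI[of _ 0])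
    show "S \<subseteq> {h. \<exists>n. ipow c n \<circ> h \<in> G}" using G_d unfolding d_def by blast
  next
    fix h assume hS: "h \<in> gen S" and "h \<in> {h. \<exists>n. ipow c n \<circ> h \<in> G}"
    then obtain n where n: "ipow c n \<circ> h \<in> G" by blast
    have bh: "bij h" using hS S(1) plgroupD(5)[OF pl] by blast
    have "ipow c (- n) \<circ> iv h = cj c n (iv (ipow c n \<circ> h))"
    proof
      fix x
      have "iv (ipow c n \<circ> h) (ipow c n x) = iv h x"
        using bh bij_ipow[OF bc, of n] by (simp add: iv_eq_iff bij_comp bij_iv_simps(1)[of h])
      then show "(ipow c (- n) \<circ> iv h) x = cj c n (iv (ipow c n \<circ> h)) x"
        by (simp add: cj_apply[OF bc])
    qed
    then have "ipow c (- n) \<circ> iv h \<in> G" using G_cj[OF G_iv[OF n]] by metis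
    then show "iv h \<in> {h. \<exists>n. ipow c n \<circ> h \<in> G}" by blast
  next
    fix h k assume "h \<in> {h. \<exists>n. ipow c n \<circ> h \<in> G}" "k \<in> {h. \<exists>n. ipow c n \<circ> h \<in> G}"
    then obtain m n where mn: "ipow c m \<circ> h \<in> G" "ipow c n \<circ> k \<in> G" by blast
    have "ipow c (m + n) \<circ> (h \<circ> k) = cj c (- n) (ipow c m \<circ> h) \<circ> (ipow c n \<circ> k)"
    proof
      fix x
      show "(ipow c (m + n) \<circ> (h \<circ> k)) x = (cj c (- n) (ipow c m \<circ> h) \<circ> (ipow c n \<circ> k)) x"
        using ipow_add[OF bc, of n m] bc by (simp add: cj_apply[OF bc] add.commute)
    qed
    then have "ipow c (m + n) \<circ> (h \<circ> k) \<in> G" using G_comp[OF G_cj[OF mn(1)] mn(2)] by metis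
    then show "h \<circ> k \<in> {h. \<exists>n. ipow c n \<circ> h \<in> G}" by blast
  qed
  then have HG: "\<exists>n. ipow c n \<circ> h \<in> G" if "h \<in> H" for h using that S(1) by blast
  have "agree h" if h: "h \<in> H" "el h" for h
  proof -
    obtain n where n: "ipow c n \<circ> h \<in> G" using HG h by blast
    \<comment> \<open>Both \<open>h\<close> and its product with the power of \<open>c\<close> have
      slope 1, and \<open>lam c\<close> exceeds 1, so the power is trivial.\<close>
    have "lam c powi n = 1"
      using GH(2)[OF n] lam_comp[OF plgroupD(8)[OF pl c(1), of n] h(1)] lam_ipow[OF c(1)] el_iff h by simp
    then have "n = 0" using c(2) power_int_strict_increasing[of 0 n "lam c"] power_int_strict_increasing[of n 0 "lam c"]
      by (cases n "0::int" rule: linorder_cases) auto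
    then have "cj c 0 h = h" "h \<in> G" using n by (auto simp: cj_apply[OF bc])
    then show ?thesis unfolding G_def by (metis (mono_tags, lifting) mem_Collect_eq)
  qed
  then show thesis using that[OF finT TH] unfolding agree_def by blast
qed

end

text \<open>If the slopes are not discrete, \<open>der H\<close> fixes the orbital pointwise by
  \<open>dense_case\<close>. Elliptic elements then act trivially on it, and the empty set serves as
  \<open>T\<close>.\<close>

lemma domain_structure:
  obtains c T where "c \<in> H" "\<And>x. a < x \<Longrightarrow> x < b \<Longrightarrow> x < c x" "finite T" "T \<subseteq> der H"
    "\<And>h. h \<in> H \<Longrightarrow> el h \<Longrightarrow> \<exists>\<delta>\<in>gen T. \<forall>x\<in>{z..c z}. \<delta> x = h x"
proof (cases "\<exists>\<epsilon>>0. \<forall>h\<in>H. 1 < lam h \<longrightarrow> 1 + \<epsilon> \<le> lam h")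
  case True
  then obtain \<epsilon> where "\<epsilon> > 0" "\<And>h. h \<in> H \<Longrightarrow> 1 < lam h \<Longrightarrow> 1 + \<epsilon> \<le> lam h" by blast
  from cyclic_case[OF this] obtain c where c: "c \<in> H" "lam c > 1" "\<And>h. h \<in> H \<Longrightarrow> \<exists>n. lam (ipow c n \<circ> h) = 1"
    by blast
  obtain T where "finite T" "T \<subseteq> der H" "\<And>h. h \<in> H \<Longrightarrow> el h \<Longrightarrow> \<exists>\<delta>\<in>gen T. \<forall>x\<in>{z..c z}. \<delta> x = h x"
    using domain_structure_cyclic[OF c(1,2) c(3)] by blast
  then show thesis using that c(1) c_up[OF c(1,2)] by blast
next
  case False
  then have dense: "\<exists>h\<in>H. 1 < lam h \<and> lam h < 1 + \<epsilon>" if "\<epsilon> > 0" for \<epsilon> using that by force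
  obtain c where c: "c \<in> H" "lam c > 1" using expanding .
  have "\<exists>\<delta>\<in>gen {}. \<forall>x\<in>{z..c z}. \<delta> x = h x" if h: "h \<in> H" "el h" for h
  proof (rule bexI[OF _ gen.one], rule ballI)
    fix x assume "x \<in> {z..c z}"
    then have x: "a < x" "x < b" using z cz[OF c] by auto
    then have "x \<in> fixpts (der H)" using dense_case[OF dense] by blast
    then show "id x = h x" using el_fix[OF h] x by simp
  qed
  then show thesis using that[of c "{}"] c(1) c_up[OF c] by blast
qed

end

subsection \<open>Solvability and towers\<close>

context bad_orbital
begin

lemma der_el: "d \<in> der H \<Longrightarrow> el d"
proof -
  assume "d \<in> der H"
  then obtain e where e: "e > 0" "\<And>x. \<bar>x - a\<bar> \<le> e \<Longrightarrow> d x = x"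
    using der_fix_near[OF pl ab(2)] by metis
  define p where "p = a + min e ((b - a) / 2)"
  have "a < p" "p < b" "\<bar>p - a\<bar> \<le> e" using e(1) ab(1) by (auto simp: p_def min_def field_simps)
  with e(2) show "el d" unfolding el_def by blast
qed

text \<open>Elements of \<open>der H\<close> preserve the fundamental domain, so restriction is a
  homomorphism there. Its image lies in the restrictions of \<open>gen T\<close>, and homomorphisms
  respect derived series.\<close>

lemma derived_on_domain:
  assumes T: "T \<subseteq> der H" and cz: "c z \<in> fixpts (der H)"
    and agree: "\<And>h. h \<in> H \<Longrightarrow> el h \<Longrightarrow> \<exists>\<delta>\<in>gen T. \<forall>x\<in>{z..c z}. \<delta> x = h x"
    and g: "g \<in> dseries (der H) n"
  shows "\<exists>\<delta>\<in>dseries (gen T) n. \<forall>x\<in>{z..c z}. \<delta> x = g x"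
proof -
  have pD: "plgroup (der H)" using plgroup_der pl .
  have pT: "plgroup (gen T)" using plgroup_gen[OF pD T] by blast
  have keep: "h x \<in> {z..c z}" if "h \<in> der H" "x \<in> {z..c z}" for h x
  proof -
    have "h z = z" "h (c z) = c z" using that(1) z(1) cz by (auto simp: fixpts_def)
    then show ?thesis
      using that(2) PLa_le[OF plgroupD(3)[OF pD that(1)], of z x] PLa_le[OF plgroupD(3)[OF pD that(1)], of x "c z"]
      by auto
  qed
  have sub: "dseries (der H) n \<subseteq> der H" for n using dseries_subset plgroupD(1)[OF pD] by blast
  define A where "A n = {g \<in> der H. \<exists>\<delta>\<in>dseries (gen T) n. \<forall>x\<in>{z..c z}. \<delta> x = g x}" for n
  have A_iv: "iv g \<in> A n" if gA: "g \<in> A n" for g n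
  proof -
    obtain \<delta> where d: "g \<in> der H" "\<delta> \<in> dseries (gen T) n" "\<forall>x\<in>{z..c z}. \<delta> x = g x"
      using gA by (auto simp: A_def)
    have pn: "plgroup (dseries (gen T) n)" using plgroup_dseries[OF pT] .
    have ig: "iv g \<in> der H" using plgroupD(6)[OF pD d(1)] .
    have "iv \<delta> x = iv g x" if x: "x \<in> {z..c z}" for x
    proof -
      have "\<delta> (iv g x) = x" using d(3) keep[OF ig x] plgroupD(5)[OF pD d(1)] by (simp add: bij_iv_simps(1)[of g])
      then show ?thesis using plgroupD(5)[OF pn d(2)] by (simp add: iv_eq_iff)
    qed
    then show ?thesis using ig plgroupD(6)[OF pn d(2)] unfolding A_def by blast
  qed
  have A_comp: "f \<circ> g \<in> A n" if fA: "f \<in> A n" and gA: "g \<in> A n" for f g n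
  proof -
    obtain \<delta> where d: "f \<in> der H" "\<delta> \<in> dseries (gen T) n" "\<forall>x\<in>{z..c z}. \<delta> x = f x"
      using fA by (auto simp: A_def)
    obtain \<epsilon> where e: "g \<in> der H" "\<epsilon> \<in> dseries (gen T) n" "\<forall>x\<in>{z..c z}. \<epsilon> x = g x"
      using gA by (auto simp: A_def)
    have "\<delta> \<circ> \<epsilon> \<in> dseries (gen T) n" using plgroupD(7)[OF plgroup_dseries[OF pT] d(2) e(2)] .
    moreover have "\<forall>x\<in>{z..c z}. (\<delta> \<circ> \<epsilon>) x = (f \<circ> g) x" using d(3) e(3) keep[OF e(1)] by simp
    ultimately show ?thesis using plgroupD(7)[OF pD d(1) e(1)] unfolding A_def by blast
  qed
  have "dseries (der H) n \<subseteq> A n"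
  proof (induct n)
    case 0
    have "g \<in> A 0" if "g \<in> der H" for g
      using agree[of g] der_el[OF that] that der_subset[OF fgH] by (auto simp: A_def)
    then show ?case by auto
  next
    case (Suc n)
    have "der (dseries (der H) n) \<subseteq> A (Suc n)"
      unfolding der_def[of "dseries (der H) n"]
    proof (rule gen_subsetI)
      show "id \<in> A (Suc n)"
        unfolding A_def using plgroupD(4)[OF pD] plgroupD(4)[OF plgroup_dseries[OF pT, of "Suc n"]] by blast
      show "{comm f g |f g. f \<in> dseries (der H) n \<and> g \<in> dseries (der H) n} \<subseteq> A (Suc n)"
      proof clarify
        fix f g assume fg: "f \<in> dseries (der H) n" "g \<in> dseries (der H) n"
        obtain \<delta> where d: "f \<in> der H" "\<delta> \<in> dseries (gen T) n" "\<forall>x\<in>{z..c z}. \<delta> x = f x"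
          using Suc fg by (auto simp: A_def)
        obtain \<epsilon> where e: "g \<in> der H" "\<epsilon> \<in> dseries (gen T) n" "\<forall>x\<in>{z..c z}. \<epsilon> x = g x"
          using Suc fg by (auto simp: A_def)
        have pn: "plgroup (dseries (gen T) n)" using plgroup_dseries[OF pT] .
        have iv_agree: "iv \<alpha> x = iv h x"
          if "h \<in> der H" "\<alpha> \<in> dseries (gen T) n" "\<forall>x\<in>{z..c z}. \<alpha> x = h x" "x \<in> {z..c z}" for \<alpha> h x
        proof -
          have "\<alpha> (iv h x) = x"
            using that(3) keep[OF plgroupD(6)[OF pD that(1)] that(4)] plgroupD(5)[OF pD that(1)]
            by (simp add: bij_iv_simps(1)[of h])
          then show ?thesis using plgroupD(5)[OF pn that(2)] by (simp add: iv_eq_iff)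
        qed
        have "comm \<delta> \<epsilon> x = comm f g x" if x: "x \<in> {z..c z}" for x
        proof -
          have 1: "g x \<in> {z..c z}" using keep[OF e(1) x] .
          have 2: "f (g x) \<in> {z..c z}" using keep[OF d(1) 1] .
          have 3: "iv g (f (g x)) \<in> {z..c z}" using keep[OF plgroupD(6)[OF pD e(1)] 2] .
          have "\<delta> (\<epsilon> x) = f (g x)" using d(3) e(3) x 1 by simp
          then show ?thesis using iv_agree[OF e 2] iv_agree[OF d 3] by (simp add: comm_def)
        qed
        moreover have "comm \<delta> \<epsilon> \<in> dseries (gen T) (Suc n)" using comm_in_der[OF d(2) e(2)] by simp
        moreover have "comm f g \<in> der H" using comm_in[OF plgroupD(1)[OF pD] d(1) e(1)] .
        ultimately show "comm f g \<in> A (Suc n)" unfolding A_def by blast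
      qed
    qed (use A_iv A_comp in blast)+
    then show ?case by simp
  qed
  with g show ?thesis by (auto simp: A_def)
qed

text \<open>A power of \<open>c\<close> carries any point of the orbital into the fundamental
  domain, and the terms of the derived series are normal, so triviality on the domain
  suffices.\<close>

lemma solvable_on_orbital:
  assumes c: "c \<in> H" "\<And>x. a < x \<Longrightarrow> x < b \<Longrightarrow> x < c x" and T: "T \<subseteq> der H"
    and agree: "\<And>h. h \<in> H \<Longrightarrow> el h \<Longrightarrow> \<exists>\<delta>\<in>gen T. \<forall>x\<in>{z..c z}. \<delta> x = h x"
    and solv: "dseries (gen T) n \<subseteq> {id}" and w: "w \<in> dseries H (Suc n)" and x: "a < x" "x < b"
  shows "w x = x"
proof -
  have cz: "c z \<in> fixpts (der H)" using fix_der_inv[OF fgH z(1) c(1)] .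
  obtain m where m: "z \<le> ipow c m x" "ipow c m x \<le> c z"
    using fundamental_domain[OF c(1) pl o c(2) x z(2,3)] by blast
  have bc: "bij c" using plgroupD(5)[OF pl c(1)] .
  have "cj c (- m) w \<in> dseries H (Suc n)"
    unfolding cj_def by (rule dseries_normal[OF fgH plgroupD(8)[OF pl c(1)] w])
  then have "cj c (- m) w \<in> dseries (der H) n" unfolding dseries_Suc_right .
  from derived_on_domain[where c = c and T = T, OF T cz agree this] solv
  have "cj c (- m) w (ipow c m x) = ipow c m x" using m by fastforce
  then have "ipow c m (w x) = ipow c m x" using bc by (simp add: cj_apply)
  then show ?thesis using bij_ipow[OF bc, of m] by (metis bij_iv_simps(2))
qed

end

section \<open>Existence and finiteness of the orbitals of a group\<close>

lemma orb_exists: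
  assumes "plgroup H" "x \<notin> fixpts H"
  obtains a b where "orb H a b" "a < x" "x < b"
proof -
  define A where "A = fixpts H \<inter> {..x}"
  define B where "B = fixpts H \<inter> {x..}"
  have x: "0 < x" "x < 1" using fixpts_outside[OF assms(1), of x] assms(2) by force+
  have mem: "0 \<in> A" "1 \<in> B" unfolding A_def B_def using fixpts_outside[OF assms(1)] x by auto
  have cl: "closed A" "closed B" unfolding A_def B_def using fixpts_closed[OF assms(1)] by (auto intro: closed_Int)
  have bd: "bdd_above A" "bdd_below B" by (auto simp: A_def B_def bdd_above_def bdd_below_def)
  have a: "Sup A \<in> A" using closed_contains_Sup[OF _ bd(1) cl(1)] mem by blast
  have b: "Inf B \<in> B" using closed_contains_Inf[OF _ bd(2) cl(2)] mem by blast
  have "Sup A \<in> fixpts H" "Sup A \<le> x" "Inf B \<in> fixpts H" "x \<le> Inf B"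
    using a b unfolding A_def B_def by blast+
  moreover from this have "Sup A \<noteq> x" "Inf B \<noteq> x" using assms(2) by metis+
  ultimately have ax: "Sup A < x" and xb: "x < Inf B" by linarith+
  have "y \<notin> fixpts H" if y: "Sup A < y" "y < Inf B" for y
  proof
    assume "y \<in> fixpts H"
    then have "y \<in> A \<or> y \<in> B" by (auto simp: A_def B_def)
    then show False using cSup_upper[OF _ bd(1), of y] cInf_lower[OF _ bd(2), of y] y by auto
  qed
  then have "orb H (Sup A) (Inf B)" unfolding orb_def using a b ax xb by (auto simp: A_def B_def)
  then show thesis using that ax xb by blast
qed

lemma orb_unique: "orb H a b \<Longrightarrow> orb H a b' \<Longrightarrow> b = b'"
  unfolding orb_def by (cases b b' rule: linorder_cases) auto

text \<open>The left end of an orbital is a frontier point of the support of some generator, for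
  otherwise all generators would be the identity near it. It determines the right end by
  \<open>orb_unique\<close>.\<close>

lemma finite_orbitals:
  assumes "plgroup H" "H = gen S" "finite S"
  shows "finite {a. \<exists>b. orb H a b}"
proof (rule finite_subset)
  have SP: "s \<in> PLa" if "s \<in> S" for s using that assms gen.incl plgroupD(3) by blast
  show "finite (\<Union>s\<in>S. {e. s e = e \<and> e \<in> closure (mv s)})"
    using assms(3) finite_frontier_fix SP by blast
  show "{a. \<exists>b. orb H a b} \<subseteq> (\<Union>s\<in>S. {e. s e = e \<and> e \<in> closure (mv s)})"
  proof clarify
    fix a b assume o: "orb H a b"
    have fa: "s a = a" if "s \<in> S" for s using o that assms(2) gen.incl[OF that] by (auto simp: orb_def fixpts_def)
    show "a \<in> (\<Union>s\<in>S. {e. s e = e \<and> e \<in> closure (mv s)})"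
    proof (rule ccontr)
      assume "\<not> ?thesis"
      then have n: "a \<notin> (\<Union>s\<in>S. closure (mv s))" using fa by blast
      have "closed (\<Union>s\<in>S. closure (mv s))" using assms(3) by auto
      then have "open (- (\<Union>s\<in>S. closure (mv s)))" by (rule open_Compl)
      then obtain e where e: "e > 0" "cball a e \<subseteq> - (\<Union>s\<in>S. closure (mv s))"
        using n unfolding open_contains_cball by blast
      define p where "p = a + min e ((b - a) / 2)"
      have p: "a < p" "p < b" "p \<in> cball a e"
        using e(1) o by (auto simp: p_def orb_def dist_real_def min_def field_simps)
      have "s p = p" if "s \<in> S" for s
      proof -
        have "p \<notin> mv s" using e(2) p(3) that closure_subset[of "mv s"] by blast
        then show ?thesis by (simp add: mv_def)
      qed
      then have "p \<in> fixpts H" unfolding assms(2) by (subst fixpts_gen) (use SP PLaD(2) in auto)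
      then show False using o p by (auto simp: orb_def)
    qed
  qed
qed

abbreviation fsolvable :: "(real \<Rightarrow> real) set \<Rightarrow> bool" where
  "fsolvable H \<equiv> (\<exists>n. dseries H n \<subseteq> {id})"

text \<open>If all finitely generated subgroups of \<open>der H\<close> are solvable, then so is the action of \<open>H\<close> on each of
  the finitely many bad orbitals, and a term of the derived series is supported on the good ones.\<close>

lemma dichotomy:
  assumes "plgroup H" "H = gen S" "finite S" "\<not> fsolvable H"
    and solv: "\<And>T. finite T \<Longrightarrow> T \<subseteq> der H \<Longrightarrow> fsolvable (gen T)"
  obtains L where "plgroup L" "L \<subseteq> H" "\<not> L \<subseteq> {id}" "\<And>g. g \<in> L \<Longrightarrow> closure (mv g) \<inter> fixpts L = {}"
proof -
  have fg: "fgroup H" using plgroupD(1)[OF assms(1)] .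
  have "\<exists>n. \<forall>w\<in>dseries H n. \<forall>x. a < x \<longrightarrow> x < b \<longrightarrow> w x = x"
    if ab: "orb H a b" "{a<..<b} \<inter> fixpts (der H) \<noteq> {}" for a b
  proof -
    obtain z where z: "z \<in> fixpts (der H)" "a < z" "z < b" using ab by auto
    interpret bad_orbital H S a b z by unfold_locales (fact assms(1-3) ab(1) z)+
    obtain c T where cT: "c \<in> H" "\<And>x. a < x \<Longrightarrow> x < b \<Longrightarrow> x < c x" "finite T" "T \<subseteq> der H"
      "\<And>h. h \<in> H \<Longrightarrow> el h \<Longrightarrow> \<exists>\<delta>\<in>gen T. \<forall>x\<in>{z..c z}. \<delta> x = h x"
      using domain_structure by metis
    obtain n where n: "dseries (gen T) n \<subseteq> {id}" using solv[OF cT(3,4)] by blast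
    show ?thesis using solvable_on_orbital[OF cT(1,2,4,5) n] by blast
  qed
  then have "\<exists>n. \<forall>b. orb H a b \<longrightarrow> {a<..<b} \<inter> fixpts (der H) \<noteq> {} \<longrightarrow>
      (\<forall>w\<in>dseries H n. \<forall>x. a < x \<longrightarrow> x < b \<longrightarrow> w x = x)" for a
    using orb_unique by metis
  then obtain \<nu> where \<nu>: "\<And>a b w x. orb H a b \<Longrightarrow> {a<..<b} \<inter> fixpts (der H) \<noteq> {} \<Longrightarrow>
      w \<in> dseries H (\<nu> a) \<Longrightarrow> a < x \<Longrightarrow> x < b \<Longrightarrow> w x = x" by metis
  obtain N where N: "\<And>a b. orb H a b \<Longrightarrow> \<nu> a \<le> N"
    using finite_orbitals[OF assms(1-3)] finite_nat_set_iff_bounded_le[of "\<nu> ` {a. \<exists>b. orb H a b}"] by auto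
  \<comment> \<open>The successor ensures that \<open>L\<close> is contained in \<open>der H\<close>
    even if \<open>N\<close> is 0, so that its elements are the identity near
    \<open>fixpts H\<close>.\<close>
  define L where "L = dseries H (Suc N)"
  show thesis
  proof (rule that)
    show "plgroup L" "L \<subseteq> H" "\<not> L \<subseteq> {id}"
      unfolding L_def using plgroup_dseries[OF assms(1)] dseries_subset[OF fg] assms(4) by blast+
    show "closure (mv g) \<inter> fixpts L = {}" if g: "g \<in> L" for g
    proof (rule ccontr)
      assume "closure (mv g) \<inter> fixpts L \<noteq> {}"
      then obtain p where p: "p \<in> closure (mv g)" "p \<in> fixpts L" by auto
      have "g \<in> der H" using g dseries_antimono[OF fg, of 1 "Suc N"] by (auto simp: L_def)
      then have "p \<notin> fixpts H" using der_closure_mv[OF assms(1)] p by blast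
      then obtain a b where ab: "orb H a b" "a < p" "p < b" using orb_exists[OF assms(1)] by blast
      show False
      proof (cases "{a<..<b} \<inter> fixpts (der H) = {}")
        case True
        then show False using good_orbital[OF assms(1) ab(1) True, of "Suc N"] p(2) ab by (auto simp: L_def)
      next
        case False
        have "\<nu> a \<le> Suc N" using N[OF ab(1)] by simp
        then have "g \<in> dseries H (\<nu> a)" using g dseries_antimono[OF fg] unfolding L_def by blast
        then have "g x = x" if "a < x" "x < b" for x using \<nu>[OF ab(1) False] that by blast
        moreover define e where "e = min ((p - a) / 2) ((b - p) / 2)"
        have e: "e \<le> (p - a) / 2" "e \<le> (b - p) / 2" unfolding e_def by (rule min.cobounded1, rule min.cobounded2)
        moreover have "a < x \<and> x < b" if "\<bar>x - p\<bar> \<le> e" for x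
          using that ab(2,3) e by (auto simp: abs_le_iff)
        ultimately have "g x = x" if "\<bar>x - p\<bar> \<le> e" for x using that by blast
        moreover have "e > 0" using ab(2,3) unfolding e_def by simp
        ultimately show False using not_in_closure_mv[of e p g] p(1) by blast
      qed
    qed
  qed
qed

text \<open>A tower is represented by the end points of its orbitals.\<close>

definition orbi :: "(real \<Rightarrow> real) \<Rightarrow> real \<Rightarrow> real \<Rightarrow> bool" where
  "orbi g p q \<longleftrightarrow> p < q \<and> g p = p \<and> g q = q \<and> (\<forall>x. p < x \<longrightarrow> x < q \<longrightarrow> g x \<noteq> x)"

definition chain_of_orbitals :: "(real \<Rightarrow> real) set \<Rightarrow> (real \<times> real) set \<Rightarrow> bool" where
  "chain_of_orbitals H P \<longleftrightarrow> finite P \<and> (\<forall>(p, q)\<in>P. \<exists>g\<in>H. orbi g p q)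
    \<and> (\<forall>(p, q)\<in>P. \<forall>(p', q')\<in>P. p' \<le> p \<and> q \<le> q' \<or> p \<le> p' \<and> q' \<le> q)"

lemma chain_of_orbitalsD:
  assumes "chain_of_orbitals H P"
  shows "finite P" "(p, q) \<in> P \<Longrightarrow> \<exists>g\<in>H. orbi g p q"
    "(p, q) \<in> P \<Longrightarrow> (p', q') \<in> P \<Longrightarrow> p' \<le> p \<and> q \<le> q' \<or> p \<le> p' \<and> q' \<le> q"
    "(p, q) \<in> P \<Longrightarrow> p < q"
proof -
  note c = assms[unfolded chain_of_orbitals_def]
  show "finite P" using c by simp
  show 1: "\<exists>g\<in>H. orbi g p q" if "(p, q) \<in> P" using bspec[OF conjunct1[OF conjunct2[OF c]] that] by simp
  then show "p < q" if "(p, q) \<in> P" using that unfolding orbi_def by blast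
  show "p' \<le> p \<and> q \<le> q' \<or> p \<le> p' \<and> q' \<le> q" if pq: "(p, q) \<in> P" "(p', q') \<in> P"
    using bspec[OF conjunct2[OF conjunct2[OF c]] pq(1)] bspec[of P _ "(p', q')"] pq(2) by auto
qed

text \<open>Comparability puts the largest left end below the smallest right end.\<close>

lemma chain_common_point:
  assumes "chain_of_orbitals H P"
  shows "\<exists>x. \<forall>p q. (p, q) \<in> P \<longrightarrow> p < x \<and> x < q"
proof (cases "P = {}")
  case False
  note fin = chain_of_orbitalsD(1)[OF assms] and cmp = chain_of_orbitalsD(3)[OF assms]
    and pq = chain_of_orbitalsD(4)[OF assms]
  define m M where "m = Max (fst ` P)" and "M = Min (snd ` P)"
  have "m \<in> fst ` P" "M \<in> snd ` P" using fin False unfolding m_def M_def by auto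
  then obtain p q p' q' where "(p, q) \<in> P" "m = p" "(p', q') \<in> P" "M = q'" by auto
  then have "m < M" using cmp[of p q p' q'] pq[of p q] pq[of p' q'] by linarith
  show ?thesis
  proof (intro exI allI impI)
    fix p q assume "(p, q) \<in> P"
    then have "p \<le> m" "M \<le> q" unfolding m_def M_def using fin by (force intro: Max_ge Min_le)+
    then show "p < (m + M) / 2 \<and> (m + M) / 2 < q" using \<open>m < M\<close> by auto
  qed
qed simp

lemma orbi_conj:
  assumes "f \<in> PLa" "g \<in> PLa" "orbi g p q"
  shows "orbi (f \<circ> g \<circ> iv f) (f p) (f q)"
proof -
  have b: "bij f" using PLaD(2)[OF assms(1)] .
  have i: "iv f (f x) = x" "f (iv f x) = x" for x using b by (simp_all add: bij_iv_simps)
  have less: "p < iv f x \<longleftrightarrow> f p < x" "iv f x < q \<longleftrightarrow> x < f q" for x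
    using PLa_less[OF assms(1), of p "iv f x"] PLa_less[OF assms(1), of "iv f x" q] i by simp_all
  show ?thesis
    unfolding orbi_def
  proof (intro conjI allI impI)
    show "f p < f q" "(f \<circ> g \<circ> iv f) (f p) = f p" "(f \<circ> g \<circ> iv f) (f q) = f q"
      using assms i by (auto simp: orbi_def)
    fix x assume "f p < x" "x < f q"
    then have "g (iv f x) \<noteq> iv f x" using assms(3) less by (auto simp: orbi_def)
    then have "f (g (iv f x)) \<noteq> f (iv f x)" using assms(1) by simp
    then show "(f \<circ> g \<circ> iv f) x \<noteq> x" using i by simp
  qed
qed

text \<open>By induction on the derived length. The chain lies in one orbital of \<open>H\<close>,
  which is bad. Apart from this orbital itself, every member belongs to an elliptic element, and one
  conjugation moves all these members into the fundamental domain, where \<open>gen T\<close>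
  realizes them. Since \<open>gen T\<close> lies in \<open>der H\<close>, its derived length is
  smaller.\<close>

lemma tower_bound:
  assumes "plgroup H" "H = gen S" "finite S" "dseries H d \<subseteq> {id}" "chain_of_orbitals H P"
  shows "card P \<le> d"
  using assms
proof (induct d arbitrary: H S P)
  case 0
  have False if pq: "(p, q) \<in> P" for p q
  proof -
    obtain g where g: "g \<in> H" "orbi g p q" using chain_of_orbitalsD(2)[OF 0(5) pq] by blast
    have "H \<subseteq> {id}" using 0(4) unfolding funpow_0 .
    then have "g = id" using g(1) by blast
    then show False using g(2) unfolding orbi_def by (metis dense id_apply)
  qed
  then have "P = {}" by auto
  then show ?case by simp
next
  case (Suc d)
  note pl = Suc.prems(1)
  note fin = chain_of_orbitalsD(1)[OF Suc.prems(5)] and cmp = chain_of_orbitalsD(3)[OF Suc.prems(5)]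
    and orbs = chain_of_orbitalsD(2)[OF Suc.prems(5)]
  show ?case
  proof (cases "P = {}")
    case False
    obtain x where "\<forall>p q. (p, q) \<in> P \<longrightarrow> p < x \<and> x < q"
      using chain_common_point[OF Suc.prems(5)] by blast
    then have x: "\<And>p q. (p, q) \<in> P \<Longrightarrow> p < x \<and> x < q" by blast
    have "x \<notin> fixpts H"
    proof -
      obtain p q where "(p, q) \<in> P" using False by auto
      then obtain g where "g \<in> H" "g x \<noteq> x" using x orbs unfolding orbi_def by blast
      then show ?thesis by (auto simp: fixpts_def)
    qed
    then obtain a b where oab: "orb H a b" "a < x" "x < b" using orb_exists[OF pl] by blast
    have inab: "a \<le> p \<and> q \<le> b" if "(p, q) \<in> P" for p q
    proof -
      obtain g where g: "g \<in> H" "orbi g p q" using orbs[OF \<open>(p, q) \<in> P\<close>] by blast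
      have "g a = a" "g b = b" using oab(1) g(1) by (auto simp: orb_def fixpts_def)
      then have "\<not> (p < a \<and> a < q)" "\<not> (p < b \<and> b < q)" using g(2) by (auto simp: orbi_def)
      then show ?thesis using x[OF \<open>(p, q) \<in> P\<close>] oab by linarith
    qed
    \<comment> \<open>On a good orbital no term of the derived series has a fixed point, while the
      trivial group fixes everything.\<close>
    have "{a<..<b} \<inter> fixpts (der H) \<noteq> {}"
    proof
      assume "{a<..<b} \<inter> fixpts (der H) = {}"
      from good_orbital[OF pl oab(1) this, of "Suc d"] Suc.prems(4)
      have "x \<notin> fixpts (dseries H (Suc d))" using oab by auto
      then show False using Suc.prems(4) unfolding fixpts_def by auto
    qed
    then obtain z where z: "z \<in> fixpts (der H)" "a < z" "z < b" by auto
    interpret bad_orbital H S a b z by unfold_locales (fact Suc.prems(1-3) oab(1) z)+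
    obtain c T where c: "c \<in> H" "\<And>x. a < x \<Longrightarrow> x < b \<Longrightarrow> x < c x" and T: "finite T" "T \<subseteq> der H"
      and agree: "\<And>h. h \<in> H \<Longrightarrow> el h \<Longrightarrow> \<exists>\<delta>\<in>gen T. \<forall>x\<in>{z..c z}. \<delta> x = h x"
      using domain_structure by metis
    obtain n where n: "z \<le> ipow c n x" "ipow c n x \<le> c z"
      using fundamental_domain[OF c(1) pl oab(1) c(2) oab(2,3) z(2,3)] by blast
    define f where "f = ipow c n"
    have f: "f \<in> H" "f \<in> PLa" "bij f" "iv f \<in> H"
      using plgroupD(8)[OF pl c(1)] plgroupD(3,5,6)[OF pl] unfolding f_def by blast+
    have czF: "c z \<in> fixpts (der H)" "a < c z" "c z < b"
      using fix_der_inv[OF fgH z(1) c(1)] orb_inv[OF pl oab(1) c(1)] z by auto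
    \<comment> \<open>The orbital of \<open>H\<close> itself is the only possible member whose
      element need not be elliptic; its removal accounts for the increment in the bound.\<close>
    define P' where "P' = (\<lambda>(p, q). (f p, f q)) ` (P - {(a, b)})"
    have inj: "inj_on (\<lambda>(p, q). (f p, f q)) (P - {(a, b)})"
      using f(2) by (auto simp: inj_on_def)
    have orb': "\<exists>\<delta>\<in>gen T. orbi \<delta> (f p) (f q)" if pq: "(p, q) \<in> P" "(p, q) \<noteq> (a, b)" for p q
    proof -
      obtain g where g: "g \<in> H" "orbi g p q" using orbs[OF pq(1)] by blast
      define h where "h = f \<circ> g \<circ> iv f"
      have h: "h \<in> H" unfolding h_def using plgroupD(7)[OF pl] f(1,4) g(1) by blast
      have ho: "orbi h (f p) (f q)" unfolding h_def
        using orbi_conj[OF f(2) plgroupD(3)[OF pl g(1)] g(2)] .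
      have ends: "a < f p \<and> f p < b \<or> a < f q \<and> f q < b"
        using inab[OF pq(1)] x[OF pq(1)] pq(2) oab(2,3) orb_inv[OF pl oab(1) f(1)] by (metis less_le_trans le_less_trans order_le_less)
      then have "el h" using ho unfolding el_def orbi_def by blast
      then have hz: "h z = z" "h (c z) = c z" using el_fix[OF h] z czF by auto
      have fx: "f p < f x" "f x < f q" "z \<le> f x" "f x \<le> c z"
        using x[OF pq(1)] f(2) n by (auto simp: f_def)
      \<comment> \<open>The orbital of \<open>h\<close> contains the point \<open>f x\<close> of the
        domain, and \<open>h\<close> fixes both ends of the domain, so the orbital cannot cross
        them.\<close>
      have "\<not> f p < z" "\<not> c z < f q" using hz ho fx unfolding orbi_def by (meson le_less_trans less_le_trans)+
      moreover obtain \<delta> where \<delta>: "\<delta> \<in> gen T" "\<forall>x\<in>{z..c z}. \<delta> x = h x" using agree[OF h \<open>el h\<close>] by blast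
      ultimately have "orbi \<delta> (f p) (f q)" using ho fx unfolding orbi_def by auto
      then show ?thesis using \<delta>(1) by blast
    qed
    have chain: "chain_of_orbitals (gen T) P'"
      unfolding chain_of_orbitals_def
    proof (intro conjI)
      show "finite P'" using fin by (simp add: P'_def)
      show "\<forall>(p, q)\<in>P'. \<exists>g\<in>gen T. orbi g p q" unfolding P'_def using orb' by auto
      show "\<forall>(p, q)\<in>P'. \<forall>(p', q')\<in>P'. p' \<le> p \<and> q \<le> q' \<or> p \<le> p' \<and> q' \<le> q"
        unfolding P'_def using cmp f(2) by fastforce
    qed
    have pT: "plgroup (gen T)" "gen T \<subseteq> der H" using plgroup_gen[OF plgroup_der[OF pl] T(2)] by auto
    have "dseries (gen T) d \<subseteq> dseries (der H) d" by (rule dseries_mono[OF pT(2)])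
    also have "\<dots> \<subseteq> {id}" using Suc.prems(4) unfolding dseries_Suc_right .
    finally have "card P' \<le> d" using Suc.hyps[OF pT(1) _ T(1) _ chain] by blast
    moreover have "card P' = card (P - {(a, b)})" unfolding P'_def by (rule card_image[OF inj])
    ultimately show ?thesis using fin by (simp add: card_Diff_singleton_if split: if_splits)
  qed simp
qed

text \<open>In an ascending system the support \<open>Y n\<close> of the elements up to \<open>g n\<close> is wandering for \<open>g (Suc n)\<close>;
  in a descending one the support \<open>Y (Suc n)\<close> of the elements from \<open>g (Suc n)\<close> on is wandering for \<open>g n\<close>.\<close>

definition ascending :: "(real \<Rightarrow> real) set \<Rightarrow> (nat \<Rightarrow> real \<Rightarrow> real) \<Rightarrow> (nat \<Rightarrow> real set) \<Rightarrow> bool" where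
  "ascending H g Y \<longleftrightarrow> g 0 \<noteq> id \<and> (\<forall>n. g n \<in> H \<and> Y n \<subseteq> Y (Suc n) \<and> mv (g n) \<subseteq> Y n
    \<and> (\<forall>k x. k \<noteq> 0 \<longrightarrow> x \<in> Y n \<longrightarrow> ipow (g (Suc n)) k x \<notin> Y n))"

definition descending :: "(real \<Rightarrow> real) set \<Rightarrow> (nat \<Rightarrow> real \<Rightarrow> real) \<Rightarrow> (nat \<Rightarrow> real set) \<Rightarrow> bool" where
  "descending H g Y \<longleftrightarrow> (\<forall>n. g n \<in> H \<and> Y (Suc n) \<subseteq> Y n \<and> Y n \<noteq> {} \<and> mv (g n) \<subseteq> Y n
    \<and> (\<forall>k x. k \<noteq> 0 \<longrightarrow> x \<in> Y (Suc n) \<longrightarrow> ipow (g n) k x \<notin> Y (Suc n)))"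

section \<open>Existence of ascending or descending systems\<close>

lemma compact_closure_mv: assumes "f \<in> PLa" shows "compact (closure (mv f))"
proof -
  have "mv f \<subseteq> {0..1}" using PLa_mv[OF assms] greaterThanLessThan_subseteq_atLeastAtMost_iff[of 0 1 0 1] by auto
  then have "bounded (mv f)" by (rule bounded_subset[OF bounded_closed_interval])
  then show ?thesis by simp
qed

text \<open>Carry along a compact set \<open>K\<close> that avoids the fixed points of
  \<open>L\<close>. Some \<open>g'\<close> in \<open>L\<close> clears \<open>K\<close>; adding the
  closure of the support of \<open>g'\<close> keeps the set compact and away from the fixed
  points.\<close>

lemma ascending_exists:
  assumes "plgroup L" "\<not> L \<subseteq> {id}" "\<And>g. g \<in> L \<Longrightarrow> closure (mv g) \<inter> fixpts L = {}"
  shows "\<exists>g Y. ascending L g Y"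
proof -
  define Q where "Q = (\<lambda>(n::nat) (g, K). g \<in> L \<and> compact K \<and> K \<inter> fixpts L = {} \<and> mv g \<subseteq> K \<and> (n = 0 \<longrightarrow> g \<noteq> id))"
  define R where "R = (\<lambda>(n::nat) (g::real \<Rightarrow> real, K::real set) (g', K'). K \<subseteq> K' \<and> (\<forall>k x. k \<noteq> 0 \<longrightarrow> x \<in> K \<longrightarrow> ipow g' k x \<notin> K))"
  have cl: "compact (closure (mv g))" "mv g \<subseteq> closure (mv g)" if "g \<in> L" for g
    using compact_closure_mv plgroupD(3)[OF assms(1) that] closure_subset by blast+
  obtain g where g: "g \<in> L" "g \<noteq> id" using assms(2) by auto
  have "\<exists>s. Q 0 s"
    by (rule exI[of _ "(g, closure (mv g))"]) (use g cl[OF g(1)] assms(3)[OF g(1)] in \<open>simp add: Q_def\<close>)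
  moreover have "\<exists>t. Q (Suc n) t \<and> R n s t" if "Q n s" for n s
  proof -
    obtain g K where s: "s = (g, K)" by fastforce
    have K: "compact K" "K \<inter> fixpts L = {}" using that by (auto simp: Q_def s)
    obtain g' where g': "g' \<in> L" "\<And>n x. n \<noteq> 0 \<Longrightarrow> x \<in> K \<Longrightarrow> ipow g' n x \<notin> K"
      using clear_compact[OF assms(1) K] by metis
    show ?thesis
      by (rule exI[of _ "(g', K \<union> closure (mv g'))"])
        (use g' K cl[OF g'(1)] assms(3)[OF g'(1)] in \<open>auto simp: Q_def R_def s\<close>)
  qed
  ultimately obtain F where F: "\<And>n. Q n (F n)" "\<And>n. R n (F n) (F (Suc n))"
    using dependent_nat_choice[of Q R] by metis
  have "ascending L (fst \<circ> F) (snd \<circ> F)"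
    unfolding ascending_def using F unfolding Q_def R_def by (auto split: prod.splits simp: case_prod_beta)
  then show ?thesis by blast
qed

text \<open>\<open>Y n\<close> is the support of \<open>gen (T n)\<close>. The supports of the
  finitely many generators in \<open>T (Suc n)\<close>, taken from \<open>der (gen (T n))\<close>,
  have compact closures avoiding \<open>fixpts (gen (T n))\<close>, so one element of
  \<open>gen (T n)\<close> clears them all.\<close>

lemma descending_exists:
  assumes "plgroup H" "H = gen S" "finite S" "\<not> fsolvable H"
    and no: "\<And>T. finite T \<Longrightarrow> T \<subseteq> H \<Longrightarrow> \<not> fsolvable (gen T) \<Longrightarrow>
      \<exists>T'. finite T' \<and> T' \<subseteq> der (gen T) \<and> \<not> fsolvable (gen T')"
  shows "\<exists>g Y. descending H g Y"
proof -
  define Q where "Q = (\<lambda>(n::nat) T. finite T \<and> T \<subseteq> H \<and> \<not> fsolvable (gen T))"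
  define R where "R = (\<lambda>(n::nat) (T::(real \<Rightarrow> real) set) T'. T' \<subseteq> der (gen T))"
  have "\<exists>T. Q 0 T" using assms(2-4) gen.incl[of _ S] unfolding Q_def by blast
  moreover have "\<exists>T'. Q (Suc n) T' \<and> R n T T'" if "Q n T" for n T
  proof -
    have T: "finite T" "T \<subseteq> H" "\<not> fsolvable (gen T)" using that by (auto simp: Q_def)
    have pT: "plgroup (gen T)" "gen T \<subseteq> H" using plgroup_gen[OF assms(1) T(2)] by auto
    obtain T' where T': "finite T'" "T' \<subseteq> der (gen T)" "\<not> fsolvable (gen T')"
      using no[OF T] by blast
    have "der (gen T) \<subseteq> H" using der_subset[OF plgroupD(1)[OF pT(1)]] pT(2) by blast
    then show ?thesis using T' unfolding Q_def R_def by blast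
  qed
  ultimately obtain T where T: "\<And>n. Q n (T n)" "\<And>n. R n (T n) (T (Suc n))"
    using dependent_nat_choice[of Q R] by metis
  define Y where "Y n = - fixpts (gen (T n))" for n
  have pT: "plgroup (gen (T n))" "gen (T n) \<subseteq> H" for n
    using plgroup_gen[OF assms(1)] T(1)[of n] by (auto simp: Q_def)
  have TT: "gen (T (Suc n)) \<subseteq> der (gen (T n))" for n
    using gen_least[OF fgroup_der[OF plgroupD(1)[OF pT(1)]]] T(2)[of n] unfolding R_def by blast
  have "\<forall>n. \<exists>g. g \<in> gen (T n) \<and> (\<forall>k x. k \<noteq> 0 \<longrightarrow> x \<in> Y (Suc n) \<longrightarrow> ipow g k x \<notin> Y (Suc n))"
  proof
    fix n
    define K where "K = (\<Union>t\<in>T (Suc n). closure (mv t))"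
    have td: "t \<in> der (gen (T n))" "t \<in> H" if "t \<in> T (Suc n)" for t
      using that T(2)[of n] T(1)[of "Suc n"] by (auto simp: R_def Q_def)
    have "compact K" unfolding K_def
      using T(1)[of "Suc n"] td(2) compact_closure_mv plgroupD(3)[OF assms(1)] by (intro compact_UN) (auto simp: Q_def)
    moreover have "K \<inter> fixpts (gen (T n)) = {}" unfolding K_def using der_closure_mv[OF pT(1)] td(1) by blast
    ultimately obtain g where g: "g \<in> gen (T n)" "\<And>k x. k \<noteq> 0 \<Longrightarrow> x \<in> K \<Longrightarrow> ipow g k x \<notin> K"
      using clear_compact[OF pT(1)] by metis
    have "Y (Suc n) \<subseteq> K"
    proof
      fix x assume "x \<in> Y (Suc n)"
      then have "\<exists>t\<in>T (Suc n). t x \<noteq> x"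
        unfolding Y_def using td(2) plgroupD(5)[OF assms(1)] by (subst (asm) fixpts_gen) auto
      then obtain t where "t \<in> T (Suc n)" "x \<in> mv t" unfolding mv_def by blast
      then show "x \<in> K" unfolding K_def using closure_subset[of "mv t"] by blast
    qed
    then have "\<forall>k x. k \<noteq> 0 \<longrightarrow> x \<in> Y (Suc n) \<longrightarrow> ipow g k x \<notin> Y (Suc n)" using g(2) by blast
    then show "\<exists>g. g \<in> gen (T n) \<and> (\<forall>k x. k \<noteq> 0 \<longrightarrow> x \<in> Y (Suc n) \<longrightarrow> ipow g k x \<notin> Y (Suc n))"
      using g(1) by blast
  qed
  from choice[OF this] obtain g where "\<forall>n. g n \<in> gen (T n) \<and>
      (\<forall>k x. k \<noteq> 0 \<longrightarrow> x \<in> Y (Suc n) \<longrightarrow> ipow (g n) k x \<notin> Y (Suc n))" by blast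
  then have g: "\<And>n. g n \<in> gen (T n)"
    "\<And>n k x. k \<noteq> 0 \<Longrightarrow> x \<in> Y (Suc n) \<Longrightarrow> ipow (g n) k x \<notin> Y (Suc n)" by blast+
  have "descending H g Y"
    unfolding descending_def
  proof (intro allI conjI impI)
    fix n
    show "g n \<in> H" using g(1) pT(2) by blast
    show "Y (Suc n) \<subseteq> Y n"
      unfolding Y_def using fixpts_mono[OF TT] fixpts_mono[OF der_subset[OF plgroupD(1)[OF pT(1)]]] by blast
    show "mv (g n) \<subseteq> Y n" unfolding Y_def mv_def fixpts_def using g(1)[of n] by auto
    show "Y n \<noteq> {}"
    proof
      assume "Y n = {}"
      then have "\<And>f x. f \<in> gen (T n) \<Longrightarrow> f x = id x" unfolding Y_def fixpts_def by auto
      then have "gen (T n) \<subseteq> {id}" by blast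
      then have "dseries (gen (T n)) 0 \<subseteq> {id}" unfolding funpow_0 .
      then show False using T(1)[of n] unfolding Q_def by blast
    qed
    show "ipow (g n) k x \<notin> Y (Suc n)" if "k \<noteq> 0" "x \<in> Y (Suc n)" for k x using g(2) that by blast
  qed
  then show ?thesis by blast
qed

lemma ascending_mono: assumes "ascending L g Y" "L \<subseteq> H" shows "ascending H g Y"
proof -
  have "g n \<in> H" for n using assms unfolding ascending_def by blast
  then show ?thesis using assms(1) unfolding ascending_def by simp
qed

text \<open>The alternative is put to all finitely generated non-solvable subgroups of
  \<open>H\<close>: \<open>dichotomy\<close> applies as soon as one of them has a derived group with
  only solvable finitely generated subgroups; otherwise the descent never stops.\<close>

lemma ascending_or_descending:
  assumes "plgroup H" "H = gen S" "finite S" "\<not> fsolvable H"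
  shows "\<exists>g Y. ascending H g Y \<or> descending H g Y"
proof (cases "\<exists>T. finite T \<and> T \<subseteq> H \<and> \<not> fsolvable (gen T) \<and>
    \<not> (\<exists>T'. finite T' \<and> T' \<subseteq> der (gen T) \<and> \<not> fsolvable (gen T'))")
  case True
  then obtain T where T: "finite T" "T \<subseteq> H" "\<not> fsolvable (gen T)"
    and no: "\<not> (\<exists>T'. finite T' \<and> T' \<subseteq> der (gen T) \<and> \<not> fsolvable (gen T'))" by (elim exE conjE)
  have pT: "plgroup (gen T)" "gen T \<subseteq> H" using plgroup_gen[OF assms(1) T(2)] by auto
  have solv: "fsolvable (gen T')" if "finite T'" "T' \<subseteq> der (gen T)" for T'
    by (rule ccontr) (use no that in metis)
  obtain L where L: "plgroup L" "L \<subseteq> gen T" "\<not> L \<subseteq> {id}" "\<And>g. g \<in> L \<Longrightarrow> closure (mv g) \<inter> fixpts L = {}"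
    using dichotomy[OF pT(1) refl T(1,3) solv] by metis
  have "\<exists>g Y. ascending L g Y" by (rule ascending_exists[OF L(1,3,4)])
  then obtain g Y where "ascending L g Y" by (elim exE)
  then have "ascending H g Y" by (rule ascending_mono[OF _ subset_trans[OF L(2) pT(2)]])
  then show ?thesis by blast
next
  case False
  have no: "\<exists>T'. finite T' \<and> T' \<subseteq> der (gen T) \<and> \<not> fsolvable (gen T')"
    if "finite T" "T \<subseteq> H" "\<not> fsolvable (gen T)" for T
    by (rule ccontr) (use False that in metis)
  have "\<exists>g Y. descending H g Y" by (rule descending_exists[OF assms no])
  then show ?thesis by blast
qed

subsection \<open>Embedding the permutation wreath power\<close>

locale wandering_descent =
  fixes h :: "nat \<Rightarrow> 'a \<Rightarrow> 'a" and Y :: "nat \<Rightarrow> 'a set"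
  assumes bij_h: "bij (h n)" and Y_Suc: "Y (Suc n) \<subseteq> Y n" and Y_ne: "Y n \<noteq> {}"
    and fix_out: "x \<notin> Y n \<Longrightarrow> h n x = x"
    and wander: "k \<noteq> 0 \<Longrightarrow> x \<in> Y (Suc n) \<Longrightarrow> ipow (h n) k x \<notin> Y (Suc n)"
begin

lemma Y_mono: "m \<le> n \<Longrightarrow> Y n \<subseteq> Y m"
  by (induct n rule: dec_induct) (use Y_Suc in auto)

lemma Y_pow: "x \<in> Y n \<Longrightarrow> ipow (h n) k x \<in> Y n"
proof (rule ccontr)
  assume x: "x \<in> Y n" and y: "ipow (h n) k x \<notin> Y n"
  have "ipow (h n) (- k) (ipow (h n) k x) = ipow (h n) k x"
    by (rule ipow_fix[OF bij_h fix_out[OF y]])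
  then show False using x y bij_h by simp
qed

text \<open>\<open>word k s\<close> carries \<open>Y k\<close> to the copy of it indexed by the point \<open>s\<close> of \<open>X\<^sub>k\<close>.\<close>

primrec word :: "nat \<Rightarrow> (nat \<Rightarrow> int) \<Rightarrow> 'a \<Rightarrow> 'a" where
  "word 0 s = id"
| "word (Suc k) s = word k s \<circ> ipow (h k) (s k)"

lemma bij_word: "bij (word k s)"
proof (induct k)
  case 0
  show ?case unfolding word.simps by (rule bij_id)
next
  case (Suc k)
  show ?case unfolding word.simps by (rule bij_comp[OF bij_ipow[OF bij_h] Suc])
qed

lemma word_inj: "word k s x = word k s y \<Longrightarrow> x = y"
  using bij_is_inj[OF bij_word] by (rule injD)

lemma word_cong: "(\<And>j. j < k \<Longrightarrow> s j = s' j) \<Longrightarrow> word k s = word k s'"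
  by (induct k) auto

lemma word_zero: "(\<And>j. j < k \<Longrightarrow> s j = 0) \<Longrightarrow> word k s = id"
  by (induct k) auto

text \<open>Powers of \<open>h k\<close> preserve \<open>Y k\<close>, so the earlier coordinates
  agree by induction and the common word cancels. Wandering of \<open>Y (Suc k)\<close> under
  \<open>h k\<close> then forces equality of the last coordinate.\<close>

lemma word_disjoint:
  "x \<in> Y k \<Longrightarrow> x' \<in> Y k \<Longrightarrow> word k s x = word k s' x' \<Longrightarrow> j < k \<Longrightarrow> s j = s' j"
proof (induct k arbitrary: x x' j)
  case (Suc k)
  have k: "x \<in> Y k" "x' \<in> Y k" using Suc.prems Y_Suc by auto
  have agree: "s i = s' i" if "i < k" for i
    using Suc.hyps[OF Y_pow[OF k(1)] Y_pow[OF k(2)] _ that] Suc.prems(3) by simp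
  then have "word k s = word k s'" by (rule word_cong)
  then have e: "ipow (h k) (s k) x = ipow (h k) (s' k) x'" using Suc.prems(3) by - (rule word_inj[of k s], simp)
  have "ipow (h k) (s k - s' k) x = ipow (h k) (- s' k) (ipow (h k) (s k) x)"
    using ipow_add[OF bij_h, of k "- s' k" "s k" x] by simp
  then have "ipow (h k) (s k - s' k) x = x'" using e bij_h by simp
  then have "s k - s' k = 0" using wander[of "s k - s' k" x k] Suc.prems(1,2) by metis
  then show ?case using agree Suc.prems(4) by (cases "j = k") auto
qed simp

lemma word_in_Y: "x \<in> Y k \<Longrightarrow> word k s x \<in> Y k \<Longrightarrow> j < k \<Longrightarrow> s j = 0"
  using word_disjoint[of x k "word k s x" s "\<lambda>_. 0" j] by (simp add: word_zero)

text \<open>These are the points whose address stops at level \<open>j\<close>, because they lie in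
  no translate of \<open>Y (Suc j)\<close>.\<close>

definition Z :: "nat \<Rightarrow> 'a set" where
  "Z j = {z \<in> Y j. \<forall>n. ipow (h j) n z \<notin> Y (Suc j)}"

text \<open>Refine one level at a time: a point of a copy of \<open>Y k\<close> either stops there,
  or a power of \<open>h k\<close> brings it into \<open>Y (Suc k)\<close> and the opposite exponent
  is recorded as its next coordinate.\<close>

lemma coverage:
  "x \<notin> Y 0 \<or> (\<exists>j<k. \<exists>s. \<exists>z\<in>Z j. x = word (Suc j) s z) \<or> (\<exists>s. \<exists>z\<in>Y k. x = word k s z)"
proof (induct k)
  case 0
  show ?case by auto
next
  case (Suc k)
  have "(\<exists>s. \<exists>z\<in>Z k. x = word (Suc k) s z) \<or> (\<exists>s. \<exists>z\<in>Y (Suc k). x = word (Suc k) s z)"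
    if "\<exists>s. \<exists>z\<in>Y k. x = word k s z"
  proof -
    from that obtain s z where z: "z \<in> Y k" "x = word k s z" by blast
    have upd: "word (Suc k) (s(k := m)) y = word k s (ipow (h k) m y)" for m y
      using word_cong[of k "s(k := m)" s] by simp
    show ?thesis
    proof (cases "z \<in> Z k")
      case True
      have "x = word (Suc k) (s(k := 0)) z" using z upd[of 0] by simp
      then show ?thesis using True by blast
    next
      case False
      then obtain n where n: "ipow (h k) n z \<in> Y (Suc k)" using z by (auto simp: Z_def)
      have "x = word (Suc k) (s(k := - n)) (ipow (h k) n z)"
        using z upd[of "- n" "ipow (h k) n z"] ipow_inverse(1)[OF bij_h, of k n z] by metis
      then show ?thesis using n by blast
    qed
  qed
  then show ?case using Suc less_SucI[of _ k] lessI[of k] by blast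
qed

text \<open>\<open>w\<close> moves addressed points merely by changing their addresses through
  \<open>\<sigma>\<close>. Both the addresses that stop before level \<open>k\<close> and those that
  reach it are included, so that \<open>coverage\<close> accounts for all of
  \<open>w\<close>.\<close>

definition matches :: "nat \<Rightarrow> ('a \<Rightarrow> 'a) \<Rightarrow> ((nat \<Rightarrow> int) \<Rightarrow> nat \<Rightarrow> int) \<Rightarrow> bool" where
  "matches k w \<sigma> \<longleftrightarrow> bij w \<and> bij \<sigma> \<and> (\<forall>x. x \<notin> Y 0 \<longrightarrow> w x = x)
    \<and> (\<forall>j s x. j < k \<longrightarrow> x \<in> Z j \<longrightarrow> w (word (Suc j) s x) = word (Suc j) (\<sigma> s) x)
    \<and> (\<forall>s x. x \<in> Y k \<longrightarrow> w (word k s x) = word k (\<sigma> s) x)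
    \<and> (\<forall>s j. k \<le> j \<longrightarrow> \<sigma> s j = s j)"

lemma matches_id: "matches k id id"
  by (simp add: matches_def)

lemma matches_comp: "matches k w \<sigma> \<Longrightarrow> matches k w' \<sigma>' \<Longrightarrow> matches k (w \<circ> w') (\<sigma> \<circ> \<sigma>')"
  unfolding matches_def by (simp add: bij_comp)

lemma matches_iv: assumes "matches k w \<sigma>" shows "matches k (iv w) (iv \<sigma>)"
proof -
  have b: "bij w" "bij \<sigma>" using assms by (auto simp: matches_def)
  have s: "\<sigma> (iv \<sigma> t) = t" for t using b(2) by (simp add: bij_iv_simps(1)[of \<sigma>])
  show ?thesis
    unfolding matches_def
  proof (intro conjI allI impI)
    show "bij (iv w)" "bij (iv \<sigma>)" using b by (simp_all add: bij_imp_bij_inv)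
    show "iv w x = x" if "x \<notin> Y 0" for x
      using assms that b(1) by (simp add: iv_eq_iff matches_def)
    show "iv w (word (Suc j) t x) = word (Suc j) (iv \<sigma> t) x" if "j < k" "x \<in> Z j" for j t x
    proof -
      have "w (word (Suc j) (iv \<sigma> t) x) = word (Suc j) (\<sigma> (iv \<sigma> t)) x" using assms that unfolding matches_def by blast
      then show ?thesis using b(1) unfolding s by (simp only: iv_eq_iff)
    qed
    show "iv w (word k t x) = word k (iv \<sigma> t) x" if "x \<in> Y k" for t x
    proof -
      have "w (word k (iv \<sigma> t) x) = word k (\<sigma> (iv \<sigma> t)) x" using assms that unfolding matches_def by blast
      then show ?thesis using b(1) unfolding s by (simp only: iv_eq_iff)
    qed
    show "iv \<sigma> t j = t j" if "k \<le> j" for t j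
    proof -
      have "\<sigma> (iv \<sigma> t) j = iv \<sigma> t j" using assms that unfolding matches_def by blast
      then show ?thesis unfolding s by simp
    qed
  qed
qed

text \<open>Copies of the nonempty set \<open>Y k\<close> with different addresses are disjoint, so
  \<open>w\<close> determines \<open>\<sigma>\<close>; conversely \<open>coverage\<close> recovers
  \<open>w\<close> from \<open>\<sigma>\<close>.\<close>

lemma matches_id_iff: assumes "matches k w \<sigma>" shows "w = id \<longleftrightarrow> \<sigma> = id"
proof
  assume w: "w = id"
  obtain x where x: "x \<in> Y k" using Y_ne by blast
  have "\<sigma> s j = s j" for s j
  proof (cases "j < k")
    case True
    have "w (word k s x) = word k (\<sigma> s) x" using assms x unfolding matches_def by blast
    then have "word k s x = word k (\<sigma> s) x" unfolding w by simp
    from word_disjoint[OF x x this True] show ?thesis by simp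
  next
    case False
    then show ?thesis using assms unfolding matches_def by simp
  qed
  then show "\<sigma> = id" by (simp add: fun_eq_iff)
next
  assume \<sigma>: "\<sigma> = id"
  have m: "x \<notin> Y 0 \<Longrightarrow> w x = x" "j < k \<Longrightarrow> z \<in> Z j \<Longrightarrow> w (word (Suc j) s z) = word (Suc j) (\<sigma> s) z"
    "z \<in> Y k \<Longrightarrow> w (word k s z) = word k (\<sigma> s) z" for x j s z
    using assms unfolding matches_def by blast+
  have "w x = x" for x
    using coverage[of x k]
  proof (elim disjE exE conjE bexE)
    show "w x = x" if "x \<notin> Y 0" using m(1) that .
    show "w x = x" if "j < k" "z \<in> Z j" "x = word (Suc j) s z" for j s z
      using m(2)[OF that(1,2), of s] that(3) \<sigma> by simp
    show "w x = x" if "z \<in> Y k" "x = word k s z" for s z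
      using m(3)[OF that(1), of s] that(2) \<sigma> by simp
  qed
  then show "w = id" by (simp add: fun_eq_iff)
qed

text \<open>All large levels are demanded: \<open>h i\<close> satisfies the condition from level
  \<open>i + 1\<close> on, and composing two elements needs a common level.\<close>

definition corr :: "('a \<Rightarrow> 'a) \<Rightarrow> ((nat \<Rightarrow> int) \<Rightarrow> nat \<Rightarrow> int) \<Rightarrow> bool" where
  "corr w \<sigma> \<longleftrightarrow> (\<exists>k0. \<forall>k\<ge>k0. matches k w \<sigma>)"

lemma corr_comp: assumes "corr w \<sigma>" "corr w' \<sigma>'" shows "corr (w \<circ> w') (\<sigma> \<circ> \<sigma>')"
proof -
  obtain a b where "\<forall>k\<ge>a. matches k w \<sigma>" "\<forall>k\<ge>b. matches k w' \<sigma>'" using assms unfolding corr_def by blast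
  then have "\<forall>k\<ge>max a b. matches k (w \<circ> w') (\<sigma> \<circ> \<sigma>')" using matches_comp by simp
  then show ?thesis unfolding corr_def by blast
qed

lemma corr_iv: "corr w \<sigma> \<Longrightarrow> corr (iv w) (iv \<sigma>)"
  unfolding corr_def using matches_iv by blast

lemma corr_id: "corr id id"
  unfolding corr_def using matches_id by blast

lemma corr_bij: "corr w \<sigma> \<Longrightarrow> bij w \<and> bij \<sigma>"
  unfolding corr_def matches_def by blast

text \<open>Hence \<open>corr\<close> is the graph of an isomorphism between the groups generated by
  the \<open>h i\<close> and the \<open>p i\<close>.\<close>

lemma corr_eq_iff: assumes "corr w \<sigma>" "corr w' \<sigma>'" shows "w = w' \<longleftrightarrow> \<sigma> = \<sigma>'"
proof -
  have b: "bij w" "bij \<sigma>" using corr_bij[OF assms(1)] by auto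
  have *: "iv f \<circ> f' = id \<longleftrightarrow> f = f'" if "bij f" for f f' :: "'b \<Rightarrow> 'b"
    using that by (auto simp: fun_eq_iff iv_eq_iff)
  obtain k where "matches k (iv w \<circ> w') (iv \<sigma> \<circ> \<sigma>')"
    using corr_comp[OF corr_iv[OF assms(1)] assms(2)] unfolding corr_def by blast
  from matches_id_iff[OF this] show ?thesis unfolding *[OF b(1)] *[OF b(2)] .
qed

text \<open>The partner of \<open>h i\<close>, whose support lies in \<open>Y i\<close>, the copy
  with all earlier coordinates 0.\<close>

definition p :: "nat \<Rightarrow> (nat \<Rightarrow> int) \<Rightarrow> nat \<Rightarrow> int" where
  "p i = pbase i 1 (\<lambda>_. 0)"

lemma pbase_inverse: "pbase k (- c) y (pbase k c y s) = s"
  by (auto simp: pbase_def fun_eq_iff)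

lemma bij_pbase: "bij (pbase k c y)"
  by (rule bij_betw_byWitness[where f' = "pbase k (- c) y"])
    (use pbase_inverse[of k c y] pbase_inverse[of k "- c" y] in auto)

text \<open>The coordinates beyond \<open>i\<close> only select a point \<open>y\<close> of
  \<open>Y i\<close>. Asking for \<open>Y (m - 1)\<close> and not for \<open>Y m\<close> lets the
  lemma serve both kinds of addresses in \<open>matches\<close>.\<close>

lemma word_split:
  assumes "i < m" "x \<in> Y (m - 1)"
  shows "\<exists>y\<in>Y i. \<forall>t. (\<forall>j. i < j \<longrightarrow> j < m \<longrightarrow> t j = s j) \<longrightarrow> word m t x = word i t (ipow (h i) (t i) y)"
proof -
  have "x \<in> Y (m - 1) \<Longrightarrow> ?thesis"
    using assms(1)[THEN Suc_leI]
  proof (induct m arbitrary: x rule: dec_induct)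
    case base
    then show ?case by (intro bexI[of _ x]) auto
  next
    case (step m)
    have "x \<in> Y m" using step.prems by simp
    then have "ipow (h m) (s m) x \<in> Y (m - 1)" using Y_pow Y_mono[of "m - 1" m] by auto
    from step.hyps(3)[OF this] obtain y where y: "y \<in> Y i"
      "\<forall>t. (\<forall>j. i < j \<longrightarrow> j < m \<longrightarrow> t j = s j) \<longrightarrow> word m t (ipow (h m) (s m) x) = word i t (ipow (h i) (t i) y)"
      by blast
    show ?case
    proof (rule bexI[OF _ y(1)], intro allI impI)
      fix t assume t: "\<forall>j. i < j \<longrightarrow> j < Suc m \<longrightarrow> t j = s j"
      then have "t m = s m" using step.hyps(1) by simp
      then show "word (Suc m) t x = word i t (ipow (h i) (t i) y)" using y(2) t by simp
    qed
  qed
  then show ?thesis using assms(2) .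
qed

text \<open>If the coordinates before \<open>i\<close> vanish, the outer word is the identity and
  \<open>h i\<close> raises the next exponent by 1. Otherwise the point lies outside
  \<open>Y i\<close>, where \<open>h i\<close> is trivial, and \<open>p i\<close> leaves the address
  unchanged.\<close>

lemma generator_on_word:
  assumes "i < m" "x \<in> Y (m - 1)"
  shows "h i (word m s x) = word m (p i s) x"
proof -
  obtain y where y: "y \<in> Y i"
    "\<And>t. (\<forall>j. i < j \<longrightarrow> j < m \<longrightarrow> t j = s j) \<Longrightarrow> word m t x = word i t (ipow (h i) (t i) y)"
    using word_split[OF assms, of s] by blast
  show ?thesis
  proof (cases "\<forall>j<i. s j = 0")
    case True
    then have ps: "p i s = s(i := s i + 1)" by (simp add: p_def pbase_def)
    have "word i (p i s) = id" "word i s = id" using True by (auto simp: ps intro!: word_zero)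
    then show ?thesis
      using y(2)[of s] y(2)[of "p i s"] ipow_Suc[OF bij_h, of i "s i" y] by (simp add: ps)
  next
    case False
    then have "p i s = s" unfolding p_def pbase_def by (simp only: if_False)
    moreover have "word i s (ipow (h i) (s i) y) \<notin> Y i" using word_in_Y[OF Y_pow[OF y(1)]] False by blast
    ultimately show ?thesis using y(2)[of s] fix_out by simp
  qed
qed

lemma corr_generator: "corr (h i) (p i)"
proof -
  have "matches k (h i) (p i)" if k: "Suc i \<le> k" for k
    unfolding matches_def
  proof (intro conjI allI impI)
    show "bij (h i)" "bij (p i)" using bij_h bij_pbase by (auto simp: p_def)
    show "h i x = x" if "x \<notin> Y 0" for x using fix_out Y_mono[of 0 i] that by blast
    show "h i (word k s x) = word k (p i s) x" if "x \<in> Y k" for s x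
      using generator_on_word[of i k x s] k Y_mono[of "k - 1" k] that by auto
    show "p i s j = s j" if "k \<le> j" for s j using that k by (simp add: p_def pbase_def)
    show "h i (word (Suc j) s x) = word (Suc j) (p i s) x" if "j < k" "x \<in> Z j" for j s x
    proof (cases "i \<le> j")
      case True
      then show ?thesis using generator_on_word[of i "Suc j" x s] that(2) by (auto simp: Z_def)
    next
      case False
      have xj: "x \<in> Y j" using that(2) by (simp add: Z_def)
      \<comment> \<open>The address stops before level \<open>i\<close>, so the point is outside
        \<open>Y (Suc j)\<close> and therefore outside \<open>Y i\<close>.\<close>
      have "word (Suc j) s x \<notin> Y (Suc j)"
      proof
        assume a: "word (Suc j) s x \<in> Y (Suc j)"
        then have "word j s (ipow (h j) (s j) x) \<in> Y j" using Y_Suc by auto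
        then have "word j s = id" using word_in_Y[OF Y_pow[OF xj]] by (intro word_zero) blast
        then show False using a that(2) by (simp add: Z_def)
      qed
      then have "h i (word (Suc j) s x) = word (Suc j) s x" using fix_out Y_mono[of "Suc j" i] False by auto
      moreover have "word (Suc j) (p i s) = word (Suc j) s"
        using False by (intro word_cong) (simp add: p_def pbase_def)
      ultimately show ?thesis by simp
    qed
  qed
  then show ?thesis unfolding corr_def by blast
qed

lemma corr_total: "w \<in> gen (range h) \<Longrightarrow> \<exists>\<sigma>\<in>gen (range p). corr w \<sigma>"
proof -
  have "gen (range h) \<subseteq> {w. \<exists>\<sigma>\<in>gen (range p). corr w \<sigma>}"
  proof (rule gen_subsetI)
    show "id \<in> {w. \<exists>\<sigma>\<in>gen (range p). corr w \<sigma>}" using corr_id gen.one by blast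
    show "range h \<subseteq> {w. \<exists>\<sigma>\<in>gen (range p). corr w \<sigma>}" using corr_generator gen.incl[of _ "range p"] by blast
    show "iv w \<in> {w. \<exists>\<sigma>\<in>gen (range p). corr w \<sigma>}" if "w \<in> {w. \<exists>\<sigma>\<in>gen (range p). corr w \<sigma>}" for w
      using that corr_iv gen.inverse by blast
    show "w \<circ> w' \<in> {w. \<exists>\<sigma>\<in>gen (range p). corr w \<sigma>}"
      if "w \<in> {w. \<exists>\<sigma>\<in>gen (range p). corr w \<sigma>}" "w' \<in> {w. \<exists>\<sigma>\<in>gen (range p). corr w \<sigma>}" for w w'
      using that corr_comp gen.comp by blast
  qed
  then show "w \<in> gen (range h) \<Longrightarrow> \<exists>\<sigma>\<in>gen (range p). corr w \<sigma>" by blast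
qed

lemma corr_onto: "\<sigma> \<in> gen (range p) \<Longrightarrow> \<exists>w\<in>gen (range h). corr w \<sigma>"
proof -
  have "gen (range p) \<subseteq> {\<sigma>. \<exists>w\<in>gen (range h). corr w \<sigma>}"
  proof (rule gen_subsetI)
    show "id \<in> {\<sigma>. \<exists>w\<in>gen (range h). corr w \<sigma>}" using corr_id gen.one by blast
    show "range p \<subseteq> {\<sigma>. \<exists>w\<in>gen (range h). corr w \<sigma>}" using corr_generator gen.incl[of _ "range h"] by blast
    show "iv \<sigma> \<in> {\<sigma>. \<exists>w\<in>gen (range h). corr w \<sigma>}" if "\<sigma> \<in> {\<sigma>. \<exists>w\<in>gen (range h). corr w \<sigma>}" for \<sigma>
      using that corr_iv gen.inverse by blast
    show "\<sigma> \<circ> \<sigma>' \<in> {\<sigma>. \<exists>w\<in>gen (range h). corr w \<sigma>}"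
      if "\<sigma> \<in> {\<sigma>. \<exists>w\<in>gen (range h). corr w \<sigma>}" "\<sigma>' \<in> {\<sigma>. \<exists>w\<in>gen (range h). corr w \<sigma>}" for \<sigma> \<sigma>'
      using that corr_comp gen.comp by blast
  qed
  then show "\<sigma> \<in> gen (range p) \<Longrightarrow> \<exists>w\<in>gen (range h). corr w \<sigma>" by blast
qed

section \<open>The permutations \<open>p i\<close> generate all base-group generators\<close>

lemma pbase_add: "pbase k (c + d) y = pbase k c y \<circ> pbase k d y"
  by (auto simp: pbase_def fun_eq_iff)

lemma fgroup_p: "fgroup (gen (range p))"
  by (rule fgroup_gen) (auto simp: p_def bij_pbase)

lemma pbase_zero_gen: "pbase k c (\<lambda>_. 0) \<in> gen (range p)"
proof -
  have "ipow (p k) c = pbase k c (\<lambda>_. 0)"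
  proof (induct c rule: int_induct[where k = 0])
    case base
    show ?case by (auto simp: pbase_def fun_eq_iff)
  next
    case (step1 i)
    show ?case
    proof
      fix s
      have "ipow (p k) (i + 1) s = p k (ipow (p k) i s)" unfolding p_def by (rule ipow_Suc[OF bij_pbase])
      also have "\<dots> = p k (pbase k i (\<lambda>_. 0) s)" unfolding step1(2) ..
      also have "\<dots> = pbase k (1 + i) (\<lambda>_. 0) s" unfolding pbase_add p_def by simp
      finally show "ipow (p k) (i + 1) s = pbase k (i + 1) (\<lambda>_. 0) s" by (simp add: add.commute)
    qed
  next
    case (step2 i)
    show ?case
    proof
      fix s
      have "p k (ipow (p k) (i - 1) s) = ipow (p k) i s"
        using ipow_Suc[OF bij_pbase, of k 1 "\<lambda>_. 0" "i - 1" s, folded p_def] by simp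
      also have "\<dots> = pbase k (1 + (i - 1)) (\<lambda>_. 0) s" unfolding step2(2) by simp
      also have "\<dots> = p k (pbase k (i - 1) (\<lambda>_. 0) s)" unfolding pbase_add p_def by simp
      finally show "ipow (p k) (i - 1) s = pbase k (i - 1) (\<lambda>_. 0) s"
        using bij_pbase[of k 1 "\<lambda>_. 0"] unfolding p_def by (metis bij_iv_simps(2))
    qed
  qed
  moreover have "ipow (p k) c \<in> gen (range p)" by (rule ipow_in[OF fgroup_p]) (rule gen.incl, simp)
  ultimately show ?thesis by simp
qed

definition transports :: "nat \<Rightarrow> (nat \<Rightarrow> int) \<Rightarrow> ((nat \<Rightarrow> int) \<Rightarrow> nat \<Rightarrow> int) \<Rightarrow> bool" where
  "transports k y q \<longleftrightarrow> (\<forall>s j. k \<le> j \<longrightarrow> q s j = s j)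
    \<and> (\<forall>s j. (\<forall>i<k. s i = 0) \<longrightarrow> j < k \<longrightarrow> q s j = y j)
    \<and> (\<forall>s t j. (\<forall>i<k. s i = t i) \<longrightarrow> j < k \<longrightarrow> q s j = q t j)"

lemma transportsD:
  assumes "transports k y q"
  shows "k \<le> j \<Longrightarrow> q s j = s j" "\<forall>i<k. s i = 0 \<Longrightarrow> j < k \<Longrightarrow> q s j = y j"
    "\<forall>i<k. s i = t i \<Longrightarrow> j < k \<Longrightarrow> q s j = q t j"
  using assms unfolding transports_def by blast+

text \<open>Set coordinate \<open>k\<close> while the earlier ones are still 0, where the base
  generator at the zero point applies; then move the earlier ones by induction.\<close>

lemma transitive: "\<exists>q\<in>gen (range p). transports k y q"
proof (induct k)
  case 0
  show ?case by (rule bexI[of _ id]) (auto intro: gen.one simp: transports_def)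
next
  case (Suc k)
  then obtain q where q0: "q \<in> gen (range p)" and q': "transports k y q" by blast
  note q = q0 transportsD[OF q']
  let ?b = "pbase k (y k) (\<lambda>_. 0)"
  have bj: "?b s j = s j" if "j \<noteq> k" for s j using that by (simp add: pbase_def)
  show ?case
    unfolding transports_def
  proof (rule bexI[of _ "q \<circ> ?b"], intro conjI allI impI)
    show "q \<circ> ?b \<in> gen (range p)" using gen.comp[OF q(1) pbase_zero_gen] .
    show "(q \<circ> ?b) s j = s j" if "Suc k \<le> j" for s j using that q(2)[of j] bj by simp
    show "(q \<circ> ?b) s j = y j" if "\<forall>j<Suc k. s j = 0" "j < Suc k" for s j
    proof (cases "j = k")
      case True
      then show ?thesis using q(2)[of k "?b s"] that(1) by (simp add: pbase_def)
    next
      case False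
      then show ?thesis using q(3)[of "?b s" j] that bj by simp
    qed
    show "(q \<circ> ?b) s j = (q \<circ> ?b) t j" if "\<forall>j<Suc k. s j = t j" "j < Suc k" for s t j
    proof (cases "j = k")
      case True
      have "(\<forall>j<k. s j = 0) = (\<forall>j<k. t j = 0)" "s k = t k" using that(1) by simp_all
      moreover have "?b u k = (if \<forall>j<k. u j = 0 then u k + y k else u k)" for u by (auto simp: pbase_def)
      ultimately have "?b s k = ?b t k" by (simp only:)
      then show ?thesis using q(2)[of k "?b s"] q(2)[of k "?b t"] True by simp
    next
      case False
      then show ?thesis using q(4)[of "?b s" "?b t" j] that bj by simp
    qed
  qed
qed

text \<open>Conjugating the base generator at the zero point by an element that transports zero to
  \<open>y\<close> gives the one at \<open>y\<close>.\<close>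

lemma pbase_gen: "pbase k c y \<in> gen (range p)"
proof -
  obtain q where q0: "q \<in> gen (range p)" and q': "transports k y q" using transitive by blast
  note q = q0 transportsD[OF q']
  have b: "bij q" using fgroupD(2)[OF fgroup_p q(1)] .
  let ?b = "pbase k c (\<lambda>_. 0)"
  have "q (?b t) = pbase k c y (q t)" for t
  proof (cases "\<forall>j<k. t j = 0")
    case True
    have "q (?b t) j = pbase k c y (q t) j" for j
      using q(3)[OF True] q(2)[of j t] q(2)[of j "?b t"] q(4)[of "?b t" t j] True
      by (cases "j < k") (auto simp: pbase_def)
    then show ?thesis by (rule ext)
  next
    case False
    have "\<not> (\<forall>j<k. q t j = y j)"
    proof
      assume a: "\<forall>j<k. q t j = y j"
      \<comment> \<open>Clearing the first \<open>k\<close> coordinates of \<open>t\<close> does not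
        change its image under \<open>q\<close>, so by injectivity they were 0 already.\<close>
      let ?t = "\<lambda>j. if j < k then 0 else t j"
      have "q t j = q ?t j" for j
        using a q(3)[of ?t j] q(2)[of j t] q(2)[of j ?t] by (cases "j < k") auto
      then have "q t = q ?t" by (rule ext)
      then have "t = ?t" using bij_is_inj[OF b] by (rule injD[rotated])
      then have "t j = 0" if "j < k" for j using fun_cong[of t ?t j] that by simp
      then show False using False by blast
    qed
    then show ?thesis using False by (auto simp: pbase_def)
  qed
  then have "q \<circ> ?b \<circ> iv q = pbase k c y" using b by (simp add: fun_eq_iff bij_iv_simps(1)[of q])
  moreover have "q \<circ> ?b \<circ> iv q \<in> gen (range p)"
    using fgroupD(4)[OF fgroup_p fgroupD(4)[OF fgroup_p q(1) pbase_zero_gen] fgroupD(3)[OF fgroup_p q(1)]] .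
  ultimately show ?thesis by simp
qed

end

subsection \<open>Embedding the restricted wreath power\<close>

lemma wup_in_step:
  assumes "\<And>i. f i \<in> carrier G" "finite {i. f i \<noteq> \<one>\<^bsub>G\<^esub>}"
  shows "wup l G (f, n) \<in> carrier (wr_step l G)"
  using assms unfolding wr_step_def by auto

lemma step_cases:
  assumes "x \<in> carrier (wr_step l G)"
  obtains f n where "x = wup l G (f, n)" "\<And>i. f i \<in> carrier G" "finite {i. f i \<noteq> \<one>\<^bsub>G\<^esub>}"
  using assms unfolding wr_step_def by auto

text \<open>It makes the tag \<open>Suc k\<close> fresh, so that a new pair cannot coincide with an
  element of \<open>G\<close> and \<open>wdn\<close> inverts \<open>wup\<close>.\<close>

definition low_tags :: "nat \<Rightarrow> wt monoid \<Rightarrow> bool" where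
  "low_tags k G \<longleftrightarrow> (\<forall>l f n. WN l f n \<in> carrier G \<longrightarrow> l \<le> k)"

lemma wdn_wup:
  assumes "\<And>i. f i \<in> carrier G" "low_tags k G"
  shows "wdn G (wup (Suc k) G (f, n)) = (f, n)"
proof (cases "n = 0 \<and> (\<forall>i. i \<noteq> 0 \<longrightarrow> f i = \<one>\<^bsub>G\<^esub>)")
  case True
  then have "(\<lambda>i. if i = 0 then f 0 else \<one>\<^bsub>G\<^esub>) = f" by auto
  then show ?thesis using True assms(1)[of 0] by (simp add: wup_def wdn_def)
next
  case False
  then have "wup (Suc k) G (f, n) = WN (Suc k) f n" by (auto simp: wup_def)
  moreover have "WN (Suc k) f n \<notin> carrier G" using assms(2) unfolding low_tags_def by fastforce
  ultimately show ?thesis by (simp add: wdn_def)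
qed

lemma carrier_subset_step:
  assumes "\<one>\<^bsub>G\<^esub> \<in> carrier G" "x \<in> carrier G"
  shows "x \<in> carrier (wr_step l G)"
proof -
  let ?f = "\<lambda>i::int. if i = 0 then x else \<one>\<^bsub>G\<^esub>"
  have "wup l G (?f, 0) \<in> carrier (wr_step l G)"
    by (rule wup_in_step) (use assms in \<open>auto intro: finite_subset[of _ "{0}"]\<close>)
  then show ?thesis by (simp add: wup_def)
qed

lemma low_tags_step: assumes "low_tags k G" shows "low_tags (Suc k) (wr_step (Suc k) G)"
  unfolding low_tags_def
proof (intro allI impI)
  fix l f n assume "WN l f n \<in> carrier (wr_step (Suc k) G)"
  then obtain f' n' where *: "WN l f n = wup (Suc k) G (f', n')" "\<And>i. f' i \<in> carrier G" by (rule step_cases) blast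
  show "l \<le> Suc k"
  proof (cases "n' = 0 \<and> (\<forall>i. i \<noteq> 0 \<longrightarrow> f' i = \<one>\<^bsub>G\<^esub>)")
    case True
    then have "WN l f n \<in> carrier G" using *(1) *(2)[of 0] by (simp add: wup_def)
    then show ?thesis using assms unfolding low_tags_def by (meson le_SucI)
  next
    case False
    then have "wup (Suc k) G (f', n') = WN (Suc k) f' n'" by (auto simp: wup_def)
    then show ?thesis using *(1) by simp
  qed
qed

text \<open>Composition is reversed because the products in \<open>PLgrp\<close> are read from left to right.\<close>

definition faithful :: "wt monoid \<Rightarrow> (wt \<Rightarrow> 'a \<Rightarrow> 'a) \<Rightarrow> 'a set \<Rightarrow> ('a \<Rightarrow> 'a) set \<Rightarrow> bool" where
  "faithful G \<phi> U H \<longleftrightarrow> \<one>\<^bsub>G\<^esub> \<in> carrier G \<and> \<phi> \<one>\<^bsub>G\<^esub> = id \<and> inj_on \<phi> (carrier G)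
    \<and> (\<forall>x\<in>carrier G. \<phi> x \<in> H \<and> (\<forall>p. p \<notin> U \<longrightarrow> \<phi> x p = p) \<and> (\<exists>y\<in>carrier G. x \<otimes>\<^bsub>G\<^esub> y = \<one>\<^bsub>G\<^esub>))
    \<and> (\<forall>x\<in>carrier G. \<forall>y\<in>carrier G. x \<otimes>\<^bsub>G\<^esub> y \<in> carrier G \<and> \<phi> (x \<otimes>\<^bsub>G\<^esub> y) = \<phi> y \<circ> \<phi> x)"

text \<open>One step upwards: the translates of \<open>U\<close> under powers of
  \<open>\<tau>\<close> are disjoint and carry independent copies of \<open>G\<close>, which
  \<open>\<tau>\<close> permutes.\<close>

locale wreath_action =
  fixes H :: "('a \<Rightarrow> 'a) set" and U :: "'a set" and \<tau> :: "'a \<Rightarrow> 'a" and G :: "wt monoid" and \<phi> :: "wt \<Rightarrow> 'a \<Rightarrow> 'a"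
  assumes H: "fgroup H" and \<tau>: "\<tau> \<in> H" and U_ne: "U \<noteq> {}"
    and wander: "k \<noteq> 0 \<Longrightarrow> x \<in> U \<Longrightarrow> ipow \<tau> k x \<notin> U"
    and F: "faithful G \<phi> U H"
begin

lemma bij_\<tau>: "bij \<tau>"
  using fgroupD(2)[OF H \<tau>] .

lemma G_one: "\<one>\<^bsub>G\<^esub> \<in> carrier G" "\<phi> \<one>\<^bsub>G\<^esub> = id"
  using F unfolding faithful_def by blast+

lemma G_mult: "x \<in> carrier G \<Longrightarrow> y \<in> carrier G \<Longrightarrow> x \<otimes>\<^bsub>G\<^esub> y \<in> carrier G"
  "x \<in> carrier G \<Longrightarrow> y \<in> carrier G \<Longrightarrow> \<phi> (x \<otimes>\<^bsub>G\<^esub> y) = \<phi> y \<circ> \<phi> x"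
  using F unfolding faithful_def by blast+

lemma \<phi>_H: "x \<in> carrier G \<Longrightarrow> \<phi> x \<in> H"
  using F unfolding faithful_def by blast

lemma \<phi>_out: "x \<in> carrier G \<Longrightarrow> p \<notin> U \<Longrightarrow> \<phi> x p = p"
  using F unfolding faithful_def by blast

lemma \<phi>_inj: "x \<in> carrier G \<Longrightarrow> y \<in> carrier G \<Longrightarrow> \<phi> x = \<phi> y \<Longrightarrow> x = y"
  using F unfolding faithful_def inj_on_def by blast

lemma \<phi>_in: "x \<in> carrier G \<Longrightarrow> \<phi> x p \<in> U \<longleftrightarrow> p \<in> U"
proof -
  assume x: "x \<in> carrier G"
  have "inj (\<phi> x)" using fgroupD(2)[OF H \<phi>_H[OF x]] by (rule bij_is_inj)
  then show ?thesis using \<phi>_out[OF x] by (metis injD)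
qed

text \<open>The unit laws are pulled back from composition along the injective
  \<open>\<phi>\<close>.\<close>

lemma G_unit: assumes "x \<in> carrier G" shows "\<one>\<^bsub>G\<^esub> \<otimes>\<^bsub>G\<^esub> x = x" "x \<otimes>\<^bsub>G\<^esub> \<one>\<^bsub>G\<^esub> = x"
proof -
  have "\<phi> (\<one>\<^bsub>G\<^esub> \<otimes>\<^bsub>G\<^esub> x) = \<phi> x" unfolding G_mult(2)[OF G_one(1) assms] G_one(2) by simp
  then show "\<one>\<^bsub>G\<^esub> \<otimes>\<^bsub>G\<^esub> x = x" by (rule \<phi>_inj[OF G_mult(1)[OF G_one(1) assms] assms])
  have "\<phi> (x \<otimes>\<^bsub>G\<^esub> \<one>\<^bsub>G\<^esub>) = \<phi> x" unfolding G_mult(2)[OF assms G_one(1)] G_one(2) by simp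
  then show "x \<otimes>\<^bsub>G\<^esub> \<one>\<^bsub>G\<^esub> = x" by (rule \<phi>_inj[OF G_mult(1)[OF assms G_one(1)] assms])
qed

lemma index_unique: "ipow \<tau> i p \<in> U \<Longrightarrow> ipow \<tau> j p \<in> U \<Longrightarrow> i = j"
proof -
  assume *: "ipow \<tau> i p \<in> U" "ipow \<tau> j p \<in> U"
  have "ipow \<tau> (i - j) (ipow \<tau> j p) = ipow \<tau> i p" using ipow_add[OF bij_\<tau>, of "i - j" j p] by simp
  then show "i = j" using wander[of "i - j" "ipow \<tau> j p"] * by auto
qed

text \<open>The action of the base group: coordinate \<open>i\<close> acts on the image of
  \<open>U\<close> under \<open>ipow \<tau> (- i)\<close>. This sign fits the shift
  \<open>i - m\<close> in \<open>wr_step\<close> with reversed composition.\<close>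

definition spread :: "(int \<Rightarrow> wt) \<Rightarrow> 'a \<Rightarrow> 'a" where
  "spread f p = (if \<exists>i. ipow \<tau> i p \<in> U
    then (let i = THE i. ipow \<tau> i p \<in> U in ipow \<tau> (- i) (\<phi> (f i) (ipow \<tau> i p))) else p)"

lemma spread_at: "ipow \<tau> i p \<in> U \<Longrightarrow> spread f p = ipow \<tau> (- i) (\<phi> (f i) (ipow \<tau> i p))"
proof -
  assume i: "ipow \<tau> i p \<in> U"
  then have "(THE i. ipow \<tau> i p \<in> U) = i" using index_unique by blast
  then show ?thesis using i unfolding spread_def Let_def by auto
qed

lemma spread_out: "(\<And>i. ipow \<tau> i p \<notin> U) \<Longrightarrow> spread f p = p"
  by (simp add: spread_def)

lemma spread_index:
  assumes "ipow \<tau> i p \<in> U" "f i \<in> carrier G" shows "ipow \<tau> i (spread f p) \<in> U"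
  using assms \<phi>_in bij_\<tau> by (simp add: spread_at)

lemma spread_mult:
  assumes "\<And>i. f i \<in> carrier G" "\<And>i. g i \<in> carrier G"
  shows "spread (\<lambda>i. f i \<otimes>\<^bsub>G\<^esub> g i) = spread g \<circ> spread f"
proof
  fix p
  show "spread (\<lambda>i. f i \<otimes>\<^bsub>G\<^esub> g i) p = (spread g \<circ> spread f) p"
  proof (cases "\<exists>i. ipow \<tau> i p \<in> U")
    case True
    then obtain i where i: "ipow \<tau> i p \<in> U" by blast
    have "spread g (spread f p) = ipow \<tau> (- i) (\<phi> (g i) (ipow \<tau> i (spread f p)))"
      using spread_at[OF spread_index[OF i assms(1)]] .
    also have "ipow \<tau> i (spread f p) = \<phi> (f i) (ipow \<tau> i p)" using bij_\<tau> by (simp add: spread_at[OF i])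
    finally show ?thesis using G_mult(2)[OF assms(1,2)] by (simp add: spread_at[OF i])
  next
    case False
    then show ?thesis by (simp add: spread_out)
  qed
qed

text \<open>A point of index \<open>i\<close> gets index \<open>i - m\<close> under
  \<open>ipow \<tau> m\<close>.\<close>

lemma spread_shift: "ipow \<tau> m (spread (\<lambda>i. g (i - m)) p) = spread g (ipow \<tau> m p)"
proof (cases "\<exists>i. ipow \<tau> i p \<in> U")
  case True
  then obtain i where i: "ipow \<tau> i p \<in> U" by blast
  have e: "ipow \<tau> (i - m) (ipow \<tau> m p) = ipow \<tau> i p" using ipow_add[OF bij_\<tau>, of "i - m" m p] by simp
  then have "spread g (ipow \<tau> m p) = ipow \<tau> (- (i - m)) (\<phi> (g (i - m)) (ipow \<tau> i p))"
    using spread_at[of "i - m" "ipow \<tau> m p" g] i by simp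
  also have "\<dots> = ipow \<tau> (m + (- i)) (\<phi> (g (i - m)) (ipow \<tau> i p))" by simp
  also have "\<dots> = ipow \<tau> m (ipow \<tau> (- i) (\<phi> (g (i - m)) (ipow \<tau> i p)))" by (rule ipow_add[OF bij_\<tau>])
  finally show ?thesis by (simp add: spread_at[OF i])
next
  case False
  have "ipow \<tau> i (ipow \<tau> m p) \<notin> U" for i using ipow_add[OF bij_\<tau>, of i m p] False by metis
  then show ?thesis using False by (simp add: spread_out)
qed

lemma spread_inj:
  assumes "\<And>i. f i \<in> carrier G" "\<And>i. g i \<in> carrier G" "spread f = spread g" shows "f = g"
proof
  fix i
  have "\<phi> (f i) y = \<phi> (g i) y" for y
  proof (cases "y \<in> U")
    case True
    let ?p = "ipow \<tau> (- i) y"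
    have p: "ipow \<tau> i ?p = y" using bij_\<tau> by simp
    have "ipow \<tau> i (spread f ?p) = ipow \<tau> i (spread g ?p)" using assms(3) by simp
    then show ?thesis using spread_at[of i ?p f] spread_at[of i ?p g] p True bij_\<tau> by simp
  next
    case False
    then show ?thesis using \<phi>_out assms(1,2) by metis
  qed
  then have "\<phi> (f i) = \<phi> (g i)" by (rule ext)
  then show "f i = g i" by (rule \<phi>_inj[OF assms(1,2)])
qed

lemma spread_delta:
  assumes "x \<in> carrier G"
  shows "spread (\<lambda>j. if j = i then x else \<one>\<^bsub>G\<^esub>) = ipow \<tau> (- i) \<circ> \<phi> x \<circ> ipow \<tau> i"
proof
  fix p
  let ?d = "\<lambda>j. if j = i then x else \<one>\<^bsub>G\<^esub>"
  show "spread ?d p = (ipow \<tau> (- i) \<circ> \<phi> x \<circ> ipow \<tau> i) p"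
  proof (cases "\<exists>j. ipow \<tau> j p \<in> U")
    case True
    then obtain j where j: "ipow \<tau> j p \<in> U" by blast
    show ?thesis
    proof (cases "j = i")
      case True
      then show ?thesis using spread_at[OF j, of ?d] by simp
    next
      case False
      then have "ipow \<tau> i p \<notin> U" using index_unique[OF j] by blast
      then show ?thesis using spread_at[OF j, of ?d] False \<phi>_out[OF assms] bij_\<tau> by (simp add: G_one)
    qed
  next
    case False
    then show ?thesis using \<phi>_out[OF assms] bij_\<tau> by (simp add: spread_out)
  qed
qed

lemma spread_one: "spread (\<lambda>_. \<one>\<^bsub>G\<^esub>) = id"
  using spread_delta[OF G_one(1), of 0] by (simp add: G_one(2) id_def o_def)

text \<open>A finitely supported function is a finite product of functions with one nontrivial
  value, each acting as a conjugate of some \<open>\<phi> x\<close> by a power of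
  \<open>\<tau>\<close>.\<close>

lemma spread_H:
  assumes "finite {i. f i \<noteq> \<one>\<^bsub>G\<^esub>}" "\<And>i. f i \<in> carrier G"
  shows "spread f \<in> H"
proof -
  have "\<forall>f. {i. f i \<noteq> \<one>\<^bsub>G\<^esub>} \<subseteq> A \<longrightarrow> (\<forall>i. f i \<in> carrier G) \<longrightarrow> spread f \<in> H" if "finite A" for A :: "int set"
    using that
  proof (induct A rule: finite_induct)
    case empty
    show ?case
    proof (intro allI impI)
      fix f :: "int \<Rightarrow> wt" assume "{i. f i \<noteq> \<one>\<^bsub>G\<^esub>} \<subseteq> {}"
      then have "f = (\<lambda>_. \<one>\<^bsub>G\<^esub>)" by auto
      then show "spread f \<in> H" using spread_one fgroupD(1)[OF H] by metis
    qed
  next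
    case (insert a A)
    show ?case
    proof (intro allI impI)
      fix f :: "int \<Rightarrow> wt" assume f: "{i. f i \<noteq> \<one>\<^bsub>G\<^esub>} \<subseteq> insert a A" "\<forall>i. f i \<in> carrier G"
      define f' where "f' = f(a := \<one>\<^bsub>G\<^esub>)"
      define d where "d = (\<lambda>j. if j = a then f a else \<one>\<^bsub>G\<^esub>)"
      have c: "f' i \<in> carrier G" "d i \<in> carrier G" for i using f(2) G_one(1) by (auto simp: f'_def d_def)
      have "(\<lambda>i. f' i \<otimes>\<^bsub>G\<^esub> d i) = f" using f(2) G_unit by (auto simp: f'_def d_def)
      then have e: "spread f = spread d \<circ> spread f'" using spread_mult[of f' d, OF c] by simp
      have "{i. f' i \<noteq> \<one>\<^bsub>G\<^esub>} \<subseteq> A" using f(1) by (auto simp: f'_def)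
      then have 1: "spread f' \<in> H" using insert.hyps(3) c(1) by blast
      have fa: "f a \<in> carrier G" using f(2) by blast
      have "spread d \<in> H" unfolding d_def spread_delta[OF fa]
        by (intro fgroupD(4)[OF H] ipow_in[OF H \<tau>] \<phi>_H[OF fa])
      then show "spread f \<in> H" unfolding e using fgroupD(4)[OF H _ 1] by blast
    qed
  qed
  then show ?thesis using assms by blast
qed

definition act :: "(int \<Rightarrow> wt) \<times> int \<Rightarrow> 'a \<Rightarrow> 'a" where
  "act q = ipow \<tau> (snd q) \<circ> spread (fst q)"

lemma act_mult:
  assumes "\<And>i. f i \<in> carrier G" "\<And>i. g i \<in> carrier G"
  shows "act (\<lambda>i. f i \<otimes>\<^bsub>G\<^esub> g (i - m), m + n) = act (g, n) \<circ> act (f, m)"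
proof
  fix p
  let ?q = "spread f p"
  have "act (\<lambda>i. f i \<otimes>\<^bsub>G\<^esub> g (i - m), m + n) p = ipow \<tau> (n + m) (spread (\<lambda>i. g (i - m)) ?q)"
    using spread_mult[of f "\<lambda>i. g (i - m)", OF assms] by (simp add: act_def add.commute)
  also have "\<dots> = ipow \<tau> n (spread g (ipow \<tau> m ?q))" unfolding ipow_add[OF bij_\<tau>] spread_shift ..
  finally show "act (\<lambda>i. f i \<otimes>\<^bsub>G\<^esub> g (i - m), m + n) p = (act (g, n) \<circ> act (f, m)) p" by (simp add: act_def)
qed

text \<open>\<open>spread\<close> preserves \<open>U\<close>, so where a point of \<open>U\<close>
  ends up reveals the exponent of \<open>\<tau>\<close>; cancelling that power leaves
  \<open>spread_inj\<close>.\<close>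

lemma act_inj:
  assumes "\<And>i. f i \<in> carrier G" "\<And>i. g i \<in> carrier G" "act (f, m) = act (g, n)"
  shows "(f, m) = (g, n)"
proof -
  obtain y where y: "y \<in> U" using U_ne by blast
  have u: "spread f y \<in> U" "spread g y \<in> U"
    using spread_index[of 0 y f] spread_index[of 0 y g] y assms(1,2) by auto
  have "ipow \<tau> m (spread f y) = ipow \<tau> n (spread g y)" using fun_cong[OF assms(3), of y] by (simp add: act_def)
  then have "ipow \<tau> (- n) (ipow \<tau> m (spread f y)) = spread g y" using bij_\<tau> by simp
  then have "ipow \<tau> (- n + m) (spread f y) \<in> U" using ipow_add[OF bij_\<tau>, of "- n" m] u by simp
  then have mn: "m = n" using wander[of "- n + m" "spread f y"] u by auto
  have "spread f p = spread g p" for p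
  proof -
    have "ipow \<tau> m (spread f p) = ipow \<tau> m (spread g p)" using fun_cong[OF assms(3), of p] mn by (simp add: act_def)
    then have "ipow \<tau> (- m) (ipow \<tau> m (spread f p)) = ipow \<tau> (- m) (ipow \<tau> m (spread g p))" by simp
    then show ?thesis using bij_\<tau> by simp
  qed
  then have "spread f = spread g" by (rule ext)
  then show ?thesis using spread_inj[OF assms(1,2)] mn by simp
qed

lemma act_delta: "x \<in> carrier G \<Longrightarrow> act (\<lambda>i. if i = 0 then x else \<one>\<^bsub>G\<^esub>, 0) = \<phi> x"
  using spread_delta[of x 0] by (simp add: act_def fun_eq_iff)

lemma act_H: "finite {i. f i \<noteq> \<one>\<^bsub>G\<^esub>} \<Longrightarrow> (\<And>i. f i \<in> carrier G) \<Longrightarrow> act (f, n) \<in> H"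
  unfolding act_def fst_conv snd_conv by (intro fgroupD(4)[OF H] ipow_in[OF H \<tau>] spread_H)

lemma act_out: "\<tau> p = p \<Longrightarrow> p \<notin> U \<Longrightarrow> act q p = p"
  using ipow_fix[OF bij_\<tau>, of p] by (simp add: act_def spread_out)

text \<open>The second claim says that the new action extends the old one, so the actions at all
  levels glue together on the ascending union.\<close>

lemma step_faithful:
  assumes tags: "low_tags k G" and V: "U \<subseteq> V" "\<And>p. p \<notin> V \<Longrightarrow> \<tau> p = p"
  shows "faithful (wr_step (Suc k) G) (\<lambda>x. act (wdn G x)) V H"
    "\<And>x. x \<in> carrier G \<Longrightarrow> act (wdn G x) = \<phi> x"
proof -
  let ?W = "wr_step (Suc k) G"
  have one: "\<one>\<^bsub>?W\<^esub> = \<one>\<^bsub>G\<^esub>" by (simp add: wr_step_def)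
  show base: "act (wdn G x) = \<phi> x" if "x \<in> carrier G" for x
    using act_delta[OF that] that by (simp add: wdn_def)
  note dec = wdn_wup[OF _ tags]
  have mult: "wup (Suc k) G (f, m) \<otimes>\<^bsub>?W\<^esub> wup (Suc k) G (g, n) = wup (Suc k) G (\<lambda>i. f i \<otimes>\<^bsub>G\<^esub> g (i - m), m + n)"
    if "\<And>i. f i \<in> carrier G" "\<And>i. g i \<in> carrier G" for f g m n
    using dec[of f m] dec[of g n] that by (simp add: wr_step_def)
  have fin: "finite {i. f i \<otimes>\<^bsub>G\<^esub> g (i - m) \<noteq> \<one>\<^bsub>G\<^esub>}"
    if "finite {i. f i \<noteq> \<one>\<^bsub>G\<^esub>}" "finite {i. g i \<noteq> \<one>\<^bsub>G\<^esub>}" for f g and m :: int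
  proof (rule finite_subset)
    show "{i. f i \<otimes>\<^bsub>G\<^esub> g (i - m) \<noteq> \<one>\<^bsub>G\<^esub>} \<subseteq> {i. f i \<noteq> \<one>\<^bsub>G\<^esub>} \<union> (\<lambda>i. i + m) ` {i. g i \<noteq> \<one>\<^bsub>G\<^esub>}"
    proof
      fix i assume "i \<in> {i. f i \<otimes>\<^bsub>G\<^esub> g (i - m) \<noteq> \<one>\<^bsub>G\<^esub>}"
      then have "f i \<noteq> \<one>\<^bsub>G\<^esub> \<or> g (i - m) \<noteq> \<one>\<^bsub>G\<^esub>" using G_unit(1)[OF G_one(1)] by auto
      then show "i \<in> {i. f i \<noteq> \<one>\<^bsub>G\<^esub>} \<union> (\<lambda>i. i + m) ` {i. g i \<noteq> \<one>\<^bsub>G\<^esub>}"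
        by (auto intro!: image_eqI[of _ _ "i - m"])
    qed
  qed (use that in auto)
  have inverse: "\<exists>y\<in>carrier ?W. x \<otimes>\<^bsub>?W\<^esub> y = \<one>\<^bsub>G\<^esub>" if x: "x \<in> carrier ?W" for x
  proof -
    obtain f n where f: "x = wup (Suc k) G (f, n)" "\<And>i. f i \<in> carrier G" "finite {i. f i \<noteq> \<one>\<^bsub>G\<^esub>}"
      using x by (rule step_cases) blast
    have "\<forall>y. y \<in> carrier G \<longrightarrow> (\<exists>w. w \<in> carrier G \<and> y \<otimes>\<^bsub>G\<^esub> w = \<one>\<^bsub>G\<^esub>)" using F unfolding faithful_def by blast
    then obtain \<iota> where \<iota>: "\<And>y. y \<in> carrier G \<Longrightarrow> \<iota> y \<in> carrier G" "\<And>y. y \<in> carrier G \<Longrightarrow> y \<otimes>\<^bsub>G\<^esub> \<iota> y = \<one>\<^bsub>G\<^esub>"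
      by metis
    have \<iota>1: "\<iota> \<one>\<^bsub>G\<^esub> = \<one>\<^bsub>G\<^esub>" using \<iota>[OF G_one(1)] G_unit(1) by metis
    \<comment> \<open>Obtained by solving \<open>f i \<otimes> f' (i - n) = \<one>\<close> for
      \<open>f'\<close>.\<close>
    define f' where "f' i = \<iota> (f (i + n))" for i
    have c: "f' i \<in> carrier G" for i using \<iota>(1)[OF f(2)] by (simp add: f'_def)
    have "finite {i. f' i \<noteq> \<one>\<^bsub>G\<^esub>}"
    proof (rule finite_subset)
      show "{i. f' i \<noteq> \<one>\<^bsub>G\<^esub>} \<subseteq> (\<lambda>i. i - n) ` {i. f i \<noteq> \<one>\<^bsub>G\<^esub>}"
      proof
        fix i assume "i \<in> {i. f' i \<noteq> \<one>\<^bsub>G\<^esub>}"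
        then have "f (i + n) \<noteq> \<one>\<^bsub>G\<^esub>" using \<iota>1 unfolding f'_def by force
        then show "i \<in> (\<lambda>i. i - n) ` {i. f i \<noteq> \<one>\<^bsub>G\<^esub>}" by (intro image_eqI[of _ _ "i + n"]) auto
      qed
    qed (use f(3) in auto)
    then have "wup (Suc k) G (f', - n) \<in> carrier ?W" using c by (intro wup_in_step)
    moreover have "x \<otimes>\<^bsub>?W\<^esub> wup (Suc k) G (f', - n) = \<one>\<^bsub>G\<^esub>"
      unfolding f(1) mult[OF f(2) c] using \<iota>(2)[OF f(2)] by (simp add: f'_def wup_def)
    ultimately show ?thesis by blast
  qed
  show "faithful ?W (\<lambda>x. act (wdn G x)) V H"
    unfolding faithful_def one
  proof (intro conjI ballI allI impI)
    show "\<one>\<^bsub>G\<^esub> \<in> carrier ?W" using carrier_subset_step[OF G_one(1) G_one(1)] .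
    show "act (wdn G \<one>\<^bsub>G\<^esub>) = id" using base[OF G_one(1)] G_one(2) by simp
    show "inj_on (\<lambda>x. act (wdn G x)) (carrier ?W)"
    proof (rule inj_onI)
      fix x y assume x: "x \<in> carrier ?W" and y: "y \<in> carrier ?W" and e: "act (wdn G x) = act (wdn G y)"
      obtain f m where f: "x = wup (Suc k) G (f, m)" "\<And>i. f i \<in> carrier G" using x by (rule step_cases) blast
      obtain g n where g: "y = wup (Suc k) G (g, n)" "\<And>i. g i \<in> carrier G" using y by (rule step_cases) blast
      have "act (f, m) = act (g, n)" using e unfolding f(1) g(1) dec[OF f(2)] dec[OF g(2)] .
      then have "(f, m) = (g, n)" by (rule act_inj[OF f(2) g(2)])
      then show "x = y" unfolding f(1) g(1) by simp
    qed
    fix x assume x: "x \<in> carrier ?W"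
    obtain f m where f: "x = wup (Suc k) G (f, m)" "\<And>i. f i \<in> carrier G" "finite {i. f i \<noteq> \<one>\<^bsub>G\<^esub>}"
      using x by (rule step_cases) blast
    show "act (wdn G x) \<in> H" unfolding f(1) dec[OF f(2)] using act_H[OF f(3,2)] .
    show "act (wdn G x) p = p" if "p \<notin> V" for p using act_out V that by blast
    show "\<exists>y\<in>carrier ?W. x \<otimes>\<^bsub>?W\<^esub> y = \<one>\<^bsub>G\<^esub>" using inverse[OF x] .
    fix y assume y: "y \<in> carrier ?W"
    obtain g n where g: "y = wup (Suc k) G (g, n)" "\<And>i. g i \<in> carrier G" "finite {i. g i \<noteq> \<one>\<^bsub>G\<^esub>}"
      using y by (rule step_cases) blast
    have c: "f i \<otimes>\<^bsub>G\<^esub> g (i - m) \<in> carrier G" for i using G_mult(1)[OF f(2) g(2)] .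
    show "x \<otimes>\<^bsub>?W\<^esub> y \<in> carrier ?W"
      unfolding f(1) g(1) mult[OF f(2) g(2)] by (rule wup_in_step[OF c fin[OF f(3) g(3)]])
    have "wdn G (x \<otimes>\<^bsub>?W\<^esub> y) = (\<lambda>i. f i \<otimes>\<^bsub>G\<^esub> g (i - m), m + n)"
      unfolding f(1) g(1) mult[OF f(2) g(2)] by (rule dec[OF c])
    then show "act (wdn G (x \<otimes>\<^bsub>?W\<^esub> y)) = act (wdn G y) \<circ> act (wdn G x)"
      unfolding f(1) g(1) dec[OF f(2)] dec[OF g(2)] using act_mult[of f g m n, OF f(2) g(2)] by metis
  qed
qed

end

text \<open>Apply \<open>wreath_action\<close> at each level, with \<open>g (Suc k)\<close>
  displacing the support \<open>Y k\<close> of the action of \<open>Wg k\<close>. The level-0 action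
  is faithful because \<open>g 0\<close> has infinite order.\<close>

lemma Winf_embeds:
  fixes g :: "nat \<Rightarrow> 'a \<Rightarrow> 'a" and Y :: "nat \<Rightarrow> 'a set"
  assumes H: "fgroup H" and g: "\<And>n. g n \<in> H" "g 0 \<noteq> id" and Y: "\<And>n. Y n \<subseteq> Y (Suc n)" "\<And>n p. p \<notin> Y n \<Longrightarrow> g n p = p"
    and wander: "\<And>n k x. k \<noteq> 0 \<Longrightarrow> x \<in> Y n \<Longrightarrow> ipow (g (Suc n)) k x \<notin> Y n"
    and tors: "\<And>k. ipow (g 0) k = id \<Longrightarrow> k = 0"
  obtains \<psi> where "inj_on \<psi> (carrier Winf)" "\<psi> ` carrier Winf \<subseteq> H" "fgroup (\<psi> ` carrier Winf)"
    "\<And>x y. x \<in> carrier Winf \<Longrightarrow> y \<in> carrier Winf \<Longrightarrow>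
      x \<otimes>\<^bsub>Winf\<^esub> y \<in> carrier Winf \<and> \<psi> (x \<otimes>\<^bsub>Winf\<^esub> y) = \<psi> y \<circ> \<psi> x"
proof -
  obtain y0 where "g 0 y0 \<noteq> y0" using g(2) by (auto simp: fun_eq_iff)
  then have "y0 \<in> Y 0" using Y(2)[of y0 0] by blast
  moreover have "Y 0 \<subseteq> Y n" for n by (induct n) (use Y(1) in auto)
  ultimately have Y_ne: "Y n \<noteq> {}" for n by blast
  have b0: "bij (g 0)" using fgroupD(2)[OF H g(1)] .
  define \<Phi> where "\<Phi> = rec_nat (\<lambda>x. ipow (g 0) (wint x))
    (\<lambda>k \<phi> x. wreath_action.act (Y k) (g (Suc k)) \<phi> (wdn (Wg k) x))"
  have \<Phi>0: "\<Phi> 0 = (\<lambda>x. ipow (g 0) (wint x))"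
    and \<Phi>Suc: "\<Phi> (Suc k) = (\<lambda>x. wreath_action.act (Y k) (g (Suc k)) (\<Phi> k) (wdn (Wg k) x))" for k
    by (simp_all add: \<Phi>_def)
  have inv: "faithful (Wg k) (\<Phi> k) (Y k) H \<and> low_tags k (Wg k)" for k
  proof (induct k)
    case 0
    have c: "x \<in> carrier (Wg 0) \<longleftrightarrow> (\<exists>a. x = WB a)" for x by auto
    have pow_inj: "a = b" if "ipow (g 0) a = ipow (g 0) b" for a b
    proof -
      have "ipow (g 0) (a - b) x = x" for x
        using ipow_add[OF b0, of "- b" a x] that b0 by simp
      then have "ipow (g 0) (a - b) = id" by (simp add: fun_eq_iff)
      then show ?thesis using tors[of "a - b"] by simp
    qed
    have "faithful (Wg 0) (\<Phi> 0) (Y 0) H"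
      unfolding faithful_def \<Phi>0
    proof (intro conjI ballI allI impI)
      show "\<one>\<^bsub>Wg 0\<^esub> \<in> carrier (Wg 0)" "ipow (g 0) (wint \<one>\<^bsub>Wg 0\<^esub>) = id" by auto
      show "inj_on (\<lambda>x. ipow (g 0) (wint x)) (carrier (Wg 0))"
        using pow_inj by (auto intro!: inj_onI)
      fix x assume x: "x \<in> carrier (Wg 0)"
      then obtain a where a: "x = WB a" using c by blast
      show "ipow (g 0) (wint x) \<in> H" using ipow_in[OF H g(1)] .
      show "ipow (g 0) (wint x) p = p" if "p \<notin> Y 0" for p using ipow_fix[OF b0 Y(2)[OF that]] .
      show "\<exists>y\<in>carrier (Wg 0). x \<otimes>\<^bsub>Wg 0\<^esub> y = \<one>\<^bsub>Wg 0\<^esub>"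
        by (rule bexI[of _ "WB (- a)"]) (auto simp: a)
      fix y assume "y \<in> carrier (Wg 0)"
      then obtain b where b: "y = WB b" using c by blast
      show "x \<otimes>\<^bsub>Wg 0\<^esub> y \<in> carrier (Wg 0)" by simp
      show "ipow (g 0) (wint (x \<otimes>\<^bsub>Wg 0\<^esub> y)) = ipow (g 0) (wint y) \<circ> ipow (g 0) (wint x)"
        using ipow_add[OF b0, of b a] by (simp add: a b fun_eq_iff add.commute)
    qed
    moreover have "low_tags 0 (Wg 0)" by (auto simp: low_tags_def)
    ultimately show ?case by blast
  next
    case (Suc k)
    interpret wreath_action H "Y k" "g (Suc k)" "Wg k" "\<Phi> k"
      by unfold_locales (use H g Y_ne wander Suc in auto)
    show ?case
      using step_faithful(1)[of k "Y (Suc k)"] low_tags_step Suc Y unfolding \<Phi>Suc by auto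
  qed
  have up: "x \<in> carrier (Wg (Suc k)) \<and> \<Phi> (Suc k) x = \<Phi> k x" if x: "x \<in> carrier (Wg k)" for x k
  proof -
    interpret wreath_action H "Y k" "g (Suc k)" "Wg k" "\<Phi> k"
      by unfold_locales (use H g Y_ne wander inv in auto)
    show ?thesis
      using step_faithful(2)[of k "Y (Suc k)" x] inv Y x carrier_subset_step[OF G_one(1) x] unfolding \<Phi>Suc by auto
  qed
  have up_le: "x \<in> carrier (Wg m) \<and> \<Phi> m x = \<Phi> k x" if "x \<in> carrier (Wg k)" "k \<le> m" for x k m
    using that(2) by (induct m rule: dec_induct) (use up that(1) in auto)
  \<comment> \<open>The least level is only a canonical choice: by \<open>up_le\<close> every level
    containing \<open>x\<close> gives the same value.\<close>
  define \<psi> where "\<psi> x = \<Phi> (LEAST k. x \<in> carrier (Wg k)) x" for x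
  have \<psi>: "\<psi> x = \<Phi> k x" if "x \<in> carrier (Wg k)" for x k
    unfolding \<psi>_def using up_le[of x "LEAST k. x \<in> carrier (Wg k)" k] LeastI[of "\<lambda>k. x \<in> carrier (Wg k)" k]
      Least_le[of "\<lambda>k. x \<in> carrier (Wg k)" k] that by simp
  have cW: "x \<in> carrier Winf \<longleftrightarrow> (\<exists>k. x \<in> carrier (Wg k))" for x by (simp add: Winf_def)
  have common: "\<exists>k. x \<in> carrier (Wg k) \<and> y \<in> carrier (Wg k)" if xy: "x \<in> carrier Winf" "y \<in> carrier Winf" for x y
  proof -
    obtain k l where "x \<in> carrier (Wg k)" "y \<in> carrier (Wg l)" using xy cW by blast
    then have "x \<in> carrier (Wg (max k l))" "y \<in> carrier (Wg (max k l))" using up_le by auto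
    then show ?thesis by blast
  qed
  have mult: "x \<otimes>\<^bsub>Winf\<^esub> y \<in> carrier Winf \<and> \<psi> (x \<otimes>\<^bsub>Winf\<^esub> y) = \<psi> y \<circ> \<psi> x"
    if xy: "x \<in> carrier Winf" "y \<in> carrier Winf" for x y
  proof -
    define k where "k = (LEAST k. x \<in> carrier (Wg k) \<and> y \<in> carrier (Wg k))"
    have k: "x \<in> carrier (Wg k)" "y \<in> carrier (Wg k)"
      using LeastI_ex[OF common[OF xy]] unfolding k_def by blast+
    have e: "x \<otimes>\<^bsub>Winf\<^esub> y = x \<otimes>\<^bsub>Wg k\<^esub> y" by (simp add: Winf_def k_def)
    have "x \<otimes>\<^bsub>Wg k\<^esub> y \<in> carrier (Wg k)" "\<Phi> k (x \<otimes>\<^bsub>Wg k\<^esub> y) = \<Phi> k y \<circ> \<Phi> k x"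
      using inv[of k] k unfolding faithful_def by blast+
    then show ?thesis unfolding e using cW \<psi> k by metis
  qed
  have inj: "inj_on \<psi> (carrier Winf)"
  proof (rule inj_onI)
    fix x y assume xy: "x \<in> carrier Winf" "y \<in> carrier Winf" and e: "\<psi> x = \<psi> y"
    obtain k where k: "x \<in> carrier (Wg k)" "y \<in> carrier (Wg k)" using common[OF xy] by blast
    have "inj_on (\<Phi> k) (carrier (Wg k))" using inv[of k] unfolding faithful_def by blast
    then show "x = y" using e k unfolding \<psi>[OF k(1)] \<psi>[OF k(2)] by (rule inj_onD)
  qed
  have sub: "\<psi> x \<in> H" if "x \<in> carrier Winf" for x
  proof -
    obtain k where "x \<in> carrier (Wg k)" using \<open>x \<in> carrier Winf\<close> cW by blast
    then show ?thesis using inv[of k] \<psi> unfolding faithful_def by metis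
  qed
  have "fgroup (\<psi> ` carrier Winf)"
    unfolding fgroup_def
  proof (intro conjI ballI)
    have "\<one>\<^bsub>Wg 0\<^esub> \<in> carrier (Wg 0)" "\<Phi> 0 \<one>\<^bsub>Wg 0\<^esub> = id" using inv[of 0] unfolding faithful_def by blast+
    then show "id \<in> \<psi> ` carrier Winf" using \<psi> cW by (metis imageI)
    fix f assume "f \<in> \<psi> ` carrier Winf"
    then obtain x where x: "x \<in> carrier Winf" "f = \<psi> x" by blast
    show bf: "bij f" using sub[OF x(1)] x(2) fgroupD(2)[OF H] by simp
    obtain k where k: "x \<in> carrier (Wg k)" using x(1) cW by blast
    then obtain y where y: "y \<in> carrier (Wg k)" "x \<otimes>\<^bsub>Wg k\<^esub> y = \<one>\<^bsub>Wg k\<^esub>"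
      using inv[of k] unfolding faithful_def by blast
    have "\<Phi> k y \<circ> \<Phi> k x = id" using inv[of k] k y unfolding faithful_def by metis
    then have "\<Phi> k y (f q) = q" for q using \<psi>[OF k] x(2) by (metis comp_apply id_apply)
    then have "iv f = \<psi> y" unfolding \<psi>[OF y(1)] using bf by (auto simp: fun_eq_iff iv_eq_iff) (metis bij_iv_simps(1))
    then show "iv f \<in> \<psi> ` carrier Winf" using y(1) cW by blast
    fix f' assume "f' \<in> \<psi> ` carrier Winf"
    then obtain x' where x': "x' \<in> carrier Winf" "f' = \<psi> x'" by blast
    show "f \<circ> f' \<in> \<psi> ` carrier Winf" using mult[OF x'(1) x(1)] x(2) x'(2) by (metis imageI)
  qed
  then show thesis using that inj sub mult by blast
qed

subsection \<open>Elements of PLo\<close>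

lemma PLo_homeo:
  assumes "f \<in> PLo"
  shows "\<And>x. x \<notin> {0..1} \<Longrightarrow> f x = x" "strict_mono f" "bij f" "f 0 = 0" "f 1 = 1" "continuous_on UNIV f"
proof -
  show out: "f x = x" if "x \<notin> {0..1}" for x using assms that unfolding PLo_def by blast
  obtain g where g: "homeomorphism {0..1} {0..1} f g" using assms unfolding PLo_def by blast
  have mono: "mono_on {0..1} f" using assms unfolding PLo_def by blast
  have im: "f ` {0..1} = {0..1}" using g by (simp add: homeomorphism_def)
  have gf: "g (f x) = x" if "x \<in> {0..1}" for x using g that by (simp add: homeomorphism_def)
  have rng: "f x \<in> {0..1}" if "x \<in> {0..1}" for x using im that by blast
  show f0: "f 0 = 0"
  proof -
    have "(0::real) \<in> f ` {0..1}" unfolding im by simp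
    then obtain x where "x \<in> {0..1}" "f x = 0" by force
    then show ?thesis using mono_onD[OF mono, of 0 x] rng[of 0] by auto
  qed
  show f1: "f 1 = 1"
  proof -
    have "(1::real) \<in> f ` {0..1}" unfolding im by simp
    then obtain x where "x \<in> {0..1}" "f x = 1" by force
    then show ?thesis using mono_onD[OF mono, of x 1] rng[of 1] by auto
  qed
  show sm: "strict_mono f"
  proof (rule strict_monoI)
    fix x y :: real assume xy: "x < y"
    have "f x < f y" if "x \<in> {0..1}" "y \<in> {0..1}"
    proof -
      have "f x \<le> f y" using mono_onD[OF mono that] xy by simp
      moreover have "f x \<noteq> f y" using gf[OF that(1)] gf[OF that(2)] xy by auto
      ultimately show ?thesis by simp
    qed
    moreover have "x \<in> {0..1} \<or> f x = x" "y \<in> {0..1} \<or> f y = y" using out by blast+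
    ultimately show "f x < f y" using xy rng[of x] rng[of y] by force
  qed
  show "bij f"
  proof (rule bijI)
    show "inj f" using sm by (rule strict_mono_imp_inj_on)
    show "surj f"
    proof (unfold surj_def, intro allI)
      fix y show "\<exists>x. y = f x"
      proof (cases "y \<in> {0..1}")
        case True
        then have "y \<in> f ` {0..1}" unfolding im .
        then show ?thesis by blast
      next
        case False
        then show ?thesis using out[of y] by (intro exI[of _ y]) simp
      qed
    qed
  qed
  have c1: "continuous_on {0..1} f" using g by (simp add: homeomorphism_def)
  have idc: "continuous_on A f" if "\<And>x. x \<in> A \<Longrightarrow> f x = x" for A
    using continuous_on_cong[of A A f id] that by simp
  have c2: "continuous_on {..0} f" using out f0 by (intro idc) force
  have c3: "continuous_on {1..} f" using out f1 by (intro idc) force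
  have "continuous_on ({..0} \<union> {0..1} \<union> {1..}) f"
    by (intro continuous_on_closed_Un closed_Un c1 c2 c3) auto
  moreover have "{..0} \<union> {0..1} \<union> {1..} = (UNIV :: real set)" by auto
  ultimately show "continuous_on UNIV f" by simp
qed

text \<open>Take the first entry above \<open>p\<close>, or not below \<open>p\<close>, and its
  predecessor; the two versions serve right and left germs.\<close>

lemma subdivision_piece:
  assumes xs: "length xs \<ge> 2" "hd xs = (0::real)" "last xs = 1"
  shows "0 \<le> p \<Longrightarrow> p < 1 \<Longrightarrow> \<exists>i. Suc i < length xs \<and> xs ! i \<le> p \<and> p < xs ! Suc i"
    "0 < p \<Longrightarrow> p \<le> 1 \<Longrightarrow> \<exists>i. Suc i < length xs \<and> xs ! i < p \<and> p \<le> xs ! Suc i"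
proof -
  have ne: "xs \<noteq> []" using xs(1) by auto
  have ends: "xs ! 0 = 0" "xs ! (length xs - 1) = 1"
    using hd_conv_nth[OF ne] last_conv_nth[OF ne] xs(2,3) by simp_all
  show "\<exists>i. Suc i < length xs \<and> xs ! i \<le> p \<and> p < xs ! Suc i" if p: "0 \<le> p" "p < 1"
  proof -
    define j where "j = (LEAST j. p < xs ! j)"
    have ex: "p < xs ! (length xs - 1)" using ends p by simp
    have j: "p < xs ! j" "j \<le> length xs - 1" 
      unfolding j_def using LeastI[where P = "\<lambda>j. p < xs ! j", OF ex] Least_le[where P = "\<lambda>j. p < xs ! j", OF ex] by auto
    then obtain i where i: "j = Suc i" using ends p by (cases j) auto
    then have "\<not> p < xs ! i" unfolding j_def by (metis lessI not_less_Least)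
    then show ?thesis using i j xs(1) by (intro exI[of _ i]) auto
  qed
  show "\<exists>i. Suc i < length xs \<and> xs ! i < p \<and> p \<le> xs ! Suc i" if p: "0 < p" "p \<le> 1"
  proof -
    define j where "j = (LEAST j. p \<le> xs ! j)"
    have ex: "p \<le> xs ! (length xs - 1)" using ends p by simp
    have j: "p \<le> xs ! j" "j \<le> length xs - 1" 
      unfolding j_def using LeastI[where P = "\<lambda>j. p \<le> xs ! j", OF ex] Least_le[where P = "\<lambda>j. p \<le> xs ! j", OF ex] by auto
    then obtain i where i: "j = Suc i" using ends p by (cases j) auto
    then have "\<not> p \<le> xs ! i" unfolding j_def by (metis lessI not_less_Least)
    then show ?thesis using i j xs(1) by (intro exI[of _ i]) auto
  qed
qed

lemma affine_slope_pos:
  fixes f :: "real \<Rightarrow> real"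
  assumes "strict_mono f" "u < v" "\<forall>x\<in>{u..v}. f x = m * x + c" shows "m > 0"
proof -
  have "f u < f v" using assms(1,2) by (rule strict_monoD)
  then have "0 < m * (v - u)" using assms by (simp add: algebra_simps)
  then show ?thesis using assms(2) by (simp add: zero_less_mult_iff)
qed

lemma PLo_sub_PLa: "PLo \<subseteq> PLa"
proof
  fix f assume f: "f \<in> PLo"
  note h = PLo_homeo[OF f]
  obtain xs :: "real list" where xs: "length xs \<ge> 2" "hd xs = 0" "last xs = 1"
    and aff: "\<And>i. Suc i < length xs \<Longrightarrow> \<exists>m c. \<forall>x\<in>{xs ! i .. xs ! Suc i}. f x = m * x + c"
    using f unfolding PLo_def by blast
  have idp: "\<exists>m>0. \<exists>e>0. \<forall>t\<in>{0..e}. f (p + \<sigma> * t) = f p + \<sigma> * (m * t)"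
    if "e > 0" "\<And>t. 0 \<le> t \<Longrightarrow> t \<le> e \<Longrightarrow> f (p + \<sigma> * t) = p + \<sigma> * t" for p \<sigma> e
  proof (intro exI conjI ballI)
    fix t assume "t \<in> {0..e}"
    then show "f (p + \<sigma> * t) = f p + \<sigma> * (1 * t)" using that(2)[of t] that(2)[of 0] that(1) by simp
  qed (use that(1) in auto)
  have "\<exists>m>0. \<exists>e>0. \<forall>t\<in>{0..e}. f (p + 1 * t) = f p + 1 * (m * t)" for p
  proof -
    consider "p < 0" | "p \<ge> 1" | "0 \<le> p" "p < 1" by linarith
    then show ?thesis
    proof cases
      case 1
      then show ?thesis using h(1) h(4) by (intro idp[of "- p"]) (auto simp: le_less)
    next
      case 2
      then show ?thesis using h(1) h(5) by (intro idp[of 1]) (auto simp: le_less)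
    next
      case 3
      obtain i where i: "Suc i < length xs" "xs ! i \<le> p" "p < xs ! Suc i" using subdivision_piece(1)[OF xs 3] by blast
      obtain m c where m: "\<forall>x\<in>{xs ! i .. xs ! Suc i}. f x = m * x + c" using aff[OF i(1)] by blast
      have "m > 0" by (rule affine_slope_pos[OF h(2) _ m]) (use i in linarith)
      moreover have "\<forall>t\<in>{0..xs ! Suc i - p}. f (p + 1 * t) = f p + 1 * (m * t)"
        using m i by (auto simp: algebra_simps)
      ultimately show ?thesis using i by (intro exI[of _ m] conjI exI[of _ "xs ! Suc i - p"]) auto
    qed
  qed
  moreover have "\<exists>m>0. \<exists>e>0. \<forall>t\<in>{0..e}. f (p + (-1) * t) = f p + (-1) * (m * t)" for p
  proof -
    consider "p \<le> 0" | "p > 1" | "0 < p" "p \<le> 1" by linarith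
    then show ?thesis
    proof cases
      case 1
      then show ?thesis using h(1) h(4) by (intro idp[of 1]) (auto simp: le_less)
    next
      case 2
      then show ?thesis using h(1) h(5) by (intro idp[of "p - 1"]) (auto simp: le_less)
    next
      case 3
      obtain i where i: "Suc i < length xs" "xs ! i < p" "p \<le> xs ! Suc i" using subdivision_piece(2)[OF xs 3] by blast
      obtain m c where m: "\<forall>x\<in>{xs ! i .. xs ! Suc i}. f x = m * x + c" using aff[OF i(1)] by blast
      have "m > 0" by (rule affine_slope_pos[OF h(2) _ m]) (use i in linarith)
      moreover have "\<forall>t\<in>{0..p - xs ! i}. f (p + (-1) * t) = f p + (-1) * (m * t)"
        using m i by (auto simp: algebra_simps)
      ultimately show ?thesis using i by (intro exI[of _ m] conjI exI[of _ "p - xs ! i"]) auto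
    qed
  qed
  ultimately show "f \<in> PLa" unfolding PLa_def using h by blast
qed

lemma PLo_iv: assumes f: "f \<in> PLo" shows "iv f \<in> PLo"
proof -
  note h = PLo_homeo[OF f]
  obtain g where g: "homeomorphism {0..1} {0..1} f g" using f unfolding PLo_def by blast
  obtain xs :: "real list" where xs: "sorted_wrt (<) xs" "length xs \<ge> 2" "hd xs = 0" "last xs = 1"
    and aff: "\<And>i. Suc i < length xs \<Longrightarrow> \<exists>m c. \<forall>x\<in>{xs ! i .. xs ! Suc i}. f x = m * x + c"
    using f unfolding PLo_def by blast
  have ff: "f (iv f y) = y" for y using h(3) by (rule bij_iv_simps)
  have less: "iv f x < iv f y \<longleftrightarrow> x < y" for x y using strict_mono_less[OF h(2), of "iv f x" "iv f y"] ff by simp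
  have le: "iv f y \<le> x \<longleftrightarrow> y \<le> f x" "x \<le> iv f y \<longleftrightarrow> f x \<le> y" for x y
    using strict_mono_less_eq[OF h(2), of "iv f y" x] strict_mono_less_eq[OF h(2), of x "iv f y"] ff by simp_all
  show ?thesis
    unfolding PLo_def
  proof (intro CollectI conjI allI impI)
    show "iv f x = x" if "x \<notin> {0..1}" for x using h(1)[OF that] h(3) by (simp add: iv_eq_iff)
    have gi: "iv f x = g x" if "x \<in> {0..1}" for x
    proof -
      have "f (g x) = x" using g that by (simp add: homeomorphism_def)
      then show ?thesis using h(3) by (simp add: iv_eq_iff)
    qed
    have "homeomorphism {0..1} {0..1} (iv f) f"
      by (rule homeomorphism_cong[OF homeomorphism_symD[OF g]]) (use gi in auto)
    then show "\<exists>g. homeomorphism {0..1} {0..1} (iv f) g" by blast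
    show "mono_on {0..1} (iv f)" using less by (auto intro!: mono_onI simp: le_less)
    show "\<exists>xs. sorted_wrt (<) xs \<and> 2 \<le> length xs \<and> hd xs = 0 \<and> last xs = 1 \<and>
        (\<forall>i. Suc i < length xs \<longrightarrow> (\<exists>m c. \<forall>x\<in>{xs ! i..xs ! Suc i}. iv f x = m * x + c))"
    \<comment> \<open>The breaks of the inverse are among the images of the subdivision points of
      \<open>f\<close>.\<close>
    proof (intro exI[of _ "map f xs"] conjI allI impI)
      show "sorted_wrt (<) (map f xs)"
        using xs(1) strict_mono_less[OF h(2)] by (simp add: sorted_wrt_map)
      have "xs \<noteq> []" using xs(2) by auto
      then show "2 \<le> length (map f xs)" "hd (map f xs) = 0" "last (map f xs) = 1"
        using xs h by (simp_all add: hd_map last_map)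
      fix i assume i: "Suc i < length (map f xs)"
      then have i': "Suc i < length xs" by simp
      obtain m c where m: "\<forall>x\<in>{xs ! i .. xs ! Suc i}. f x = m * x + c" using aff[OF i'] by blast
      have "xs ! i < xs ! Suc i" using sorted_wrt_nth_less[OF xs(1), of i "Suc i"] i by simp
      then have pos: "m > 0" by (rule affine_slope_pos[OF h(2) _ m])
      have "iv f y = (1 / m) * y + (- c / m)" if "y \<in> {map f xs ! i..map f xs ! Suc i}" for y
      proof -
        have "iv f y \<in> {xs ! i .. xs ! Suc i}" using that i le by simp
        then have "y = m * iv f y + c" using m ff by metis
        then show ?thesis using pos by (simp add: field_simps)
      qed
      then show "\<exists>m c. \<forall>x\<in>{map f xs ! i..map f xs ! Suc i}. iv f x = m * x + c" by blast
    qed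
  qed
qed

text \<open>Unfolding \<open>m_inv\<close> directly spares a proof that \<open>PLgrp\<close> is a
  group.\<close>

lemma m_inv_PLgrp: assumes "f \<in> PLo" shows "inv\<^bsub>PLgrp\<^esub> f = iv f"
proof -
  have b: "bij f" using PLo_homeo(3)[OF assms] .
  have 1: "iv f \<circ> f = id" "f \<circ> iv f = id" using b by (simp_all add: fun_eq_iff bij_iv_simps)
  show ?thesis
    unfolding m_inv_def
  proof (rule the_equality)
    show "iv f \<in> carrier PLgrp \<and> f \<otimes>\<^bsub>PLgrp\<^esub> iv f = \<one>\<^bsub>PLgrp\<^esub> \<and> iv f \<otimes>\<^bsub>PLgrp\<^esub> f = \<one>\<^bsub>PLgrp\<^esub>"
      using PLo_iv[OF assms] 1 by (simp add: PLgrp_def)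
    fix y assume "y \<in> carrier PLgrp \<and> f \<otimes>\<^bsub>PLgrp\<^esub> y = \<one>\<^bsub>PLgrp\<^esub> \<and> y \<otimes>\<^bsub>PLgrp\<^esub> f = \<one>\<^bsub>PLgrp\<^esub>"
    then have "y \<circ> f = id" "f \<circ> y = id" by (simp_all add: PLgrp_def)
    then show "y = iv f" using b by (metis bij_iv_simps(2) comp_apply ext id_apply)
  qed
qed

lemma subgroup_plgroup: assumes "subgroup H PLgrp" shows "plgroup H" "H \<subseteq> PLo"
proof -
  show sub: "H \<subseteq> PLo" using subgroup.subset[OF assms] by (simp add: PLgrp_def)
  have "id \<in> H" using subgroup.one_closed[OF assms] by (simp add: PLgrp_def)
  moreover have "f \<circ> g \<in> H" if "f \<in> H" "g \<in> H" for f g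
    using subgroup.m_closed[OF assms that(2,1)] by (simp add: PLgrp_def)
  moreover have "bij f \<and> iv f \<in> H" if "f \<in> H" for f
    using subgroup.m_inv_closed[OF assms that] m_inv_PLgrp[of f] PLo_homeo(3)[of f] sub that by auto
  ultimately have "fgroup H" unfolding fgroup_def by blast
  then show "plgroup H" unfolding plgroup_def using sub PLo_sub_PLa by blast
qed

lemma plgroup_subgroup: assumes "fgroup K" "K \<subseteq> PLo" shows "subgroup K PLgrp"
proof (rule subgroup.intro)
  show "K \<subseteq> carrier PLgrp" using assms by (simp add: PLgrp_def)
  show "x \<otimes>\<^bsub>PLgrp\<^esub> y \<in> K" if "x \<in> K" "y \<in> K" for x y
    using fgroupD(4)[OF assms(1) that(2,1)] by (simp add: PLgrp_def)
  show "\<one>\<^bsub>PLgrp\<^esub> \<in> K" using fgroupD(1)[OF assms(1)] by (simp add: PLgrp_def)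
  show "inv\<^bsub>PLgrp\<^esub> x \<in> K" if "x \<in> K" for x
    using fgroupD(3)[OF assms(1) that] m_inv_PLgrp[of x] that assms(2) by auto
qed

lemma generate_gen: assumes "S \<subseteq> PLo" "generate PLgrp S = H" "subgroup H PLgrp" shows "H = gen S"
proof
  have pl: "plgroup H" "H \<subseteq> PLo" using subgroup_plgroup[OF assms(3)] by auto
  have SH: "S \<subseteq> H" using assms(2) generate.incl[of _ S PLgrp] by blast
  show "gen S \<subseteq> H" by (rule gen_least[OF plgroupD(1)[OF pl(1)] SH])
  have "f \<in> gen S" if "f \<in> generate PLgrp S" for f
    using that
  proof induct
    case one
    have "\<one>\<^bsub>PLgrp\<^esub> = id" by (simp add: PLgrp_def)
    then show ?case using gen.one by metis
  next
    case (incl h)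
    then show ?case by (rule gen.incl)
  next
    case (inv h)
    then have "inv\<^bsub>PLgrp\<^esub> h = iv h" using m_inv_PLgrp assms(1) by blast
    then show ?case using gen.inverse[OF gen.incl[OF inv]] by metis
  next
    case (eng h1 h2)
    have "h1 \<otimes>\<^bsub>PLgrp\<^esub> h2 = h2 \<circ> h1" by (simp add: PLgrp_def)
    then show ?case using gen.comp[OF eng(4,2)] by metis
  qed
  then show "H \<subseteq> gen S" using assms(2) by blast
qed

text \<open>An orbital of \<open>g\<close> is an orbital of the cyclic group \<open>gen {g}\<close>;
  a connected set of moved points cannot contain its fixed ends.\<close>

lemma orbital_interval:
  assumes "plgroup H" "g \<in> H" "orbital A g"
  shows "\<exists>u v. A = {u<..<v} \<and> orbi g u v"
proof -
  have gP: "g \<in> PLa" using plgroupD(3)[OF assms(1,2)] .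
  obtain x where x: "x \<in> moved g" "A = connected_component_set (moved g) x"
    using assms(3) unfolding orbital_def by blast
  have mm: "moved g = mv g" using PLa_mv[OF gP] unfolding moved_def mv_def by auto
  have fx: "fixpts (gen {g}) = {y. g y = y}" by (subst fixpts_gen) (use PLaD(2)[OF gP] in auto)
  have pg: "plgroup (gen {g})" using plgroup_gen[OF assms(1)] assms(2) by blast
  have "x \<notin> fixpts (gen {g})" using x(1) unfolding mm fx mv_def by blast
  then obtain u v where uv: "orb (gen {g}) u v" "u < x" "x < v" using orb_exists[OF pg] by blast
  have o: "orbi g u v" using uv(1) unfolding orb_def orbi_def fx by auto
  have "{u<..<v} \<subseteq> A"
    unfolding x(2) by (rule connected_component_maximal) (use uv o in \<open>auto simp: mm mv_def orbi_def\<close>)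
  moreover have "y \<in> {u<..<v}" if y: "y \<in> A" for y
  proof (rule ccontr)
    assume n: "y \<notin> {u<..<v}"
    have con: "connected A" and xA: "x \<in> A" and sub: "A \<subseteq> mv g"
      using x connected_component_subset[of "moved g" x] unfolding x(2) mm[symmetric]
      by (simp_all add: connected_connected_component)
    have "{min x y..max x y} \<subseteq> A"
      using connected_contains_Icc[OF con] xA y by (auto simp: min_def max_def)
    moreover have "u \<in> {min x y..max x y} \<or> v \<in> {min x y..max x y}" using n uv by auto
    ultimately have "u \<in> mv g \<or> v \<in> mv g" using sub by blast
    then show False using o by (auto simp: mv_def orbi_def)
  qed
  ultimately show ?thesis using o by blast
qed

lemma tower_chain:
  assumes "plgroup H" "tower H T" "finite T"
  obtains P where "chain_of_orbitals H P" "card P = card T"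
proof -
  have T: "\<And>A g. (A, g) \<in> T \<Longrightarrow> g \<in> H \<and> orbital A g" "inj_on fst T"
    "\<And>q r. q \<in> T \<Longrightarrow> r \<in> T \<Longrightarrow> fst q \<subseteq> fst r \<or> fst r \<subseteq> fst q"
    using assms(2) unfolding tower_def signed_orbitals_def by blast+
  have "\<forall>q\<in>T. \<exists>u v. fst q = {u<..<v} \<and> orbi (snd q) u v"
    using T(1) orbital_interval[OF assms(1)] by (metis prod.collapse)
  then obtain u v where uv: "\<And>q. q \<in> T \<Longrightarrow> fst q = {u q<..<v q} \<and> orbi (snd q) (u q) (v q)" by metis
  define P where "P = (\<lambda>q. (u q, v q)) ` T"
  have "inj_on (\<lambda>q. (u q, v q)) T"
    using T(2) uv by (auto simp: inj_on_def)
  then have "card P = card T" unfolding P_def by (rule card_image)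
  moreover have "chain_of_orbitals H P"
    unfolding chain_of_orbitals_def
  proof (intro conjI)
    show "finite P" using assms(3) by (simp add: P_def)
    show "\<forall>(p, q)\<in>P. \<exists>g\<in>H. orbi g p q" unfolding P_def using uv T(1) by (force simp: prod.collapse)
    have "u r \<le> u q \<and> v q \<le> v r \<or> u q \<le> u r \<and> v r \<le> v q" if qr: "q \<in> T" "r \<in> T" for q r
    proof -
      have "u q < v q" "u r < v r" using uv[OF qr(1)] uv[OF qr(2)] by (auto simp: orbi_def)
      moreover have "{u q<..<v q} \<subseteq> {u r<..<v r} \<or> {u r<..<v r} \<subseteq> {u q<..<v q}"
        using T(3)[OF qr] uv[OF qr(1)] uv[OF qr(2)] by metis
      ultimately show ?thesis by (simp add: greaterThanLessThan_subseteq_greaterThanLessThan)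
    qed
    then show "\<forall>(p, q)\<in>P. \<forall>(p', q')\<in>P. p' \<le> p \<and> q \<le> q' \<or> p \<le> p' \<and> q' \<le> q"
      unfolding P_def by auto
  qed
  ultimately show thesis using that by blast
qed

text \<open>All positive powers of an increasing map move a point in the same direction as the map
  itself.\<close>

lemma ipow_PLa_torsion_free:
  assumes "g \<in> PLa" "g \<noteq> id" "ipow g k = id" shows "k = 0"
proof (rule ccontr)
  assume "k \<noteq> 0"
  have b: "bij g" using PLaD(2)[OF assms(1)] .
  have "ipow g (- k) = id" using ipow_inverse(1)[OF b, of k] assms(3) by (simp add: fun_eq_iff)
  define n where "n = \<bar>k\<bar>"
  have n: "n > 0" "ipow g n = id"
    using \<open>k \<noteq> 0\<close> assms(3) \<open>ipow g (- k) = id\<close> by (simp_all add: n_def abs_if)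
  obtain x where "g x \<noteq> x" using assms(2) by (auto simp: fun_eq_iff)
  then have "g x < x \<or> x < g x" by linarith
  then show False
    using ipow_less[OF assms(1), of x x n] ipow_greater[OF assms(1), of x x n] n by auto
qed

lemma Winf_case:
  assumes "subgroup H PLgrp" "ascending H g Y"
  shows "\<exists>K. subgroup K PLgrp \<and> K \<subseteq> H \<and> PLgrp\<lparr>carrier := K\<rparr> \<cong> Winf"
proof -
  have pl: "plgroup H" "H \<subseteq> PLo" using subgroup_plgroup[OF assms(1)] by auto
  have a: "g n \<in> H" "g 0 \<noteq> id" "Y n \<subseteq> Y (Suc n)" "p \<notin> Y n \<Longrightarrow> g n p = p"
    "k \<noteq> 0 \<Longrightarrow> x \<in> Y n \<Longrightarrow> ipow (g (Suc n)) k x \<notin> Y n" for n p k x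
    using assms(2) unfolding ascending_def mv_def by blast+
  have t: "ipow (g 0) k = id \<Longrightarrow> k = 0" for k
    using ipow_PLa_torsion_free[OF plgroupD(3)[OF pl(1) a(1)] a(2)] .
  obtain \<psi> where \<psi>: "inj_on \<psi> (carrier Winf)" "\<psi> ` carrier Winf \<subseteq> H" "fgroup (\<psi> ` carrier Winf)"
    "\<And>x y. x \<in> carrier Winf \<Longrightarrow> y \<in> carrier Winf \<Longrightarrow>
      x \<otimes>\<^bsub>Winf\<^esub> y \<in> carrier Winf \<and> \<psi> (x \<otimes>\<^bsub>Winf\<^esub> y) = \<psi> y \<circ> \<psi> x"
    using Winf_embeds[of H g Y, OF plgroupD(1)[OF pl(1)] a t] by metis
  define K where "K = \<psi> ` carrier Winf"
  have K: "subgroup K PLgrp" "K \<subseteq> H"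
    using plgroup_subgroup[of K] \<psi>(2,3) pl(2) unfolding K_def by auto
  define \<theta> where "\<theta> = inv_into (carrier Winf) \<psi>"
  have \<theta>: "\<theta> f \<in> carrier Winf" "\<psi> (\<theta> f) = f" if "f \<in> K" for f
    using that unfolding \<theta>_def K_def by (simp_all add: inv_into_into f_inv_into_f)
  have "\<theta> \<in> iso (PLgrp\<lparr>carrier := K\<rparr>) Winf"
    unfolding iso_def hom_def
  proof (intro CollectI conjI ballI)
    show "\<theta> \<in> carrier (PLgrp\<lparr>carrier := K\<rparr>) \<rightarrow> carrier Winf" using \<theta>(1) by simp
    show "bij_betw \<theta> (carrier (PLgrp\<lparr>carrier := K\<rparr>)) (carrier Winf)"
      unfolding \<theta>_def K_def using bij_betw_inv_into[of \<psi> "carrier Winf" "\<psi> ` carrier Winf"] \<psi>(1)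
      by (simp add: bij_betw_def)
    fix f h assume "f \<in> carrier (PLgrp\<lparr>carrier := K\<rparr>)" "h \<in> carrier (PLgrp\<lparr>carrier := K\<rparr>)"
    then have fh: "f \<in> K" "h \<in> K" by simp_all
    have m: "\<theta> f \<otimes>\<^bsub>Winf\<^esub> \<theta> h \<in> carrier Winf" "\<psi> (\<theta> f \<otimes>\<^bsub>Winf\<^esub> \<theta> h) = h \<circ> f"
      using \<psi>(4)[OF \<theta>(1)[OF fh(1)] \<theta>(1)[OF fh(2)]] \<theta>(2)[OF fh(1)] \<theta>(2)[OF fh(2)] by auto
    have "\<theta> (h \<circ> f) = \<theta> f \<otimes>\<^bsub>Winf\<^esub> \<theta> h" unfolding m(2)[symmetric] \<theta>_def
      by (rule inv_into_f_f[OF \<psi>(1)]) (use m(1) \<theta>_def in simp)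
    then show "\<theta> (f \<otimes>\<^bsub>PLgrp\<lparr>carrier := K\<rparr>\<^esub> h) = \<theta> f \<otimes>\<^bsub>Winf\<^esub> \<theta> h" by (simp add: PLgrp_def)
  qed
  then show ?thesis using K unfolding is_iso_def by blast
qed

section \<open>Identification of the permutation wreath power, and conclusion\<close>

lemma group_SymR: "group SymR"
proof (rule groupI)
  show "x \<otimes>\<^bsub>SymR\<^esub> y \<in> carrier SymR" if "x \<in> carrier SymR" "y \<in> carrier SymR" for x y
    using that by (simp add: SymR_def bij_comp)
  show "\<one>\<^bsub>SymR\<^esub> \<in> carrier SymR" unfolding SymR_def by (simp del: id_apply)
  show "x \<otimes>\<^bsub>SymR\<^esub> y \<otimes>\<^bsub>SymR\<^esub> z = x \<otimes>\<^bsub>SymR\<^esub> (y \<otimes>\<^bsub>SymR\<^esub> z)"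
    if "x \<in> carrier SymR" "y \<in> carrier SymR" "z \<in> carrier SymR" for x y z
    by (simp add: SymR_def o_assoc)
  show "\<one>\<^bsub>SymR\<^esub> \<otimes>\<^bsub>SymR\<^esub> x = x" if "x \<in> carrier SymR" for x by (simp add: SymR_def)
  show "\<exists>y\<in>carrier SymR. y \<otimes>\<^bsub>SymR\<^esub> x = \<one>\<^bsub>SymR\<^esub>" if "x \<in> carrier SymR" for x
  proof (rule bexI[of _ "iv x"])
    show "iv x \<in> carrier SymR" using that by (simp add: SymR_def bij_imp_bij_inv)
    show "iv x \<otimes>\<^bsub>SymR\<^esub> x = \<one>\<^bsub>SymR\<^esub>" using that by (simp add: SymR_def fun_eq_iff bij_iv_simps)
  qed
qed

lemma m_inv_SymR: assumes "bij x" shows "inv\<^bsub>SymR\<^esub> x = iv x"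
proof (rule group.inv_equality[OF group_SymR])
  show "iv x \<otimes>\<^bsub>SymR\<^esub> x = \<one>\<^bsub>SymR\<^esub>" using assms by (simp add: SymR_def fun_eq_iff bij_iv_simps)
qed (use assms in \<open>simp_all add: SymR_def bij_imp_bij_inv\<close>)

context wandering_descent
begin

lemma Pset_fgroup: "fgroup (Pset k)"
proof (cases k)
  case 0
  have "iv id = (id :: (nat \<Rightarrow> int) \<Rightarrow> _)" by (rule inv_id)
  then show ?thesis using 0 unfolding fgroup_def Pset.simps by (simp only: 0 Pset.simps) auto
next
  case (Suc j)
  define A where "A = Pset j \<union> {pbase j c y |c y. True}"
  have bijP: "bij q" if "q \<in> Pset i" for q i
    using that
  proof (induct i arbitrary: q)
    case 0
    then show ?case by (metis Pset.simps(1) bij_id singletonD)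
  next
    case (Suc i)
    have "Pset i \<union> {pbase i c y |c y. True} \<subseteq> carrier SymR" using Suc.hyps bij_pbase by (auto simp: SymR_def)
    then have "Pset (Suc i) \<subseteq> carrier SymR"
      using subgroup.subset[OF group.generate_is_subgroup[OF group_SymR]] by simp
    then show ?case using Suc.prems by (auto simp: SymR_def)
  qed
  have "A \<subseteq> carrier SymR" unfolding A_def using bijP bij_pbase by (auto simp: SymR_def)
  then have sg: "subgroup (Pset k) SymR"
    using group.generate_is_subgroup[OF group_SymR] by (simp add: Suc A_def)
  show ?thesis
    unfolding fgroup_def
  proof (intro conjI ballI)
    show "id \<in> Pset k" using subgroup.one_closed[OF sg] unfolding SymR_def by (simp del: id_apply)
    fix f assume f: "f \<in> Pset k"
    show b: "bij f" using bijP[OF f] .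
    show "iv f \<in> Pset k" using subgroup.m_inv_closed[OF sg f] m_inv_SymR[OF b] by simp
    fix g assume g: "g \<in> Pset k"
    show "f \<circ> g \<in> Pset k" using subgroup.m_closed[OF sg g f] by (simp add: SymR_def)
  qed
qed

lemma Pset_union: "(\<Union>k. Pset k) = gen (range p)"
proof
  have "Pset k \<subseteq> gen (range p)" for k
  proof (induct k)
    case 0
    then show ?case using gen.one by (metis Pset.simps(1) empty_subsetI insert_subset)
  next
    case (Suc k)
    show ?case
    proof
      fix q assume "q \<in> Pset (Suc k)"
      then have "q \<in> generate SymR (Pset k \<union> {pbase k c y |c y. True})" by simp
      then show "q \<in> gen (range p)"
      proof induct
        case one
        have "\<one>\<^bsub>SymR\<^esub> = id" by (simp add: SymR_def)
        then show ?case using gen.one by metis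
      next
        case (incl h)
        then show ?case using Suc pbase_gen by blast
      next
        case (inv h)
        then have h: "h \<in> gen (range p)" using Suc pbase_gen by blast
        show ?case unfolding m_inv_SymR[OF fgroupD(2)[OF fgroup_p h]] by (rule gen.inverse[OF h])
      next
        case (eng h1 h2)
        have "h1 \<otimes>\<^bsub>SymR\<^esub> h2 = h2 \<circ> h1" by (simp add: SymR_def)
        then show ?case using gen.comp[OF eng(4,2)] by metis
      qed
    qed
  qed
  then show "(\<Union>k. Pset k) \<subseteq> gen (range p)" by blast
  have mono: "Pset k \<subseteq> Pset m" if "k \<le> m" for k m
    using that by (induct m rule: dec_induct) (auto intro: generate.incl)
  have fg: "fgroup (\<Union>k. Pset k)"
    unfolding fgroup_def
  proof (intro conjI ballI)
    show "id \<in> (\<Union>k. Pset k)" using fgroupD(1)[OF Pset_fgroup[of 0]] by blast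
    fix f assume "f \<in> (\<Union>k. Pset k)"
    then obtain k where k: "f \<in> Pset k" by blast
    show "bij f" "iv f \<in> (\<Union>k. Pset k)" using fgroupD(2,3)[OF Pset_fgroup k] by blast+
    fix g assume "g \<in> (\<Union>k. Pset k)"
    then obtain m where m: "g \<in> Pset m" by blast
    have "f \<in> Pset (max k m)" "g \<in> Pset (max k m)" using k m mono[of k "max k m"] mono[of m "max k m"] by auto
    then show "f \<circ> g \<in> (\<Union>k. Pset k)" using fgroupD(4)[OF Pset_fgroup] by blast
  qed
  have "p i \<in> Pset (Suc i)" for i
    unfolding p_def Pset.simps by (rule generate.incl) blast
  then show "gen (range p) \<subseteq> (\<Union>k. Pset k)" by (intro gen_least[OF fg]) blast
qed

end

lemma Pinf_case:
  assumes "subgroup H PLgrp" "descending H h Y"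
  shows "\<exists>K. subgroup K PLgrp \<and> K \<subseteq> H \<and> PLgrp\<lparr>carrier := K\<rparr> \<cong> Pinf"
proof -
  have pl: "plgroup H" "H \<subseteq> PLo" using subgroup_plgroup[OF assms(1)] by auto
  have a: "h n \<in> H" "Y (Suc n) \<subseteq> Y n" "Y n \<noteq> {}" "x \<notin> Y n \<Longrightarrow> h n x = x"
    "k \<noteq> 0 \<Longrightarrow> x \<in> Y (Suc n) \<Longrightarrow> ipow (h n) k x \<notin> Y (Suc n)" for n k x
    using assms(2) unfolding descending_def mv_def by blast+
  interpret wandering_descent h Y
    by unfold_locales (rule plgroupD(5)[OF pl(1) a(1)], rule a(2), rule a(3), erule a(4), rule a(5))
  have hr: "range h \<subseteq> H" using a(1) by blast
  define K where "K = gen (range h)"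
  have KH: "K \<subseteq> H" unfolding K_def by (rule gen_least[OF plgroupD(1)[OF pl(1)] hr])
  have fK: "fgroup K" unfolding K_def by (rule fgroup_gen) (use hr plgroupD(5)[OF pl(1)] in blast)
  have K: "subgroup K PLgrp" by (rule plgroup_subgroup[OF fK subset_trans[OF KH pl(2)]])
  have "\<forall>w. \<exists>\<sigma>. w \<in> K \<longrightarrow> \<sigma> \<in> gen (range p) \<and> corr w \<sigma>" using corr_total unfolding K_def by blast
  then obtain \<theta> where \<theta>: "\<And>w. w \<in> K \<Longrightarrow> \<theta> w \<in> gen (range p) \<and> corr w (\<theta> w)" by metis
  have cP: "carrier Pinf = gen (range p)" unfolding Pinf_def by (simp add: Pset_union)
  have "\<theta> \<in> iso (PLgrp\<lparr>carrier := K\<rparr>) Pinf"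
    unfolding iso_def hom_def
  proof (intro CollectI conjI ballI)
    show "\<theta> \<in> carrier (PLgrp\<lparr>carrier := K\<rparr>) \<rightarrow> carrier Pinf" using \<theta> cP by simp
    have "inj_on \<theta> K"
    proof (rule inj_onI)
      fix v w assume vw: "v \<in> K" "w \<in> K" "\<theta> v = \<theta> w"
      have "corr v (\<theta> v)" "corr w (\<theta> w)" using \<theta> vw by blast+
      from corr_eq_iff[OF this] vw(3) show "v = w" by blast
    qed
    moreover have "\<theta> ` K = gen (range p)"
    proof (intro equalityI subsetI)
      show "\<sigma> \<in> gen (range p)" if "\<sigma> \<in> \<theta> ` K" for \<sigma> using that \<theta> by blast
      show "\<sigma> \<in> \<theta> ` K" if \<sigma>: "\<sigma> \<in> gen (range p)" for \<sigma>
      proof -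
        obtain w where w: "w \<in> K" "corr w \<sigma>" using corr_onto[OF \<sigma>] unfolding K_def by blast
        have "corr w (\<theta> w)" using \<theta> w by blast
        from corr_eq_iff[OF w(2) this] have "\<sigma> = \<theta> w" by blast
        then show ?thesis using w by blast
      qed
    qed
    ultimately show "bij_betw \<theta> (carrier (PLgrp\<lparr>carrier := K\<rparr>)) (carrier Pinf)" unfolding cP by (simp add: bij_betw_def)
    fix v w assume "v \<in> carrier (PLgrp\<lparr>carrier := K\<rparr>)" "w \<in> carrier (PLgrp\<lparr>carrier := K\<rparr>)"
    then have vw: "v \<in> K" "w \<in> K" by simp_all
    have "corr (w \<circ> v) (\<theta> w \<circ> \<theta> v)" using corr_comp \<theta> vw by blast
    moreover have "corr (w \<circ> v) (\<theta> (w \<circ> v))" using \<theta> fgroupD(4)[OF fK vw(2,1)] by blast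
    ultimately have "\<theta> (w \<circ> v) = \<theta> w \<circ> \<theta> v" using corr_eq_iff by metis
    then show "\<theta> (v \<otimes>\<^bsub>PLgrp\<lparr>carrier := K\<rparr>\<^esub> w) = \<theta> v \<otimes>\<^bsub>Pinf\<^esub> \<theta> w" by (simp add: PLgrp_def Pinf_def SymR_def)
  qed
  then show ?thesis using K KH unfolding is_iso_def by blast
qed

theorem theorem9:
  fixes H :: "(real \<Rightarrow> real) set"
  assumes "subgroup H PLgrp"
    and "\<exists>S. finite S \<and> S \<subseteq> PLo \<and> generate PLgrp S = H"
    and "\<forall>n::nat. \<exists>T. tower H T \<and> finite T \<and> card T \<ge> n"
  shows "(\<exists>K. subgroup K PLgrp \<and> K \<subseteq> H \<and> PLgrp\<lparr>carrier := K\<rparr> \<cong> Winf)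
       \<or> (\<exists>K. subgroup K PLgrp \<and> K \<subseteq> H \<and> PLgrp\<lparr>carrier := K\<rparr> \<cong> Pinf)"
proof -
  have pl: "plgroup H" using subgroup_plgroup[OF assms(1)] by blast
  obtain S where S: "finite S" "S \<subseteq> PLo" "generate PLgrp S = H" using assms(2) by blast
  have gS: "H = gen S" by (rule generate_gen[OF S(2,3) assms(1)])
  have "\<not> fsolvable H"
  proof
    assume "fsolvable H"
    then obtain d where d: "dseries H d \<subseteq> {id}" by blast
    obtain T where T: "tower H T" "finite T" "card T \<ge> Suc d" using assms(3) by blast
    obtain P where "chain_of_orbitals H P" "card P = card T" using tower_chain[OF pl T(1,2)] by blast
    then show False using tower_bound[OF pl gS S(1) d, of P] T(3) by simp
  qed
  then obtain g Y where "ascending H g Y \<or> descending H g Y"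
    using ascending_or_descending[OF pl gS S(1)] by blast
  then show ?thesis using Winf_case[OF assms(1)] Pinf_case[OF assms(1)] by blast
qed

end
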